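(* Let $\mathbb{F}$ be a field and let $m$, $n$, $r\le\min\{m,n\}$ be positive integers. Let $\epsilon_1(s)\mid\dots\mid\epsilon_r(s)$ and $\psi_r(s)\mid\dots\mid\psi_1(s)$ be monic polynomials in $\mathbb{F}[s]$ such that $\frac{\epsilon_i(s)}{\psi_i(s)}$ are irreducible rational functions for $i=1,\dots,r$. Let $q_1\le\dots\le q_r$ be integers. Let $(k_1,\dots,k_r)$, $(\ell_1,\dots,\ell_r)$, $(d_1,\dots,d_{n-r})$, $(v_1,\dots,v_{m-r})$ be partitions of non negative integers. Let $g_1\ge\dots\ge g_r$ be the decreasing reordering of $k_r+\ell_1,\,k_{r-1}+\ell_2,\dots,k_1+\ell_r$. Consider the conditions (a) $\sum_{i=1}^{m-r}v_i=\sum_{i=1}^r k_i$ and $\sum_{i=1}^{n-r}d_i=\sum_{i=1}^r\ell_i$; (b) $(-g_r,\dots,-g_1)\prec(\deg(\epsilon_r)-\deg(\psi_r)+q_r,\dots,\deg(\epsilon_1)-\deg(\psi_1)+q_1)$. (Necessity, arbitrary field.) If $R(s)\in\mathbb{F}(s)^{m\times n}$ is a rational matrix with $\operatorname{rank}(R(s))=r$, $\frac{\epsilon_1(s)}{\psi_1(s)},\dots,\frac{\epsilon_r(s)}{\psi_r(s)}$ as invariant rational functions, $q_1,\dots,q_r$ as invariant orders at $\infty$, $k_1,\dots,k_r$ as col-span minimal indices, $\ell_1,\dots,\ell_r$ as row-span minimal indices, and $d_1,\dots,d_{n-r}$ and $v_1,\dots,v_{m-r}$ as right and left minimal indices, respectively,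 then (a) and (b) hold. (Sufficiency.) Conversely, if $\mathbb{F}$ is algebraically closed, conditions (a) and (b) are sufficient for the existence of a rational matrix $R(s)\in\mathbb{F}(s)^{m\times n}$ with $\operatorname{rank}(R(s))=r$, $\frac{\epsilon_1(s)}{\psi_1(s)},\dots,\frac{\epsilon_r(s)}{\psi_r(s)}$ as invariant rational functions, $q_1,\dots,q_r$ as invariant orders at $\infty$, $k_1,\dots,k_r$ as col-span minimal indices, $\ell_1,\dots,\ell_r$ as row-span minimal indices, and $d_1,\dots,d_{n-r}$ and $v_1,\dots,v_{m-r}$ as right and left minimal indices, respectively.
   Context: $\mathbb{F}[s]$ is the ring of polynomials and $\mathbb{F}(s)$ its field of fractions; a rational matrix is a matrix with entries in $\mathbb{F}(s)$, and its rank is its rank over $\mathbb{F}(s)$. Empty sums are $0$. Invariant rational functions: for $R(s)\in\mathbb{F}(s)^{m\times n}$ of rank $r$ there are unimodular matrices $U(s),V(s)$ (square polynomial matrices with polynomial inverse) such that $U(s)R(s)V(s)=\begin{bmatrix}\operatorname{diag}\left(\frac{\epsilon_1(s)}{\psi_1(s)},\dots,\frac{\epsilon_r(s)}{\psi_r(s)}\right)&0\\0&0\end{bmatrix}$ (Smith--McMillan form), with $\epsilon_1\mid\dots\mid\epsilon_r$ and $\psi_r\mid\dots\mid\psi_1$ monic polynomials and each $\epsilon_i/\psi_i$ irreducible (numerator and denominator coprime). These fractions are uniquely determined and are the (finite) invariant rational functions of $R(s)$. Invariant orders at infinity: a rational function is proper if the degree of its numerator is at most that of its denominator; a biproper matrix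 is an invertible square matrix of proper rational functions whose inverse also has proper entries. For $R(s)$ of rank $r$ there are biproper matrices $B_1(s),B_2(s)$ with $B_1(s)R(s)B_2(s)=\begin{bmatrix}\operatorname{diag}(s^{-q_1},\dots,s^{-q_r})&0\\0&0\end{bmatrix}$, where $q_1\le\dots\le q_r$ are uniquely determined integers, called the invariant orders at infinity of $R(s)$. For $P(s)\in\mathbb{F}(s)^{m\times n}$, $\mathcal{R}(P(s))\subseteq\mathbb{F}(s)^m$ is the $\mathbb{F}(s)$-subspace spanned by the columns of $P(s)$; $\mathcal{N}_r(P(s))=\{x(s)\in\mathbb{F}(s)^n: P(s)x(s)=0\}$ and $\mathcal{N}_\ell(P(s))=\{x(s)\in\mathbb{F}(s)^m: x(s)^TP(s)=0\}$. A polynomial basis of a subspace $\mathcal{V}$ of $\mathbb{F}(s)^p$ is a basis consisting of polynomial vectors; its order is the sum of the degrees of its vectors (degree of a vector = maximum degree of its entries). A minimal basis of $\mathcal{V}$ is a polynomial basis of least order. The decreasingly ordered list of degrees of the vectors is the same for all minimal bases of $\mathcal{V}$; these degrees are the minimal indices of $\mathcal{V}$. The col-span, row-span, right and left minimal indices of $P(s)$ are the minimal indices of $\mathcal{R}(P(s))$, $\mathcal{R}(P(s)^T)$, $\mathcal{N}_r(P(s))$ and $\mathcal{N}_\ell(P(s))$, respectively, each ordered decreasingly. A partition is a non-increasing sequence of non negative integers. For sequences of integers $a_1\ge\dots\ge a_r$ and $b_1\ge\dots\ge b_r$, $(a_1,\dots,a_r)\prec(b_1,\dots,b_r)$ (majorization)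 means $\sum_{i=1}^k a_i\le\sum_{i=1}^k b_i$ for $1\le k\le r-1$ and $\sum_{i=1}^r a_i=\sum_{i=1}^r b_i$. *)

theory Defs
  imports
    "Jordan_Normal_Form.DL_Rank"
    "Jordan_Normal_Form.Matrix_Kernel"
    "HOL-Computational_Algebra.Polynomial_Factorial"
begin

text \<open>
  The field of rational functions is \<open>'a poly fract\<close>, and \<open>to_fract\<close> embeds the polynomials in it.
  A sequence \<open>x\<^sub>1, \<dots>, x\<^sub>r\<close> is a list of length \<open>r\<close>, so that \<open>x\<^sub>i\<close> is \<open>x ! (i - 1)\<close>.
\<close>

type_synonym 'a ratfun = "'a poly fract"

definition algebraically_closed :: "'a::field itself \<Rightarrow> bool" where
  "algebraically_closed _ \<longleftrightarrow> (\<forall>p :: 'a poly. degree p > 0 \<longrightarrow> (\<exists>x. poly p x = 0))"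


subsection \<open>Invariant rational functions\<close>

text \<open>
  Invertibility is over the polynomial ring: the inverse required by \<^const>\<open>invertible_mat\<close>
  is again a polynomial matrix.
\<close>

definition unimodular :: "'a::field poly mat \<Rightarrow> bool" where
  "unimodular U \<longleftrightarrow> invertible_mat U"

definition invariant_fraction_data :: "'a::field poly list \<Rightarrow> 'a poly list \<Rightarrow> bool" where
  "invariant_fraction_data eps psi \<longleftrightarrow>
     length psi = length eps \<and>
     (\<forall>i < length eps. lead_coeff (eps ! i) = 1 \<and> lead_coeff (psi ! i) = 1 \<and>
        coprime (eps ! i) (psi ! i)) \<and>
     (\<forall>i. Suc i < length eps \<longrightarrow> eps ! i dvd eps ! Suc i \<and> psi ! Suc i dvd psi ! i)"

definition padded_diag_mat :: "nat \<Rightarrow> nat \<Rightarrow> 'b::zero list \<Rightarrow> 'b mat" where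
  "padded_diag_mat m n xs = mat m n (\<lambda>(i, j). if i = j \<and> i < length xs then xs ! i else 0)"

definition has_invariant_rational_functions ::
    "'a::field ratfun mat \<Rightarrow> 'a poly list \<Rightarrow> 'a poly list \<Rightarrow> bool" where
  "has_invariant_rational_functions R eps psi \<longleftrightarrow>
     length eps = vec_space.rank (dim_row R) R \<and>
     invariant_fraction_data eps psi \<and>
     (\<exists>U \<in> carrier_mat (dim_row R) (dim_row R). \<exists>V \<in> carrier_mat (dim_col R) (dim_col R).
        unimodular U \<and> unimodular V \<and>
        map_mat to_fract U * R * map_mat to_fract V =
          padded_diag_mat (dim_row R) (dim_col R) (map2 Fract eps psi))"


subsection \<open>Invariant orders at infinity\<close>

definition proper_ratfun :: "'a::field ratfun \<Rightarrow> bool" where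
  "proper_ratfun x \<longleftrightarrow> (\<exists>p q. q \<noteq> 0 \<and> x = Fract p q \<and> degree p \<le> degree q)"

definition proper_mat :: "'a::field ratfun mat \<Rightarrow> bool" where
  "proper_mat B \<longleftrightarrow> (\<forall>i < dim_row B. \<forall>j < dim_col B. proper_ratfun (B $$ (i, j)))"

definition biproper :: "'a::field ratfun mat \<Rightarrow> bool" where
  "biproper B \<longleftrightarrow> square_mat B \<and> proper_mat B \<and>
     (\<exists>C. inverts_mat B C \<and> inverts_mat C B \<and> proper_mat C)"

definition has_invariant_orders_at_infinity :: "'a::field ratfun mat \<Rightarrow> int list \<Rightarrow> bool" where
  "has_invariant_orders_at_infinity R q \<longleftrightarrow>
     length q = vec_space.rank (dim_row R) R \<and> sorted q \<and>
     (\<exists>B1 \<in> carrier_mat (dim_row R) (dim_row R). \<exists>B2 \<in> carrier_mat (dim_col R) (dim_col R).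
        biproper B1 \<and> biproper B2 \<and>
        B1 * R * B2 =
          padded_diag_mat (dim_row R) (dim_col R) (map (\<lambda>e. to_fract [:0, 1:] powi (- e)) q))"


subsection \<open>Minimal indices\<close>

definition vec_degree :: "'a::zero poly vec \<Rightarrow> nat" where
  "vec_degree v = Max (degree ` {v $ i | i. i < dim_vec v})"

definition polynomial_basis ::
    "nat \<Rightarrow> 'a::field ratfun vec set \<Rightarrow> 'a poly vec list \<Rightarrow> bool" where
  "polynomial_basis p V bs \<longleftrightarrow>
     set bs \<subseteq> carrier_vec p \<and> distinct bs \<and>
     \<not> LinearCombinations.module.lin_dep class_ring (module_vec TYPE('a ratfun) p)
         (map_vec to_fract ` set bs) \<and>
     LinearCombinations.module.span class_ring (module_vec TYPE('a ratfun) p)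
         (map_vec to_fract ` set bs) = V"

definition basis_order :: "'a::zero poly vec list \<Rightarrow> nat" where
  "basis_order bs = sum_list (map vec_degree bs)"

definition minimal_basis ::
    "nat \<Rightarrow> 'a::field ratfun vec set \<Rightarrow> 'a poly vec list \<Rightarrow> bool" where
  "minimal_basis p V bs \<longleftrightarrow> polynomial_basis p V bs \<and>
     (\<forall>cs. polynomial_basis p V cs \<longrightarrow> basis_order bs \<le> basis_order cs)"

text \<open>
  Since the ordered list of degrees is the same for all minimal bases, it does not matter which
  minimal basis is used.
\<close>

definition has_minimal_indices :: "nat \<Rightarrow> 'a::field ratfun vec set \<Rightarrow> nat list \<Rightarrow> bool" where
  "has_minimal_indices p V ks \<longleftrightarrow>
     (\<exists>bs. minimal_basis p V bs \<and> ks = rev (sort (map vec_degree bs)))"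

definition left_null_space :: "'a::comm_ring_1 mat \<Rightarrow> 'a vec set" where
  "left_null_space P =
     {x \<in> carrier_vec (dim_row P). mat_of_row x * P = 0\<^sub>m 1 (dim_col P)}"

definition has_colspan_minimal_indices :: "'a::field ratfun mat \<Rightarrow> nat list \<Rightarrow> bool" where
  "has_colspan_minimal_indices P ks \<longleftrightarrow>
     has_minimal_indices (dim_row P) (vec_space.col_space (dim_row P) P) ks"

definition has_rowspan_minimal_indices :: "'a::field ratfun mat \<Rightarrow> nat list \<Rightarrow> bool" where
  "has_rowspan_minimal_indices P ks \<longleftrightarrow>
     has_minimal_indices (dim_col P) (vec_space.col_space (dim_col P) P\<^sup>T) ks"

definition has_right_minimal_indices :: "'a::field ratfun mat \<Rightarrow> nat list \<Rightarrow> bool" where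
  "has_right_minimal_indices P ks \<longleftrightarrow> has_minimal_indices (dim_col P) (mat_kernel P) ks"

definition has_left_minimal_indices :: "'a::field ratfun mat \<Rightarrow> nat list \<Rightarrow> bool" where
  "has_left_minimal_indices P ks \<longleftrightarrow> has_minimal_indices (dim_row P) (left_null_space P) ks"

definition has_structural_data ::
    "'a::field ratfun mat \<Rightarrow> nat \<Rightarrow> 'a poly list \<Rightarrow> 'a poly list \<Rightarrow> int list \<Rightarrow>
     nat list \<Rightarrow> nat list \<Rightarrow> nat list \<Rightarrow> nat list \<Rightarrow> bool" where
  "has_structural_data R r eps psi q k l d v \<longleftrightarrow>
     vec_space.rank (dim_row R) R = r \<and>
     has_invariant_rational_functions R eps psi \<and>
     has_invariant_orders_at_infinity R q \<and>
     has_colspan_minimal_indices R k \<and>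
     has_rowspan_minimal_indices R l \<and>
     has_right_minimal_indices R d \<and>
     has_left_minimal_indices R v"


subsection \<open>Partitions and majorization\<close>

definition is_partition :: "nat list \<Rightarrow> bool" where
  "is_partition xs \<longleftrightarrow> sorted_wrt (\<ge>) xs"

text \<open>Majorization is meant for decreasingly ordered lists; the order is not part of the relation.\<close>

definition majorized_by :: "int list \<Rightarrow> int list \<Rightarrow> bool" where
  "majorized_by a b \<longleftrightarrow> length a = length b \<and>
     (\<forall>j \<in> {1..<length a}. sum_list (take j a) \<le> sum_list (take j b)) \<and>
     sum_list a = sum_list b"


subsection \<open>The two conditions\<close>

definition index_sum_condition ::
    "nat list \<Rightarrow> nat list \<Rightarrow> nat list \<Rightarrow> nat list \<Rightarrow> bool" where
  "index_sum_condition k l d v \<longleftrightarrow> sum_list v = sum_list k \<and> sum_list d = sum_list l"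

definition reordered_sums :: "nat list \<Rightarrow> nat list \<Rightarrow> nat list" where
  "reordered_sums k l = rev (sort (map2 (+) (rev k) l))"

definition majorization_condition ::
    "nat \<Rightarrow> 'a::field poly list \<Rightarrow> 'a poly list \<Rightarrow> int list \<Rightarrow> nat list \<Rightarrow> bool" where
  "majorization_condition r eps psi q g \<longleftrightarrow>
     majorized_by
       (map (\<lambda>i. - int (g ! i)) (rev [0..<r]))
       (map (\<lambda>i. int (degree (eps ! i)) - int (degree (psi ! i)) + q ! i) (rev [0..<r]))"

end

theory Submission
  imports Defs
begin

text \<open>
  The finite structure of a rational matrix is its structure under multiplication by matrices that are
  invertible over the polynomials, and the structure at infinity is the same notion for the proper
  functions. Both are treated together as structures over a subring of the field of rational functions.
  The two subrings meet in the notion of a \<open>reduced\<close> matrix, and the minimal bases of a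
  subspace are the reduced matrices with that column space (\<open>minimal_basis_reduced\<close>,
  \<open>reduced_minimal_basis\<close>): a relation among the columns modulo a prime, or among their leading
  coefficients, is exactly what allows a basis vector to be replaced by one of smaller degree.

  If \<open>K\<close> and \<open>L\<close> are minimal bases of the column space and the row space of \<open>R\<close>, then
  \<open>R = K E L\<^sup>T\<close> with \<open>E\<close> square and nonsingular. As \<open>K\<close> and \<open>L\<close> can be completed to
  unimodular matrices, \<open>E\<close> has the finite structure of \<open>R\<close>. As their columns divided by the powers of
  \<open>s\<close> given by the minimal indices can be completed to biproper matrices, \<open>D\<^sub>k E D\<^sub>l\<close> has the structure
  of \<open>R\<close> at infinity, where \<open>D\<^sub>k\<close> and \<open>D\<^sub>l\<close> are the diagonal matrices of these powers. So the
  subspaces contribute only condition (a), and the rest is about \<open>E\<close>.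

  Condition (a) compares a minimal basis of the column space with one of the left null space. Together they
  give a unimodular and a biproper matrix whose quotient is block triangular with powers of \<open>s\<close> on the
  diagonal; its determinant has degree 0 (\<open>reduced_dual_sum\<close>).

  Necessity of (b) is a comparison of minors. A minor of size \<open>t\<close> of \<open>E\<close> is a polynomial multiple of
  the product of the first \<open>t\<close> invariant fractions, which bounds its degree below, and the structure at
  infinity bounds its degree above. The bound obtained involves the indices \<open>k\<^sub>i\<close> of the selected rows
  and \<open>l\<^sub>j\<close> of the selected columns. Pairing increasing indices with decreasing ones, as in the
  definition of \<open>g\<close>, is the worst case: elimination in \<open>E\<close> always finds a nonzero minor whose indices
  have at least the sum of the \<open>t\<close> largest \<open>g\<^sub>i\<close> (\<open>nonzero_minor_of_large_weight\<close>).

  For sufficiency, \<open>K\<close> and \<open>L\<close> with prescribed minimal indices, also of the null spaces, are explicit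
  sparse matrices of monomials (\<open>reduced_dual_exists\<close>). The matrix \<open>E\<close> is built as an upper triangular
  polynomial matrix, one row and column at a time, following the usual reduction of a majorization to
  a shorter one (\<open>square_matrix_exists\<close>). Each step moves part of the degree of an invariant polynomial,
  and part of the difference of two orders at infinity, to the diagonal. This needs a divisor of
  prescribed degree of a given polynomial, which exists over an algebraically closed field.
\<close>

section \<open>Rational functions\<close>

abbreviation polys :: "'a::field ratfun set" where
  "polys \<equiv> range to_fract"

abbreviation propers :: "'a::field ratfun set" where
  "propers \<equiv> Collect proper_ratfun"

definition spow :: "int \<Rightarrow> 'a::field ratfun" where
  "spow n = to_fract [:0, 1:] powi n"

text \<open>The negative of the valuation at infinity. Its value at 0 is unspecified, which is why bounds on it
  below have the form \<open>x = 0 \<or> rdeg x \<le> d\<close>.\<close>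

definition rdeg :: "'a::field ratfun \<Rightarrow> int" where
  "rdeg x = (SOME n. \<exists>p q. p \<noteq> 0 \<and> q \<noteq> 0 \<and> x = Fract p q \<and> n = int (degree p) - int (degree q))"

lemma rdeg_Fract:
  assumes "p \<noteq> 0" "q \<noteq> 0"
  shows "rdeg (Fract p q) = int (degree p) - int (degree q)"
proof -
  have "int (degree a) - int (degree b) = int (degree p) - int (degree q)"
    if "a \<noteq> 0" "b \<noteq> 0" "Fract p q = Fract a b" for a b
  proof -
    have "p * b = a * q" using that assms by (simp add: eq_fract)
    then have "degree p + degree b = degree a + degree q"
      using degree_mult_eq that assms by metis
    then show ?thesis by linarith
  qed
  then show ?thesis unfolding rdeg_def using assms by (intro some_equality) blast+
qed

lemma ratfun_nonzeroE:
  fixes x :: "'a::field ratfun"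
  assumes "x \<noteq> 0"
  obtains p q where "p \<noteq> 0" "q \<noteq> 0" "x = Fract p q"
  using assms by (cases x) (auto simp: Zero_fract_def eq_fract)

lemma rdeg_mult:
  assumes "x \<noteq> 0" "y \<noteq> 0"
  shows "rdeg (x * y) = rdeg x + rdeg y"
proof -
  obtain p q p' q' where "p \<noteq> 0" "q \<noteq> 0" "x = Fract p q" "p' \<noteq> 0" "q' \<noteq> 0" "y = Fract p' q'"
    using assms by (metis ratfun_nonzeroE)
  then show ?thesis by (simp add: rdeg_Fract degree_mult_eq)
qed

lemma rdeg_to_fract: "p \<noteq> 0 \<Longrightarrow> rdeg (to_fract p) = int (degree p)"
  by (simp add: to_fract_def rdeg_Fract)

lemma rdeg_one [simp]: "rdeg 1 = 0"
  using rdeg_to_fract[of 1] by simp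

lemma rdeg_inverse: "x \<noteq> 0 \<Longrightarrow> rdeg (inverse x) = - rdeg x"
  using rdeg_mult[of x "inverse x"] by simp

lemma rdeg_divide: "x \<noteq> 0 \<Longrightarrow> y \<noteq> 0 \<Longrightarrow> rdeg (x / y) = rdeg x - rdeg y"
  by (simp add: divide_inverse rdeg_mult rdeg_inverse)

lemma rdeg_uminus [simp]: "rdeg (- x) = rdeg x"
proof (cases "x = 0")
  case False
  then obtain p q where "p \<noteq> 0" "q \<noteq> 0" "x = Fract p q" by (metis ratfun_nonzeroE)
  then show ?thesis by (simp add: rdeg_Fract)
qed simp

lemma rdeg_prod:
  assumes "\<And>i. i \<in> A \<Longrightarrow> f i \<noteq> 0"
  shows "rdeg (\<Prod>i\<in>A. f i) = (\<Sum>i\<in>A. rdeg (f i))"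
  using assms
proof (induction A rule: infinite_finite_induct)
  case (insert x F)
  then show ?case by (simp add: rdeg_mult)
qed simp_all

lemma spow_nonzero [simp]: "spow n \<noteq> 0"
  by (simp add: spow_def)

lemma spow_0 [simp]: "spow 0 = 1"
  by (simp add: spow_def)

lemma rdeg_power: "x \<noteq> 0 \<Longrightarrow> rdeg (x ^ k) = int k * rdeg x"
  by (induction k) (simp_all add: rdeg_mult algebra_simps)

lemma rdeg_spow [simp]: "rdeg (spow n) = n"
proof -
  have x: "to_fract [:0, 1:] \<noteq> (0 :: 'a ratfun)" by simp
  have "rdeg (to_fract [:0, 1:] :: 'a ratfun) = 1" by (subst rdeg_to_fract) simp_all
  then have "rdeg (to_fract [:0, 1:] ^ nat n :: 'a ratfun) = int (nat n)"
    "rdeg (inverse (to_fract [:0, 1:]) ^ nat (- n) :: 'a ratfun) = - int (nat (- n))"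
    using rdeg_power[OF x] rdeg_power[of "inverse (to_fract [:0, 1:]) :: 'a ratfun"] rdeg_inverse[OF x] x
    by (metis mult.right_neutral, metis mult_minus1_right nonzero_imp_inverse_nonzero)
  then show ?thesis unfolding spow_def power_int_def by (cases "n \<ge> 0") simp_all
qed

lemma spow_add: "spow (a + b) = spow a * spow b"
  by (simp add: spow_def power_int_add)

lemma spow_minus: "spow (- a) * spow a = 1" "spow a * spow (- a) = 1"
  by (simp_all add: spow_def power_int_minus)

lemma spow_prod: "(\<Prod>i\<in>A. spow (f i)) = spow (\<Sum>i\<in>A. f i)"
  by (induction A rule: infinite_finite_induct) (simp_all add: spow_add)

lemma proper_iff_rdeg: "proper_ratfun x \<longleftrightarrow> x = 0 \<or> rdeg x \<le> 0"
proof
  assume "proper_ratfun x"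
  then obtain p q where "q \<noteq> 0" "x = Fract p q" "degree p \<le> degree q"
    unfolding proper_ratfun_def by blast
  then show "x = 0 \<or> rdeg x \<le> 0"
    by (cases "p = 0") (simp_all add: rdeg_Fract fract_collapse)
next
  assume *: "x = 0 \<or> rdeg x \<le> 0"
  show "proper_ratfun x"
  proof (cases "x = 0")
    case True
    then show ?thesis unfolding proper_ratfun_def
      by (intro exI[of _ 0] exI[of _ 1]) (simp add: fract_collapse)
  next
    case False
    then obtain p q where "p \<noteq> 0" "q \<noteq> 0" "x = Fract p q" by (metis ratfun_nonzeroE)
    then show ?thesis using * False unfolding proper_ratfun_def
      by (intro exI[of _ p] exI[of _ q]) (simp add: rdeg_Fract)
  qed
qed

lemma spow_mem_polys: "n \<ge> 0 \<Longrightarrow> spow n \<in> polys"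
proof -
  assume "n \<ge> 0"
  have *: "to_fract p ^ k = to_fract (p ^ k)" for k and p :: "'a poly"
    by (induction k) simp_all
  show ?thesis using \<open>n \<ge> 0\<close> by (simp add: spow_def power_int_def *)
qed

lemma polys_rdeg_nonneg: "x \<in> polys \<Longrightarrow> x \<noteq> 0 \<Longrightarrow> rdeg x \<ge> 0"
  by (auto simp: rdeg_to_fract)

lemma rdeg_add_le:
  assumes "x = 0 \<or> rdeg x \<le> d" "y = 0 \<or> rdeg y \<le> d"
  shows "x + y = 0 \<or> rdeg (x + y) \<le> d"
proof (cases "x = 0 \<or> y = 0")
  case True
  then show ?thesis using assms by auto
next
  case False
  then obtain p q p' q' where *: "p \<noteq> 0" "q \<noteq> 0" "x = Fract p q" "p' \<noteq> 0" "q' \<noteq> 0" "y = Fract p' q'"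
    by (metis ratfun_nonzeroE)
  have e: "x + y = Fract (p * q' + p' * q) (q * q')" using * by simp
  show ?thesis
  proof (cases "p * q' + p' * q = 0")
    case True
    then show ?thesis using e by (simp add: fract_collapse)
  next
    case nz: False
    have "int (degree (p * q' + p' * q)) \<le> d + int (degree q) + int (degree q')"
    proof -
      have "int (degree (p * q')) \<le> d + int (degree q) + int (degree q')"
        "int (degree (p' * q)) \<le> d + int (degree q) + int (degree q')"
        using assms False * by (simp_all add: rdeg_Fract degree_mult_eq)
      moreover have "degree (p * q' + p' * q) \<le> max (degree (p * q')) (degree (p' * q))"
        by (rule degree_add_le_max)
      ultimately show ?thesis by linarith
    qed
    then show ?thesis using e nz * by (simp add: rdeg_Fract degree_mult_eq)
  qed
qed

lemma rdeg_sum_le: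
  assumes "\<And>i. i \<in> A \<Longrightarrow> f i = 0 \<or> rdeg (f i) \<le> d"
  shows "(\<Sum>i\<in>A. f i) = 0 \<or> rdeg (\<Sum>i\<in>A. f i) \<le> d"
  using assms
proof (induction A rule: infinite_finite_induct)
  case (insert x F)
  then show ?case using rdeg_add_le[of "f x" d "sum f F"] by simp
qed simp_all

text \<open>Division with remainder of the numerator by the denominator.\<close>

lemma polynomial_part:
  obtains p where "p \<in> polys" "x - p = 0 \<or> rdeg (x - p) < 0"
proof (cases x)
  case (Fract a b)
  have b: "to_fract b \<noteq> 0" using Fract by simp
  have "x = to_fract (a div b * b + a mod b) / to_fract b"
    using Fract by (simp add: Fract_conv_to_fract)
  then have "x - to_fract (a div b) = to_fract (a mod b) / to_fract b"
    using b by (simp only: to_fract_add to_fract_mult) (simp add: field_simps)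
  moreover have "a mod b = 0 \<or> degree (a mod b) < degree b"
    using degree_mod_less[of b a] Fract by simp
  ultimately have "x - to_fract (a div b) = 0 \<or> rdeg (x - to_fract (a div b)) < 0"
    using b rdeg_divide[of "to_fract (a mod b)" "to_fract b"] rdeg_to_fract[of b] rdeg_to_fract[of "a mod b"]
    by (cases "a mod b = 0") simp_all
  then show ?thesis using that[of "to_fract (a div b)"] by simp
qed

section \<open>Subrings of a field\<close>

locale coeff_ring =
  fixes S :: "'b::field set"
  assumes zero_mem [simp]: "0 \<in> S" and one_mem [simp]: "1 \<in> S"
    and add_mem [intro]: "x \<in> S \<Longrightarrow> y \<in> S \<Longrightarrow> x + y \<in> S"
    and mult_mem [intro]: "x \<in> S \<Longrightarrow> y \<in> S \<Longrightarrow> x * y \<in> S"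
    and uminus_mem [intro]: "x \<in> S \<Longrightarrow> - x \<in> S"
begin

lemma diff_mem [intro]: "x \<in> S \<Longrightarrow> y \<in> S \<Longrightarrow> x - y \<in> S"
  using add_mem[of x "- y"] uminus_mem[of y] by simp

lemma sum_mem [intro]: "(\<And>i. i \<in> A \<Longrightarrow> f i \<in> S) \<Longrightarrow> sum f A \<in> S"
  by (induction A rule: infinite_finite_induct) auto

lemma prod_mem [intro]: "(\<And>i. i \<in> A \<Longrightarrow> f i \<in> S) \<Longrightarrow> prod f A \<in> S"
  by (induction A rule: infinite_finite_induct) auto

end

text \<open>A form of the Bezout property that holds for the polynomials and for the proper functions. The
  structure at the finite points and the structure at infinity are the structures over these two
  subrings, so that everything derived from it needs only one proof.\<close>

locale bezout_coeff_ring = coeff_ring S for S :: "'b::field set" +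
  assumes bezout: "\<And>(n::nat) x. (\<And>i. i < n \<Longrightarrow> x i \<in> S) \<Longrightarrow>
    \<exists>y c. (\<forall>i<n. y i \<in> S \<and> c i \<in> S \<and> x i = c i * (\<Sum>j<n. y j * x j))"

interpretation polys: coeff_ring "polys :: 'a::field ratfun set"
proof
  show "(0::'a ratfun) \<in> polys" by (rule range_eqI[of _ _ 0]) simp
  show "(1::'a ratfun) \<in> polys" by (rule range_eqI[of _ _ 1]) simp
  fix x y :: "'a ratfun"
  assume "x \<in> polys"
  then obtain p where p: "x = to_fract p" by blast
  show "- x \<in> polys" using p by (intro range_eqI[of _ _ "- p"]) simp
  assume "y \<in> polys"
  then obtain q where q: "y = to_fract q" by blast
  show "x + y \<in> polys" using p q by (intro range_eqI[of _ _ "p + q"]) simp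
  show "x * y \<in> polys" using p q by (intro range_eqI[of _ _ "p * q"]) simp
qed

interpretation propers: coeff_ring "propers :: 'a::field ratfun set"
proof
  fix x y :: "'a ratfun"
  assume x: "x \<in> propers" and y: "y \<in> propers"
  show "x + y \<in> propers" using x y rdeg_add_le[of x 0 y] by (simp add: proper_iff_rdeg)
  show "x * y \<in> propers" using x y
    by (cases "x = 0 \<or> y = 0") (auto simp: proper_iff_rdeg rdeg_mult)
qed (simp_all add: proper_iff_rdeg)

text \<open>An element of least degree in the ideal that the \<open>x\<^sub>i\<close> generate divides each of them, because
  the remainders also lie in the ideal.\<close>

interpretation polys: bezout_coeff_ring "polys :: 'a::field ratfun set"
proof
  fix n and x :: "nat \<Rightarrow> 'a ratfun"
  assume "\<And>i. i < n \<Longrightarrow> x i \<in> polys"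
  then have "\<forall>i. \<exists>p. i < n \<longrightarrow> x i = to_fract p" by auto
  then obtain p where p: "\<And>i. i < n \<Longrightarrow> x i = to_fract (p i)" by metis
  define I where "I = {g. \<exists>y. g = (\<Sum>j<n. y j * p j)}"
  have p_mem: "p i \<in> I" if "i < n" for i
  proof -
    have "p i = (\<Sum>j<n. (if j = i then 1 else 0) * p j)" using that by (simp add: sum.delta if_distrib[of "\<lambda>z. z * _"] cong: if_cong)
    then show ?thesis unfolding I_def by (intro CollectI exI[of _ "\<lambda>j. if j = i then 1 else 0"])
  qed
  show "\<exists>y c. \<forall>i<n. y i \<in> polys \<and> c i \<in> polys \<and> x i = c i * (\<Sum>j<n. y j * x j)"
  proof (cases "\<forall>i<n. x i = 0")
    case True
    then have "\<forall>i<n. x i = 0 * (\<Sum>j<n. 0 * x j)" by simp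
    then show ?thesis by (intro exI[of _ "\<lambda>_. 0"]) simp
  next
    case False
    then obtain i0 where "i0 < n" "p i0 \<noteq> 0" using p by auto
    then have "\<exists>g. g \<in> I \<and> g \<noteq> 0" using p_mem by blast
    then obtain g where g: "g \<in> I" "g \<noteq> 0" and least: "\<And>h. h \<in> I \<and> h \<noteq> 0 \<Longrightarrow> degree g \<le> degree h"
      using ex_has_least_nat[of "\<lambda>g. g \<in> I \<and> g \<noteq> 0" _ degree] by metis
    then obtain y where y: "g = (\<Sum>j<n. y j * p j)" unfolding I_def by blast
    have dvd: "p i = p i div g * g" if i: "i < n" for i
    proof -
      obtain u where u: "p i = (\<Sum>j<n. u j * p j)" using p_mem[OF i] unfolding I_def by blast
      have "p i mod g = p i - p i div g * g" by (simp add: minus_div_mult_eq_mod)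
      also have "\<dots> = (\<Sum>j<n. (u j - p i div g * y j) * p j)"
      proof -
        have "p i div g * g = (\<Sum>j<n. p i div g * (y j * p j))"
          by (subst (2) y) (rule sum_distrib_left)
        then show ?thesis by (subst u) (simp add: left_diff_distrib sum_subtractf mult.assoc)
      qed
      finally have "p i mod g \<in> I"
        unfolding I_def by (intro CollectI exI[of _ "\<lambda>j. u j - p i div g * y j"])
      then have "p i mod g = 0" using least[of "p i mod g"] degree_mod_less[OF g(2), of "p i"] by fastforce
      then show ?thesis by (metis add.right_neutral div_mult_mod_eq)
    qed
    have "to_fract g = (\<Sum>j<n. to_fract (y j) * x j)" using p unfolding y by simp
    have "x i = to_fract (p i div g) * (\<Sum>j<n. to_fract (y j) * x j)" if i: "i < n" for i
      using p[OF i] dvd[OF i] \<open>to_fract g = _\<close> by (metis to_fract_mult)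
    then have "\<forall>i<n. to_fract (y i) \<in> polys \<and> to_fract (p i div g) \<in> polys \<and>
        x i = to_fract (p i div g) * (\<Sum>j<n. to_fract (y j) * x j)"
      by blast
    then show ?thesis
      by (intro exI[of _ "\<lambda>j. to_fract (y j)"] exI[of _ "\<lambda>i. to_fract (p i div g)"])
  qed
qed

text \<open>Here the entry of largest degree divides the others.\<close>

interpretation propers: bezout_coeff_ring "propers :: 'a::field ratfun set"
proof
  fix n and x :: "nat \<Rightarrow> 'a ratfun"
  assume "\<And>i. i < n \<Longrightarrow> x i \<in> propers"
  show "\<exists>y c. \<forall>i<n. y i \<in> propers \<and> c i \<in> propers \<and> x i = c i * (\<Sum>j<n. y j * x j)"
  proof (cases "\<forall>i<n. x i = 0")
    case True
    then have "\<forall>i<n. x i = 0 * (\<Sum>j<n. 0 * x j)" by simp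
    then show ?thesis using propers.zero_mem by (intro exI[of _ "\<lambda>_. 0"]) blast
  next
    case False
    define J where "J = {i. i < n \<and> x i \<noteq> 0}"
    have "finite J" "J \<noteq> {}" using False unfolding J_def by auto
    then obtain i0 where i0: "i0 \<in> J" "\<And>i. i \<in> J \<Longrightarrow> rdeg (x i) \<le> rdeg (x i0)"
      using arg_min_if_finite[of J "\<lambda>i. - rdeg (x i)"] by (metis neg_le_iff_le not_le)
    have "(\<Sum>j<n. (if j = i0 then 1 else 0) * x j) = x i0"
      using i0(1) unfolding J_def by (simp add: sum.delta if_distrib[of "\<lambda>z. z * _"] cong: if_cong)
    moreover have "proper_ratfun (x i / x i0)" if "i < n" for i
      using that i0 unfolding J_def by (cases "x i = 0") (auto simp: proper_iff_rdeg rdeg_divide)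
    moreover have "x i0 \<noteq> 0" using i0 unfolding J_def by simp
    ultimately have "\<forall>i<n. (if i = i0 then 1 else (0::'a ratfun)) \<in> propers \<and> x i / x i0 \<in> propers \<and>
        x i = x i / x i0 * (\<Sum>j<n. (if j = i0 then 1 else 0) * x j)"
      by (simp add: proper_iff_rdeg[of 0] proper_iff_rdeg[of 1])
    then show ?thesis
      by (intro exI[of _ "\<lambda>j. if j = i0 then 1 else 0"] exI[of _ "\<lambda>i. x i / x i0"])
  qed
qed

section \<open>Matrices over a subring\<close>

definition mats :: "'b set \<Rightarrow> nat \<Rightarrow> nat \<Rightarrow> 'b mat set" where
  "mats S m n = {A \<in> carrier_mat m n. \<forall>i<m. \<forall>j<n. A $$ (i, j) \<in> S}"

lemma mats_carrier: "A \<in> mats S m n \<Longrightarrow> A \<in> carrier_mat m n"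
  by (simp add: mats_def)

lemma mats_dim [simp]:
  "A \<in> mats S m n \<Longrightarrow> dim_row A = m" "A \<in> mats S m n \<Longrightarrow> dim_col A = n"
  by (auto simp: mats_def)

lemma mats_transpose: "A \<in> mats S m n \<Longrightarrow> transpose_mat A \<in> mats S n m"
  by (auto simp: mats_def)

abbreviation sdiag :: "nat \<Rightarrow> (nat \<Rightarrow> int) \<Rightarrow> 'a::field ratfun mat" where
  "sdiag n e \<equiv> mat_diag n (\<lambda>i. spow (e i))"

definition hcat :: "'b::zero mat \<Rightarrow> 'b mat \<Rightarrow> 'b mat" where
  "hcat A B = four_block_mat A B (0\<^sub>m 0 (dim_col A)) (0\<^sub>m 0 (dim_col B))"

definition vcat :: "'b::zero mat \<Rightarrow> 'b mat \<Rightarrow> 'b mat" where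
  "vcat A B = four_block_mat A (0\<^sub>m (dim_row A) 0) B (0\<^sub>m (dim_row B) 0)"

lemma vcat_carrier: "A \<in> carrier_mat a n \<Longrightarrow> B \<in> carrier_mat b n \<Longrightarrow> vcat A B \<in> carrier_mat (a + b) n"
  unfolding vcat_def by auto

lemma empty_mat_zero: "A \<in> carrier_mat m 0 \<Longrightarrow> A = 0\<^sub>m m 0" "A \<in> carrier_mat 0 m \<Longrightarrow> A = 0\<^sub>m 0 m"
  by auto

lemma mult_zero_dim: "A \<in> carrier_mat m 0 \<Longrightarrow> B \<in> carrier_mat 0 n \<Longrightarrow> (A * B :: 'b::semiring_0 mat) = 0\<^sub>m m n"
  by (intro eq_matI) (auto simp: scalar_prod_def)

lemma vcat_mult_hcat:
  fixes A :: "'b::field mat"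
  assumes A: "A \<in> carrier_mat a m" and B: "B \<in> carrier_mat b m"
    and C: "C \<in> carrier_mat m c" and D: "D \<in> carrier_mat m d"
  shows "vcat A B * hcat C D = four_block_mat (A * C) (A * D) (B * C) (B * D)"
proof -
  have [simp]: "dim_row A = a" "dim_row B = b" "dim_col C = c" "dim_col D = d" using assms by auto
  show ?thesis unfolding vcat_def hcat_def
    by (subst mult_four_block_mat[of _ a m _ 0 _ b _ _ c _ d])
      (use assms in \<open>auto simp: mult_zero_dim\<close>)
qed

lemma vcat_mult:
  fixes A :: "'b::field mat"
  assumes A: "A \<in> carrier_mat a m" and B: "B \<in> carrier_mat b m" and C: "C \<in> carrier_mat m c"
  shows "vcat A B * C = vcat (A * C) (B * C)"
proof -
  have "vcat A B * hcat C (0\<^sub>m m 0) = vcat (A * C) (B * C)"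
    using assms by (subst vcat_mult_hcat[OF A B C]) (auto simp: vcat_def)
  moreover have "hcat C (0\<^sub>m m 0) = C"
    using C unfolding hcat_def by (intro eq_matI) auto
  ultimately show ?thesis by simp
qed

lemma hcat_mult_vcat:
  fixes A :: "'b::field mat"
  assumes A: "A \<in> carrier_mat m a" and B: "B \<in> carrier_mat m b"
    and C: "C \<in> carrier_mat a n" and D: "D \<in> carrier_mat b n"
  shows "hcat A B * vcat C D = A * C + B * D"
proof -
  have [simp]: "dim_col A = a" "dim_col B = b" "dim_row C = a" "dim_row D = b" using assms by auto
  have "hcat A B * vcat C D = four_block_mat (A * C + B * D) (0\<^sub>m m 0) (0\<^sub>m 0 n) (0\<^sub>m 0 0)"
    unfolding vcat_def hcat_def
    by (subst mult_four_block_mat[of _ m a _ b _ 0 _ _ n _ 0])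
      (use assms in \<open>auto simp: empty_mat_zero\<close>)
  also have "\<dots> = A * C + B * D" using assms by (intro eq_matI) auto
  finally show ?thesis .
qed

lemma det_mat_diag: "det (mat_diag n f) = (\<Prod>i<n. f i)"
proof -
  have "det (mat_diag n f) = prod_list (diag_mat (mat_diag n f))"
    by (rule det_upper_triangular[of _ n]) (auto simp: mat_diag_def)
  also have "\<dots> = (\<Prod>i<n. f i)"
    unfolding prod_list_diag_prod by (simp add: mat_diag_def atLeast0LessThan)
  finally show ?thesis .
qed

lemma transpose_mat_diag [simp]: "transpose_mat (mat_diag n f) = mat_diag n f"
  by (intro eq_matI) (auto simp: mat_diag_def)

lemma sdiag_inverse: "sdiag n (\<lambda>i. - e i) * sdiag n e = 1\<^sub>m n" "sdiag n e * sdiag n (\<lambda>i. - e i) = 1\<^sub>m n"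
  by (simp_all add: spow_minus)

lemma left_inverse_unscale:
  fixes A B :: "'a::field ratfun mat"
  assumes A: "A \<in> carrier_mat m r" and B: "B \<in> carrier_mat r m"
    and inv: "B * (A * sdiag r (\<lambda>i. - e i)) = 1\<^sub>m r"
  shows "B * A = sdiag r e"
proof -
  have "B * A = B * (A * (sdiag r (\<lambda>i. - e i) * sdiag r e))" unfolding sdiag_inverse using A B by simp
  also have "\<dots> = B * (A * sdiag r (\<lambda>i. - e i)) * sdiag r e"
    using A B by (simp add: assoc_mult_mat[of _ m r _ r _ r] assoc_mult_mat[of _ r m _ r _ r])
  finally show ?thesis unfolding inv using left_mult_one_mat[OF mat_diag_dim] by metis
qed

text \<open>\<open>P'\<close> is the inverse of \<open>P\<close>, and both have entries in \<open>S\<close>. For polynomials this is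
  unimodularity, and for proper functions it is biproperness.\<close>

definition inv_over :: "'b::field set \<Rightarrow> nat \<Rightarrow> 'b mat \<Rightarrow> 'b mat \<Rightarrow> bool" where
  "inv_over S n P P' \<longleftrightarrow> P \<in> mats S n n \<and> P' \<in> mats S n n \<and> P * P' = 1\<^sub>m n \<and> P' * P = 1\<^sub>m n"

definition equiv_over :: "'b::field set \<Rightarrow> nat \<Rightarrow> nat \<Rightarrow> 'b mat \<Rightarrow> 'b mat \<Rightarrow> bool" where
  "equiv_over S m n A B \<longleftrightarrow>
    (\<exists>P P' Q Q'. inv_over S m P P' \<and> inv_over S n Q Q' \<and> P * A * Q = B)"

lemma inv_over_sym: "inv_over S n P P' \<Longrightarrow> inv_over S n P' P"
  by (simp add: inv_over_def)

lemma inv_over_carrier: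
  assumes "inv_over S n P P'" shows "P \<in> carrier_mat n n" "P' \<in> carrier_mat n n"
  using assms by (auto simp: inv_over_def intro: mats_carrier)

lemma inv_overI:
  assumes "P \<in> mats S n n" "P' \<in> mats S n n" "P * P' = 1\<^sub>m n"
  shows "inv_over S n P P'"
  using assms mat_mult_left_right_inverse[of P n P'] by (auto simp: inv_over_def mats_carrier)

lemma inv_over_transpose:
  assumes "inv_over S n P P'" shows "inv_over S n (transpose_mat P) (transpose_mat P')"
proof (rule inv_overI)
  show "transpose_mat P \<in> mats S n n" "transpose_mat P' \<in> mats S n n"
    using assms by (auto simp: inv_over_def intro: mats_transpose)
  have "transpose_mat P * transpose_mat P' = transpose_mat (P' * P)"
    using inv_over_carrier[OF assms] by (intro transpose_mult[symmetric]) auto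
  then show "transpose_mat P * transpose_mat P' = 1\<^sub>m n"
    using assms by (simp add: inv_over_def)
qed

context coeff_ring
begin

lemma mult_mats: "A \<in> mats S m k \<Longrightarrow> B \<in> mats S k n \<Longrightarrow> A * B \<in> mats S m n"
  unfolding mats_def by (auto simp: scalar_prod_def intro!: sum_mem mult_mem)

lemma minus_mats: "A \<in> mats S m n \<Longrightarrow> B \<in> mats S m n \<Longrightarrow> A - B \<in> mats S m n"
  unfolding mats_def by (auto intro!: diff_mem)

lemma one_mats [simp]: "1\<^sub>m n \<in> mats S n n"
  unfolding mats_def by auto

lemma zero_mats [simp]: "0\<^sub>m m n \<in> mats S m n"
  unfolding mats_def by auto

lemma mat_diag_mats: "(\<And>i. i < n \<Longrightarrow> f i \<in> S) \<Longrightarrow> mat_diag n f \<in> mats S n n"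
  unfolding mats_def by (auto simp: mat_diag_def)

lemma four_block_mats:
  "A \<in> mats S a c \<Longrightarrow> B \<in> mats S a d \<Longrightarrow> C \<in> mats S b c \<Longrightarrow> D \<in> mats S b d \<Longrightarrow>
    four_block_mat A B C D \<in> mats S (a + b) (c + d)"
  unfolding mats_def by auto

lemma hcat_mats: "A \<in> mats S m a \<Longrightarrow> B \<in> mats S m b \<Longrightarrow> hcat A B \<in> mats S m (a + b)"
  unfolding hcat_def using four_block_mats[of A m a B b "0\<^sub>m 0 a" 0 "0\<^sub>m 0 b"] by simp

lemma vcat_mats: "A \<in> mats S a n \<Longrightarrow> B \<in> mats S b n \<Longrightarrow> vcat A B \<in> mats S (a + b) n"
  unfolding vcat_def using four_block_mats[of A a n "0\<^sub>m a 0" 0 B b "0\<^sub>m b 0"] by simp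

lemma signof_mem: "(signof p :: 'b) \<in> S"
  by (cases p rule: sign_cases) (simp_all add: uminus_mem)

lemma det_mem: "A \<in> mats S n n \<Longrightarrow> det A \<in> S"
  unfolding mats_def
  by (auto simp: det_def' permutes_in_image intro!: sum_mem mult_mem prod_mem signof_mem)

lemma det_inv_over:
  assumes "inv_over S n P P'"
  shows "det P \<in> S" "det P' \<in> S" "det P * det P' = 1"
proof -
  show "det P \<in> S" "det P' \<in> S" using assms det_mem by (auto simp: inv_over_def)
  have "det (P * P') = 1" using assms by (simp add: inv_over_def)
  then show "det P * det P' = 1" using det_mult[OF inv_over_carrier[OF assms]] by simp
qed

lemma inv_over_one: "inv_over S n (1\<^sub>m n) (1\<^sub>m n)"
  by (simp add: inv_over_def)

lemma inv_over_mult: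
  assumes P: "inv_over S n P P'" and Q: "inv_over S n Q Q'"
  shows "inv_over S n (P * Q) (Q' * P')"
proof (rule inv_overI)
  have c: "P \<in> carrier_mat n n" "P' \<in> carrier_mat n n" "Q \<in> carrier_mat n n" "Q' \<in> carrier_mat n n"
    using P Q by (auto dest: inv_over_carrier)
  show "P * Q \<in> mats S n n" "Q' * P' \<in> mats S n n" using P Q by (auto simp: inv_over_def intro: mult_mats)
  have "Q * (Q' * P') = P'"
    unfolding assoc_mult_mat[OF c(3,4,2), symmetric] using Q c by (simp add: inv_over_def)
  then show "P * Q * (Q' * P') = 1\<^sub>m n"
    using P c by (simp add: inv_over_def assoc_mult_mat[of _ n n _ n _ n])
qed

lemma inv_over_block:
  assumes P: "inv_over S a P P'" and Q: "inv_over S b Q Q'"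
  shows "inv_over S (a + b) (four_block_mat P (0\<^sub>m a b) (0\<^sub>m b a) Q)
    (four_block_mat P' (0\<^sub>m a b) (0\<^sub>m b a) Q')"
proof (rule inv_overI)
  show "four_block_mat P (0\<^sub>m a b) (0\<^sub>m b a) Q \<in> mats S (a + b) (a + b)"
    "four_block_mat P' (0\<^sub>m a b) (0\<^sub>m b a) Q' \<in> mats S (a + b) (a + b)"
    using P Q by (auto simp: inv_over_def intro!: four_block_mats)
  show "four_block_mat P (0\<^sub>m a b) (0\<^sub>m b a) Q * four_block_mat P' (0\<^sub>m a b) (0\<^sub>m b a) Q' = 1\<^sub>m (a + b)"
    using P Q inv_over_carrier[OF P] inv_over_carrier[OF Q]
    by (subst mult_four_block_mat[of _ a a _ b _ b _ _ a _ b]) (auto simp: inv_over_def)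
qed

lemma equiv_over_refl: "A \<in> carrier_mat m n \<Longrightarrow> equiv_over S m n A A"
  unfolding equiv_over_def using inv_over_one
  by (intro exI[of _ "1\<^sub>m m"] exI[of _ "1\<^sub>m n"]) simp

lemma equiv_over_trans:
  assumes "equiv_over S m n A B" "equiv_over S m n B C" "A \<in> carrier_mat m n"
  shows "equiv_over S m n A C"
proof -
  obtain P P' Q Q' where 1: "inv_over S m P P'" "inv_over S n Q Q'" "P * A * Q = B"
    using assms(1) unfolding equiv_over_def by blast
  obtain P1 P1' Q1 Q1' where 2: "inv_over S m P1 P1'" "inv_over S n Q1 Q1'" "P1 * B * Q1 = C"
    using assms(2) unfolding equiv_over_def by blast
  have c: "P \<in> carrier_mat m m" "Q \<in> carrier_mat n n" "P1 \<in> carrier_mat m m" "Q1 \<in> carrier_mat n n"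
    using 1 2 by (auto dest: inv_over_carrier)
  have "P1 * P * A * (Q * Q1) = C"
    unfolding 2(3)[symmetric] 1(3)[symmetric] using c assms(3)
    by (simp add: assoc_mult_mat[of _ m m _ m _ n] assoc_mult_mat[of _ m m _ n _ n] assoc_mult_mat[of _ m n _ n _ n])
  then show ?thesis unfolding equiv_over_def using inv_over_mult[OF 2(1) 1(1)] inv_over_mult[OF 1(2) 2(2)] by blast
qed

lemma equiv_over_mult:
  assumes "inv_over S m P P'" "inv_over S n Q Q'" "A \<in> carrier_mat m n"
  shows "equiv_over S m n A (P * A * Q)"
  using assms unfolding equiv_over_def by blast

text \<open>Complementary factors of the identity complete each other to an invertible matrix. The inverse
  starts from \<open>X\<close>, corrected by a multiple of \<open>Y\<close> so that it annihilates \<open>Z\<close>.\<close>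

lemma completion:
  assumes K: "K \<in> mats S m r" and X: "X \<in> mats S r m" and XK: "X * K = 1\<^sub>m r"
    and Y: "Y \<in> mats S r' m" and Z: "Z \<in> mats S m r'" and YZ: "Y * Z = 1\<^sub>m r'"
    and YK: "Y * K = 0\<^sub>m r' r" and m: "r + r' = m"
  shows "inv_over S m (vcat (X - X * Z * Y) Y) (hcat K Z)"
    and "vcat (X - X * Z * Y) Y * K = vcat (1\<^sub>m r) (0\<^sub>m r' r)"
    and "(X - X * Z * Y) * K = 1\<^sub>m r"
proof -
  note c = K[THEN mats_carrier] X[THEN mats_carrier] Y[THEN mats_carrier] Z[THEN mats_carrier]
  have W: "X - X * Z * Y \<in> mats S r m" using X Y Z by (auto intro!: minus_mats mult_mats)
  have 1: "(X - X * Z * Y) * K = 1\<^sub>m r"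
  proof -
    have "X * Z * Y * K = X * Z * (Y * K)" using c by (intro assoc_mult_mat) auto
    also have "\<dots> = 0\<^sub>m r r" using c YK by simp
    finally have "(X - X * Z * Y) * K = 1\<^sub>m r - 0\<^sub>m r r"
      using c XK by (subst minus_mult_distrib_mat[of _ r m]) auto
    then show ?thesis by auto
  qed
  have 2: "(X - X * Z * Y) * Z = 0\<^sub>m r r'"
  proof -
    have "X * Z * Y * Z = X * Z * (Y * Z)" using c by (intro assoc_mult_mat) auto
    also have "\<dots> = X * Z" using c YZ by simp
    finally have "(X - X * Z * Y) * Z = X * Z - X * Z"
      using c by (subst minus_mult_distrib_mat[of _ r m]) auto
    then show ?thesis using c by auto
  qed
  have "vcat (X - X * Z * Y) Y * hcat K Z = 1\<^sub>m m"
    by (subst vcat_mult_hcat[OF W[THEN mats_carrier] c(3) c(1) c(4)]) (simp add: 1 2 YK YZ m)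
  then show "inv_over S m (vcat (X - X * Z * Y) Y) (hcat K Z)"
    using vcat_mats[OF W Y] hcat_mats[OF K Z] m by (intro inv_overI) auto
  show "vcat (X - X * Z * Y) Y * K = vcat (1\<^sub>m r) (0\<^sub>m r' r)"
    by (subst vcat_mult[OF W[THEN mats_carrier] c(3) c(1)]) (simp add: 1 YK)
  show "(X - X * Z * Y) * K = 1\<^sub>m r" by (rule 1)
qed

end

lemma rdeg_det_unimodular:
  assumes "inv_over polys n P P'" shows "rdeg (det P) = 0" "det P \<noteq> 0"
proof -
  have "det P * det P' = 1" "det P \<in> polys" "det P' \<in> polys" using polys.det_inv_over[OF assms] by auto
  moreover from this show nz: "det P \<noteq> 0" by auto
  moreover have "det P' \<noteq> 0" using calculation by auto
  ultimately have "rdeg (det P) + rdeg (det P') = 0" "rdeg (det P) \<ge> 0" "rdeg (det P') \<ge> 0"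
    using rdeg_mult[of "det P" "det P'"] polys_rdeg_nonneg by auto
  then show "rdeg (det P) = 0" by linarith
qed

lemma rdeg_det_biproper:
  assumes "inv_over propers n P P'" shows "rdeg (det P) = 0" "det P \<noteq> 0"
proof -
  have "det P * det P' = 1" "det P \<in> propers" "det P' \<in> propers" using propers.det_inv_over[OF assms] by auto
  moreover from this show nz: "det P \<noteq> 0" by auto
  moreover have "det P' \<noteq> 0" using calculation by auto
  ultimately have "rdeg (det P) + rdeg (det P') = 0" "rdeg (det P) \<le> 0" "rdeg (det P') \<le> 0"
    using rdeg_mult[of "det P" "det P'"] by (auto simp: proper_iff_rdeg)
  then show "rdeg (det P) = 0" by linarith
qed

section \<open>Saturated matrices have a left inverse\<close>

text \<open>A matrix over \<open>S\<close> is saturated if a combination of its columns has entries in \<open>S\<close> only when its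
  coefficients lie in \<open>S\<close>.\<close>

lemma dual_system_dot:
  fixes z v :: "nat \<Rightarrow> 'b::field"
  shows "(\<Sum>i<m. (z i - (\<Sum>a<k. f a * y a i)) * v i) =
    (\<Sum>i<m. z i * v i) - (\<Sum>a<k. f a * (\<Sum>i<m. y a i * v i))"
proof -
  have "(\<Sum>i<m. (\<Sum>a<k. f a * y a i) * v i) = (\<Sum>i<m. \<Sum>a<k. f a * y a i * v i)"
    by (simp add: sum_distrib_right)
  also have "\<dots> = (\<Sum>a<k. \<Sum>i<m. f a * y a i * v i)" by (rule sum.swap)
  also have "\<dots> = (\<Sum>a<k. f a * (\<Sum>i<m. y a i * v i))"
    by (simp add: sum_distrib_left mult.assoc)
  finally show ?thesis by (simp add: left_diff_distrib sum_subtractf)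
qed

context bezout_coeff_ring
begin

text \<open>A dual system for the first \<open>k\<close> columns is extended by one column at a time. Subtracting its
  components from column \<open>k\<close> leaves a vector \<open>x'\<close> that is still saturated, hence by Bezout takes the
  value 1 under some functional, which is then made to vanish on the earlier columns.\<close>

lemma dual_system:
  fixes x :: "nat \<Rightarrow> nat \<Rightarrow> 'b"
  assumes mem: "\<And>b i. b < r \<Longrightarrow> i < m \<Longrightarrow> x b i \<in> S"
    and sat: "\<And>u b. (\<And>i. i < m \<Longrightarrow> (\<Sum>b<r. u b * x b i) \<in> S) \<Longrightarrow> b < r \<Longrightarrow> u b \<in> S"
    and indep: "\<And>u b. (\<And>i. i < m \<Longrightarrow> (\<Sum>b<r. u b * x b i) = 0) \<Longrightarrow> b < r \<Longrightarrow> u b = 0"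
  shows "k \<le> r \<Longrightarrow> \<exists>y. \<forall>a<k. (\<forall>i<m. y a i \<in> S) \<and>
    (\<forall>b<k. (\<Sum>i<m. y a i * x b i) = (if a = b then 1 else 0))"
proof (induction k)
  case 0
  show ?case by simp
next
  case (Suc k)
  then have k: "k < r" by simp
  obtain y where yS: "\<And>a i. a < k \<Longrightarrow> i < m \<Longrightarrow> y a i \<in> S"
    and y: "\<And>a b. a < k \<Longrightarrow> b < k \<Longrightarrow> (\<Sum>i<m. y a i * x b i) = (if a = b then 1 else 0)"
    using Suc by auto
  define c where "c a = (\<Sum>i<m. y a i * x k i)" for a
  define x' where "x' i = x k i - (\<Sum>a<k. c a * x a i)" for i
  have cS: "c a \<in> S" if "a < k" for a unfolding c_def using that yS mem k by (auto intro!: sum_mem mult_mem)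
  have x'S: "x' i \<in> S" if "i < m" for i unfolding x'_def using that cS mem k by (auto intro!: diff_mem sum_mem mult_mem)
  have comb: "t * x' i = (\<Sum>b<r. (if b < k then - t * c b else if b = k then t else 0) * x b i)" for t i
  proof -
    have "(\<Sum>b<r. (if b < k then - t * c b else if b = k then t else 0) * x b i) =
      (\<Sum>b<Suc k. (if b < k then - t * c b else if b = k then t else 0) * x b i)"
      using k by (intro sum.mono_neutral_right) auto
    also have "\<dots> = (\<Sum>b<k. - t * c b * x b i) + t * x k i"
    proof -
      have "(\<Sum>b<k. (if b < k then - t * c b else if b = k then t else 0) * x b i) = (\<Sum>b<k. - t * c b * x b i)"
        by (rule sum.cong) auto
      then show ?thesis unfolding sum.lessThan_Suc by (simp only: less_irrefl if_False refl if_True)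
    qed
    also have "(\<Sum>b<k. - t * c b * x b i) = - t * (\<Sum>b<k. c b * x b i)"
      by (simp only: sum_distrib_left mult.assoc)
    finally show ?thesis unfolding x'_def by (simp add: right_diff_distrib)
  qed
  obtain z d where zd: "\<And>i. i < m \<Longrightarrow> z i \<in> S \<and> d i \<in> S \<and> x' i = d i * (\<Sum>j<m. z j * x' j)"
    using bezout[of m x'] x'S by blast
  define g where "g = (\<Sum>j<m. z j * x' j)"
  have x'g: "x' i = d i * g" and dS: "d i \<in> S" if "i < m" for i
    using zd[OF that] unfolding g_def by blast+
  have "g \<noteq> 0"
  proof
    assume "g = 0"
    then have "1 * x' i = 0" if "i < m" for i using x'g[OF that] by simp
    then have *: "(\<Sum>b<r. (if b < k then - 1 * c b else if b = k then 1 else 0) * x b i) = 0"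
      if "i < m" for i using that unfolding comb .
    show False using indep[OF * k] by simp
  qed
  have "1 / g \<in> S"
  proof -
    have "1 / g * x' i \<in> S" if "i < m" for i
      using x'g[OF that] dS[OF that] \<open>g \<noteq> 0\<close> by simp
    then have *: "(\<Sum>b<r. (if b < k then - (1 / g) * c b else if b = k then 1 / g else 0) * x b i) \<in> S"
      if "i < m" for i using that unfolding comb .
    show ?thesis using sat[OF * k] by simp
  qed
  define z' where "z' i = 1 / g * z i" for i
  have z'S: "z' i \<in> S" if "i < m" for i unfolding z'_def using zd that \<open>1 / g \<in> S\<close> mult_mem by blast
  have "(\<Sum>i<m. z' i * x' i) = 1 / g * g"
    unfolding z'_def g_def by (simp add: sum_distrib_left mult.assoc)
  then have z'x': "(\<Sum>i<m. z' i * x' i) = 1" using \<open>g \<noteq> 0\<close> by simp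
  define h where "h a = (\<Sum>i<m. z' i * x a i)" for a
  define w where "w i = z' i - (\<Sum>a<k. h a * y a i)" for i
  have hS: "h a \<in> S" if "a < k" for a unfolding h_def using that z'S mem k by (auto intro!: sum_mem mult_mem)
  have wS: "w i \<in> S" if "i < m" for i unfolding w_def using that z'S hS yS by (auto intro!: diff_mem sum_mem mult_mem)
  have wx: "(\<Sum>i<m. w i * v i) = (\<Sum>i<m. z' i * v i) - (\<Sum>a<k. h a * (\<Sum>i<m. y a i * v i))" for v
    unfolding w_def by (rule dual_system_dot)
  have w0: "(\<Sum>i<m. w i * x b i) = 0" if "b < k" for b
  proof -
    have "(\<Sum>a<k. h a * (\<Sum>i<m. y a i * x b i)) = (\<Sum>a<k. if a = b then h a else 0)"
      using y that by (intro sum.cong) auto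
    also have "\<dots> = h b" using that by simp
    finally show ?thesis using wx[of "x b"] by (simp add: h_def)
  qed
  have w1: "(\<Sum>i<m. w i * x k i) = 1"
  proof -
    have "(\<Sum>i<m. z' i * x' i) = (\<Sum>i<m. x' i * z' i)" by (simp add: mult.commute)
    also have "\<dots> = (\<Sum>i<m. x k i * z' i) - (\<Sum>a<k. c a * (\<Sum>i<m. x a i * z' i))"
      unfolding x'_def by (rule dual_system_dot)
    also have "\<dots> = (\<Sum>i<m. w i * x k i)"
      unfolding wx c_def[symmetric] h_def by (simp add: mult.commute)
    finally show ?thesis using z'x' by simp
  qed
  define y' where "y' a i = (if a = k then w i else y a i - c a * w i)" for a i
  have "y' a i \<in> S" if "a < Suc k" "i < m" for a i
    unfolding y'_def using that yS cS wS by (auto intro!: diff_mem mult_mem)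
  moreover have "(\<Sum>i<m. y' a i * x b i) = (if a = b then 1 else 0)" if "a < Suc k" "b < Suc k" for a b
  proof (cases "a = k")
    case True
    then show ?thesis using w0 w1 that unfolding y'_def by (cases "b = k") auto
  next
    case False
    then have a: "a < k" using that by simp
    have "(\<Sum>i<m. y' a i * x b i) = (\<Sum>i<m. y a i * x b i) - c a * (\<Sum>i<m. w i * x b i)"
      using False unfolding y'_def by (simp add: left_diff_distrib sum_subtractf sum_distrib_left mult.assoc)
    then show ?thesis using w0 w1 that y a False by (cases "b = k") (auto simp: c_def)
  qed
  ultimately show ?case by blast
qed

lemma left_inverse_if_saturated:
  assumes K: "K \<in> mats S m r"
    and sat: "\<And>u b. u \<in> carrier_vec r \<Longrightarrow> (\<And>i. i < m \<Longrightarrow> (K *\<^sub>v u) $ i \<in> S) \<Longrightarrow> b < r \<Longrightarrow> u $ b \<in> S"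
    and indep: "\<And>u. u \<in> carrier_vec r \<Longrightarrow> K *\<^sub>v u = 0\<^sub>v m \<Longrightarrow> u = 0\<^sub>v r"
  shows "\<exists>X \<in> mats S r m. X * K = 1\<^sub>m r"
proof -
  have Kc: "K \<in> carrier_mat m r" using K by (rule mats_carrier)
  have mv: "(K *\<^sub>v vec r u) $ i = (\<Sum>b<r. u b * K $$ (i, b))" if "i < m" for u i
    using Kc that by (auto simp: scalar_prod_def atLeast0LessThan mult.commute intro: sum.cong)
  have "\<exists>y. \<forall>a<r. (\<forall>i<m. y a i \<in> S) \<and>
    (\<forall>b<r. (\<Sum>i<m. y a i * K $$ (i, b)) = (if a = b then 1 else 0))"
  proof (rule dual_system[where k = r and r = r])
    show "K $$ (i, b) \<in> S" if "b < r" "i < m" for b i using K that by (simp add: mats_def)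
    show "u b \<in> S" if "\<And>i. i < m \<Longrightarrow> (\<Sum>b<r. u b * K $$ (i, b)) \<in> S" "b < r" for u b
      using sat[of "vec r u" b] that mv by simp
    show "u b = 0" if *: "\<And>i. i < m \<Longrightarrow> (\<Sum>b<r. u b * K $$ (i, b)) = 0" "b < r" for u b
    proof -
      have "K *\<^sub>v vec r u = 0\<^sub>v m" using mv *(1) Kc by (intro eq_vecI) auto
      then have "vec r u = 0\<^sub>v r" using indep[of "vec r u"] by simp
      then have "vec r u $ b = 0" using *(2) by simp
      then show ?thesis using *(2) by simp
    qed
  qed simp
  then obtain y where y: "\<And>a i. a < r \<Longrightarrow> i < m \<Longrightarrow> y a i \<in> S"
    "\<And>a b. a < r \<Longrightarrow> b < r \<Longrightarrow> (\<Sum>i<m. y a i * K $$ (i, b)) = (if a = b then 1 else 0)"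
    by blast
  have "mat r m (\<lambda>(a, i). y a i) \<in> mats S r m" using y(1) by (auto simp: mats_def)
  moreover have "mat r m (\<lambda>(a, i). y a i) * K = 1\<^sub>m r"
    using y(2) Kc by (intro eq_matI) (auto simp: scalar_prod_def atLeast0LessThan)
  ultimately show ?thesis by blast
qed

end

section \<open>Reduced polynomial matrices\<close>

text \<open>Columns of degree at most \<open>e\<^sub>i\<close> that stay independent modulo every prime of the polynomial
  ring and, after division by \<open>s\<close> to the power \<open>e\<^sub>i\<close>, at infinity. These are the minimal bases.\<close>

definition reduced :: "nat \<Rightarrow> nat \<Rightarrow> 'a::field ratfun mat \<Rightarrow> (nat \<Rightarrow> int) \<Rightarrow> bool" where
  "reduced m r K e \<longleftrightarrow> K \<in> mats polys m r \<and> (\<exists>X \<in> mats polys r m. X * K = 1\<^sub>m r) \<and>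
    K * sdiag r (\<lambda>i. - e i) \<in> mats propers m r \<and>
    (\<exists>Z \<in> mats propers r m. Z * (K * sdiag r (\<lambda>i. - e i)) = 1\<^sub>m r)"

text \<open>The one-sided inverses over both subrings that come with two reduced matrices, and the orthogonality
  of their normalizations at infinity.\<close>

lemma reduced_dual_inverses:
  fixes K Y :: "'a::field ratfun mat"
  assumes K: "reduced m r K e" and Y: "reduced m r' Y f" and YK: "transpose_mat Y * K = 0\<^sub>m r' r"
  defines "D \<equiv> sdiag r (\<lambda>i. - e i)" and "D' \<equiv> sdiag r' (\<lambda>i. - f i)"
  obtains X Z U V where "K \<in> mats polys m r" "X \<in> mats polys r m" "X * K = 1\<^sub>m r"
    "K * D \<in> mats propers m r" "Z \<in> mats propers r m" "Z * (K * D) = 1\<^sub>m r"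
    "Y \<in> mats polys m r'" "U \<in> mats polys r' m" "Y * D' \<in> mats propers m r'" "V \<in> mats propers r' m"
    "U * Y = 1\<^sub>m r'" "V * (Y * D') = 1\<^sub>m r'"
    "transpose_mat Y * transpose_mat U = 1\<^sub>m r'" "transpose_mat (Y * D') * transpose_mat V = 1\<^sub>m r'"
    "transpose_mat (Y * D') * (K * D) = 0\<^sub>m r' r"
proof -
  obtain X Z where K': "K \<in> mats polys m r" "X \<in> mats polys r m" "X * K = 1\<^sub>m r"
    "K * D \<in> mats propers m r" "Z \<in> mats propers r m" "Z * (K * D) = 1\<^sub>m r"
    using K unfolding reduced_def D_def by blast
  obtain U V where Y': "Y \<in> mats polys m r'" "U \<in> mats polys r' m" "U * Y = 1\<^sub>m r'"
    "Y * D' \<in> mats propers m r'" "V \<in> mats propers r' m" "V * (Y * D') = 1\<^sub>m r'"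
    using Y unfolding reduced_def D'_def by blast
  note c = K'(1)[THEN mats_carrier] Y'(1)[THEN mats_carrier] Y'(2)[THEN mats_carrier] Y'(5)[THEN mats_carrier]
  have YU: "transpose_mat Y * transpose_mat U = 1\<^sub>m r'"
    using Y'(3) c transpose_mult[of U r' m Y r'] by simp
  have YV: "transpose_mat (Y * D') * transpose_mat V = 1\<^sub>m r'"
    using Y'(6) transpose_mult[OF c(4) mats_carrier[OF Y'(4)]] by simp
  have YK': "transpose_mat (Y * D') * (K * D) = 0\<^sub>m r' r"
  proof -
    have tY: "transpose_mat (Y * D') = D' * transpose_mat Y"
      unfolding D'_def using transpose_mult[OF c(2) mat_diag_dim] by simp
    have tc: "transpose_mat Y \<in> carrier_mat r' m" using c by simp
    have Dc: "D \<in> carrier_mat r r" "D' \<in> carrier_mat r' r'" by (simp_all add: D_def D'_def)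
    have "D' * transpose_mat Y * (K * D) = D' * (transpose_mat Y * (K * D))"
      by (rule assoc_mult_mat[OF Dc(2) tc mult_carrier_mat[OF c(1) Dc(1)]])
    also have "transpose_mat Y * (K * D) = transpose_mat Y * K * D"
      by (rule assoc_mult_mat[OF tc c(1) Dc(1), symmetric])
    finally show ?thesis unfolding tY YK left_mult_zero_mat[OF Dc(1)] right_mult_zero_mat[OF Dc(2)] .
  qed
  show ?thesis by (rule that[OF K' Y'(1,2,4,5,3,6) YU YV YK'])
qed

text \<open>\<open>K\<close> and \<open>Y\<close> are completed to a unimodular matrix, and their normalizations at infinity to a
  biproper one. The quotient of the two is block triangular with diagonal blocks made of the powers
  of \<open>s\<close>, and its determinant has degree 0.\<close>

lemma reduced_dual_sum:
  fixes K Y :: "'a::field ratfun mat"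
  assumes K: "reduced m r K e" and Y: "reduced m r' Y f" and m: "r + r' = m"
    and YK: "transpose_mat Y * K = 0\<^sub>m r' r"
  shows "(\<Sum>i<r. e i) = (\<Sum>i<r'. f i)"
proof -
  let ?De = "sdiag r (\<lambda>i. - e i) :: 'a ratfun mat"
  let ?Df = "sdiag r' (\<lambda>i. - f i) :: 'a ratfun mat"
  obtain X Z U V where K': "K \<in> mats polys m r" "X \<in> mats polys r m" "X * K = 1\<^sub>m r"
    "K * ?De \<in> mats propers m r" "Z \<in> mats propers r m" "Z * (K * ?De) = 1\<^sub>m r"
    and Y': "Y \<in> mats polys m r'" "U \<in> mats polys r' m" "Y * ?Df \<in> mats propers m r'" "V \<in> mats propers r' m"
    and YU: "transpose_mat Y * transpose_mat U = 1\<^sub>m r'" and YV: "transpose_mat (Y * ?Df) * transpose_mat V = 1\<^sub>m r'"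
    and YK': "transpose_mat (Y * ?Df) * (K * ?De) = 0\<^sub>m r' r"
    using reduced_dual_inverses[OF K Y YK] by metis
  note c = K'(1)[THEN mats_carrier] K'(2)[THEN mats_carrier] K'(5)[THEN mats_carrier]
    Y'(1)[THEN mats_carrier] Y'(2)[THEN mats_carrier] Y'(4)[THEN mats_carrier]
  have tY: "transpose_mat (Y * ?Df) = ?Df * transpose_mat Y"
    using c by (subst transpose_mult[of _ m r' _ r']) auto
  let ?T = "X - X * transpose_mat U * transpose_mat Y"
  let ?W = "vcat ?T (transpose_mat Y)"
  let ?B = "hcat (K * ?De) (transpose_mat V)"
  have W: "inv_over polys m ?W (hcat K (transpose_mat U))" and TK: "?T * K = 1\<^sub>m r"
    using polys.completion[OF K'(1-3) mats_transpose[OF Y'(1)] mats_transpose[OF Y'(2)] YU YK m] by auto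
  have B: "inv_over propers m ?B (vcat (Z - Z * transpose_mat V * transpose_mat (Y * ?Df)) (transpose_mat (Y * ?Df)))"
    using propers.completion(1)[OF K'(4-6) mats_transpose[OF Y'(3)] mats_transpose[OF Y'(4)] YV YK' m]
    by (rule inv_over_sym)
  have Tc: "?T \<in> carrier_mat r m" using c by auto
  have "?W * ?B = four_block_mat (?T * (K * ?De)) (?T * transpose_mat V)
      (transpose_mat Y * (K * ?De)) (transpose_mat Y * transpose_mat V)"
    using c by (intro vcat_mult_hcat) auto
  moreover have "?T * (K * ?De) = ?De"
    unfolding assoc_mult_mat[OF Tc c(1) mat_diag_dim, symmetric] TK by (rule left_mult_one_mat[OF mat_diag_dim])
  moreover have "transpose_mat Y * (K * ?De) = 0\<^sub>m r' r"
    unfolding assoc_mult_mat[OF transpose_carrier_mat[THEN iffD2, OF c(4)] c(1) mat_diag_dim, symmetric] YK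
    by (rule left_mult_zero_mat[OF mat_diag_dim])
  moreover have "transpose_mat Y * transpose_mat V = sdiag r' f"
  proof -
    have "?Df * (transpose_mat Y * transpose_mat V) = 1\<^sub>m r'"
      using YV unfolding tY using c by (simp add: assoc_mult_mat[of _ r' r' _ m _ r'])
    then have "sdiag r' f * (?Df * (transpose_mat Y * transpose_mat V)) = sdiag r' f"
      using right_mult_one_mat[OF mat_diag_dim] by simp
    moreover have "sdiag r' f * (?Df * (transpose_mat Y * transpose_mat V)) = transpose_mat Y * transpose_mat V"
      using assoc_mult_mat[of "sdiag r' f :: 'a ratfun mat" r' r' ?Df r' "transpose_mat Y * transpose_mat V" r'] c
      unfolding sdiag_inverse by simp
    ultimately show ?thesis by simp
  qed
  ultimately have "?W * ?B = four_block_mat ?De (?T * transpose_mat V) (0\<^sub>m r' r) (sdiag r' f)"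
    by simp
  moreover have "det (four_block_mat ?De (?T * transpose_mat V) (0\<^sub>m r' r) (sdiag r' f)) =
      det ?De * det (sdiag r' f)"
    using Tc c by (intro det_four_block_mat_lower_left_zero) auto
  ultimately have "det (?W * ?B) = det ?De * det (sdiag r' f)" by simp
  also have "\<dots> = spow (- (\<Sum>i<r. e i) + (\<Sum>i<r'. f i))"
    by (simp only: det_mat_diag spow_prod sum_negf spow_add)
  finally have "det ?W * det ?B = spow (- (\<Sum>i<r. e i) + (\<Sum>i<r'. f i))"
    using det_mult[OF inv_over_carrier(1)[OF W] inv_over_carrier(1)[OF B]] by simp
  then have "rdeg (det ?W) + rdeg (det ?B) = - (\<Sum>i<r. e i) + (\<Sum>i<r'. f i)"
    using rdeg_mult[of "det ?W" "det ?B"] rdeg_det_unimodular[OF W] rdeg_det_biproper[OF B] rdeg_spow by metis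
  then show ?thesis using rdeg_det_unimodular[OF W] rdeg_det_biproper[OF B] by simp
qed

section \<open>Minimal bases are the reduced matrices\<close>

definition basis_mat :: "nat \<Rightarrow> 'a::field poly vec list \<Rightarrow> 'a ratfun mat" where
  "basis_mat m bs = mat m (length bs) (\<lambda>(i, j). to_fract (bs ! j $ i))"

definition col_image :: "nat \<Rightarrow> nat \<Rightarrow> 'b::field mat \<Rightarrow> 'b vec set" where
  "col_image m r K = {y \<in> carrier_vec m. \<exists>u \<in> carrier_vec r. K *\<^sub>v u = y}"

lemma map_vec_to_fract_inj: "map_vec to_fract v = map_vec to_fract w \<Longrightarrow> v = w"
  by (auto simp: vec_eq_iff)

lemma basis_mat_carrier [simp]: "basis_mat m bs \<in> carrier_mat m (length bs)"
  "dim_row (basis_mat m bs) = m" "dim_col (basis_mat m bs) = length bs"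
  by (simp_all add: basis_mat_def)

lemma basis_mat_cols:
  assumes "set bs \<subseteq> carrier_vec m"
  shows "cols (basis_mat m bs) = map (map_vec to_fract) bs"
proof (rule nth_equalityI)
  fix j assume "j < length (cols (basis_mat m bs))"
  then have "j < length bs" by simp
  moreover from this have "dim_vec (bs ! j) = m" using assms nth_mem[of j bs] carrier_vecD by blast
  ultimately show "cols (basis_mat m bs) ! j = map (map_vec to_fract) bs ! j"
    by (intro eq_vecI) (auto simp: basis_mat_def)
qed simp

lemma basis_mat_index:
  "i < m \<Longrightarrow> j < length bs \<Longrightarrow> basis_mat m bs $$ (i, j) = to_fract (bs ! j $ i)"
  by (simp add: basis_mat_def)

lemma mult_mat_vec_index:
  fixes K :: "'b::field mat"
  assumes "K \<in> carrier_mat m r" "u \<in> carrier_vec r" "i < m"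
  shows "(K *\<^sub>v u) $ i = (\<Sum>b<r. K $$ (i, b) * u $ b)"
  using assms by (auto simp: scalar_prod_def atLeast0LessThan intro: sum.cong)

lemma mult_unit_vec:
  fixes K :: "'b::field mat"
  assumes "K \<in> carrier_mat m r" "i < r"
  shows "K *\<^sub>v unit_vec r i = col K i"
  using assms by (intro eq_vecI) auto

lemma distinct_if_injective:
  fixes K :: "'b::field mat"
  assumes K: "K \<in> carrier_mat m r"
    and inj: "\<And>u. u \<in> carrier_vec r \<Longrightarrow> K *\<^sub>v u = 0\<^sub>v m \<Longrightarrow> u = 0\<^sub>v r"
  shows "distinct (cols K)"
proof -
  have "i = j" if ij: "i < r" "j < r" "col K i = col K j" for i j
  proof (rule ccontr)
    assume "i \<noteq> j"
    have "K *\<^sub>v (unit_vec r i - unit_vec r j) = K *\<^sub>v unit_vec r i - K *\<^sub>v unit_vec r j"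
      using K by (intro mult_minus_distrib_mat_vec) auto
    also have "\<dots> = 0\<^sub>v m"
      using K ij mult_unit_vec[OF K ij(1)] mult_unit_vec[OF K ij(2)] by auto
    finally have "unit_vec r i - unit_vec r j = (0\<^sub>v r :: 'b vec)" using inj by simp
    then have "(unit_vec r i - unit_vec r j :: 'b vec) $ i = 0\<^sub>v r $ i" by simp
    then show False using ij \<open>i \<noteq> j\<close> by simp
  qed
  then show ?thesis using K by (auto simp: distinct_conv_nth)
qed

text \<open>Independence and span become injectivity and image of a matrix. All later arguments use bases in
  this form.\<close>

lemma polynomial_basis_iff:
  fixes bs :: "'a::field poly vec list"
  shows "polynomial_basis m V bs \<longleftrightarrow> set bs \<subseteq> carrier_vec m \<and>
    (\<forall>u \<in> carrier_vec (length bs). basis_mat m bs *\<^sub>v u = 0\<^sub>v m \<longrightarrow> u = 0\<^sub>v (length bs)) \<and>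
    col_image m (length bs) (basis_mat m bs) = V"
proof (cases "set bs \<subseteq> carrier_vec m")
  case bs: True
  interpret vec_space "TYPE('a ratfun)" m .
  let ?K = "basis_mat m bs"
  have K: "?K \<in> carrier_mat m (length bs)" by simp
  have cs: "set (cols ?K) = map_vec to_fract ` set bs" using basis_mat_cols[OF bs] by simp
  have span: "span (set (cols ?K)) = col_image m (length bs) ?K"
    using col_space_eq[OF K] K unfolding col_space_def col_image_def by simp
  have dist: "distinct (cols ?K) \<longleftrightarrow> distinct bs"
    unfolding basis_mat_cols[OF bs] distinct_map by (auto intro!: inj_onI map_vec_to_fract_inj)
  have "distinct bs \<and> \<not> lin_dep (set (cols ?K)) \<longleftrightarrow>
    (\<forall>u \<in> carrier_vec (length bs). ?K *\<^sub>v u = 0\<^sub>v m \<longrightarrow> u = 0\<^sub>v (length bs))"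
  proof
    assume "distinct bs \<and> \<not> lin_dep (set (cols ?K))"
    then show "\<forall>u \<in> carrier_vec (length bs). ?K *\<^sub>v u = 0\<^sub>v m \<longrightarrow> u = 0\<^sub>v (length bs)"
      using lin_depI[OF K] dist by blast
  next
    assume inj: "\<forall>u \<in> carrier_vec (length bs). ?K *\<^sub>v u = 0\<^sub>v m \<longrightarrow> u = 0\<^sub>v (length bs)"
    then have d: "distinct (cols ?K)" by (intro distinct_if_injective[OF K]) blast
    moreover have "\<not> lin_dep (set (cols ?K))" using lin_depE[OF K _ d] inj by blast
    ultimately show "distinct bs \<and> \<not> lin_dep (set (cols ?K))" using dist by blast
  qed
  then show ?thesis unfolding polynomial_basis_def using bs cs span by (auto simp only:)
qed (simp add: polynomial_basis_def)

text \<open>The rank depends only on the span of the columns.\<close>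

lemma polynomial_basis_length:
  fixes bs :: "'a::field poly vec list"
  assumes "polynomial_basis m V bs" "K \<in> carrier_mat m n" "col_image m n K = V"
  shows "vec_space.rank m K = length bs"
proof -
  interpret vec_space "TYPE('a ratfun)" m .
  let ?B = "basis_mat m bs"
  have bs: "set bs \<subseteq> carrier_vec m" using assms(1) by (simp add: polynomial_basis_def)
  have B: "?B \<in> carrier_mat m (length bs)" by simp
  have cs: "set (cols ?B) = map_vec to_fract ` set bs" using basis_mat_cols[OF bs] by simp
  have "distinct (cols ?B)"
    using assms(1) unfolding basis_mat_cols[OF bs] distinct_map polynomial_basis_def
    by (auto intro!: inj_onI map_vec_to_fract_inj)
  moreover have "\<not> lin_dep (set (cols ?B))" using assms(1) unfolding cs polynomial_basis_def by blast
  ultimately have "rank ?B = length bs" by (intro lin_indpt_full_rank[OF B])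
  moreover have "span (set (cols ?B)) = V" using assms(1) unfolding cs polynomial_basis_def by blast
  moreover have "span (set (cols K)) = V"
    using col_space_eq[OF assms(2)] assms(2,3) unfolding col_space_def col_image_def by simp
  ultimately show ?thesis unfolding rank_def by simp
qed

lemma vec_degree_ge: "v \<in> carrier_vec m \<Longrightarrow> i < m \<Longrightarrow> degree (v $ i) \<le> vec_degree v"
  unfolding vec_degree_def by (intro Max_ge) (auto simp: setcompr_eq_image)

lemma vec_degree_le:
  assumes "v \<in> carrier_vec m" "0 < m" "\<And>i. i < m \<Longrightarrow> degree (v $ i) \<le> d"
  shows "vec_degree v \<le> d"
  unfolding vec_degree_def using assms by (intro Max.boundedI) (auto simp: setcompr_eq_image)

lemma basis_mat_entry_degree:
  fixes bs :: "'a::field poly vec list"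
  assumes "set bs \<subseteq> carrier_vec m" "i < m" "j < length bs"
  shows "basis_mat m bs $$ (i, j) = 0 \<or> rdeg (basis_mat m bs $$ (i, j)) \<le> int (vec_degree (bs ! j))"
proof -
  have "bs ! j \<in> carrier_vec m" using assms nth_mem[of j bs] by blast
  then show ?thesis using vec_degree_ge[of "bs ! j" m i] assms
    by (cases "bs ! j $ i = 0") (simp_all add: basis_mat_index rdeg_to_fract)
qed

lemma rdeg_mult_le:
  "x = 0 \<or> rdeg x \<le> a \<Longrightarrow> y = 0 \<or> rdeg y \<le> b \<Longrightarrow> a + b \<le> c \<Longrightarrow> x * y = 0 \<or> rdeg (x * y) \<le> c"
  using rdeg_mult[of x y] by fastforce

lemma basis_mat_proper:
  fixes bs :: "'a::field poly vec list"
  assumes "set bs \<subseteq> carrier_vec m"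
  shows "basis_mat m bs * sdiag (length bs) (\<lambda>i. - int (vec_degree (bs ! i))) \<in> mats propers m (length bs)"
proof -
  have "proper_ratfun (basis_mat m bs $$ (i, j) * spow (- int (vec_degree (bs ! j))))"
    if "i < m" "j < length bs" for i j
    unfolding proper_iff_rdeg
    using basis_mat_entry_degree[OF assms that] by (rule rdeg_mult_le[where b = "- int (vec_degree (bs ! j))"]) (simp_all only: rdeg_spow add.right_inverse order_refl simp_thms)
  then show ?thesis
    by (simp add: mats_def mat_diag_mult_right[OF basis_mat_carrier(1)])
qed

text \<open>Replacing a basis vector by a polynomial combination that involves it gives another basis.\<close>

lemma minimal_basis_exchange:
  fixes bs :: "'a::field poly vec list"
  assumes min: "minimal_basis m V bs" and u: "u \<in> carrier_vec (length bs)"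
    and j: "j < length bs" "u $ j \<noteq> 0"
    and p: "p \<in> carrier_vec m" "map_vec to_fract p = basis_mat m bs *\<^sub>v u"
  shows "vec_degree (bs ! j) \<le> vec_degree p"
proof -
  let ?r = "length bs"
  let ?K = "basis_mat m bs"
  have pb: "polynomial_basis m V bs" using min by (simp add: minimal_basis_def)
  then have bs: "set bs \<subseteq> carrier_vec m"
    and inj: "\<And>u. u \<in> carrier_vec ?r \<Longrightarrow> ?K *\<^sub>v u = 0\<^sub>v m \<Longrightarrow> u = 0\<^sub>v ?r"
    and V: "col_image m ?r ?K = V"
    unfolding polynomial_basis_iff by blast+
  have K: "?K \<in> carrier_mat m ?r" by simp
  let ?bs = "bs[j := p]"
  have bs': "set ?bs \<subseteq> carrier_vec m" using bs p(1) set_update_subset_insert[of bs j p] by blast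
  have K': "basis_mat m ?bs \<in> carrier_mat m ?r" by (simp add: carrier_matI)
  define f where "f w = vec ?r (\<lambda>i. (if i = j then 0 else w $ i) + w $ j * u $ i)" for w
  have eq: "basis_mat m ?bs *\<^sub>v w = ?K *\<^sub>v f w" if w: "w \<in> carrier_vec ?r" for w
  proof (rule eq_vecI)
    fix i assume "i < dim_vec (?K *\<^sub>v f w)"
    then have i: "i < m" by simp
    have pi: "to_fract (p $ i) = (\<Sum>b<?r. ?K $$ (i, b) * u $ b)"
      using arg_cong[OF p(2), of "\<lambda>v. v $ i"] p(1) i mult_mat_vec_index[OF K u i] by simp
    have "(?K *\<^sub>v f w) $ i = (\<Sum>b<?r. ?K $$ (i, b) * ((if b = j then 0 else w $ b) + w $ j * u $ b))"
      using i by (subst mult_mat_vec_index[OF K _ i]) (auto simp: f_def)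
    also have "\<dots> = (\<Sum>b<?r. ?K $$ (i, b) * (if b = j then 0 else w $ b)) + (\<Sum>b<?r. ?K $$ (i, b) * (w $ j * u $ b))"
      by (simp only: distrib_left sum.distrib)
    also have "(\<Sum>b<?r. ?K $$ (i, b) * (w $ j * u $ b)) = to_fract (p $ i) * w $ j"
      unfolding pi sum_distrib_right by (simp add: mult_ac)
    also have "(\<Sum>b<?r. ?K $$ (i, b) * (if b = j then 0 else w $ b)) =
        (\<Sum>b\<in>{..<?r} - {j}. ?K $$ (i, b) * (if b = j then 0 else w $ b))"
      using j by (subst sum.remove[of _ j]) auto
    also have "\<dots> = (\<Sum>b\<in>{..<?r} - {j}. basis_mat m ?bs $$ (i, b) * w $ b)"
      using i bs bs' by (intro sum.cong) (auto simp: basis_mat_index)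
    also have "\<dots> + to_fract (p $ i) * w $ j = (\<Sum>b<?r. basis_mat m ?bs $$ (i, b) * w $ b)"
      using i j bs' by (subst (2) sum.remove[of _ j]) (auto simp: basis_mat_index)
    finally show "(basis_mat m ?bs *\<^sub>v w) $ i = (?K *\<^sub>v f w) $ i"
      using mult_mat_vec_index[OF K' w i] by simp
  qed simp
  have f: "f w \<in> carrier_vec ?r" for w by (simp add: f_def)
  have "polynomial_basis m V ?bs"
    unfolding polynomial_basis_iff length_list_update
  proof (intro conjI ballI impI)
    show "set ?bs \<subseteq> carrier_vec m" by (rule bs')
    show "w = 0\<^sub>v ?r" if w: "w \<in> carrier_vec ?r" "basis_mat m ?bs *\<^sub>v w = 0\<^sub>v m" for w
    proof -
      have fw: "f w = 0\<^sub>v ?r" using inj[OF f] eq[OF w(1)] w(2) by simp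
      have "f w $ j = 0" using fw j by simp
      then have wj: "w $ j = 0" using j by (simp add: f_def)
      have "w $ i = 0" if "i < ?r" for i
      proof -
        have "f w $ i = 0" using fw that by simp
        then show ?thesis using wj that by (cases "i = j") (simp_all add: f_def)
      qed
      then show ?thesis using w(1) by (intro eq_vecI) auto
    qed
    have "\<exists>w \<in> carrier_vec ?r. basis_mat m ?bs *\<^sub>v w = y"
      if "z \<in> carrier_vec ?r" "?K *\<^sub>v z = y" for y z
    proof -
      define w where "w = vec ?r (\<lambda>i. if i = j then z $ j / u $ j else z $ i - z $ j / u $ j * u $ i)"
      have w: "w \<in> carrier_vec ?r" by (simp add: w_def)
      have "f w = z" using that(1) j by (intro eq_vecI) (auto simp: f_def w_def)
      then show ?thesis using eq[OF w] that(2) w by auto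
    qed
    then show "col_image m ?r (basis_mat m ?bs) = V"
      unfolding V[symmetric] col_image_def using eq f by auto
  qed
  then have "basis_order bs \<le> basis_order ?bs" using min by (simp add: minimal_basis_def)
  moreover have "basis_order ?bs = basis_order bs + vec_degree p - vec_degree (bs ! j)"
    using j unfolding basis_order_def map_update by (subst sum_list_update) auto
  moreover have "vec_degree (bs ! j) \<le> basis_order bs"
    unfolding basis_order_def using j by (intro member_le_sum_list) auto
  ultimately show ?thesis by linarith
qed

text \<open>A negative bound \<open>d\<close> is allowed: it forces the combination to be 0, which independence excludes.\<close>

lemma minimal_basis_degree:
  fixes bs :: "'a::field poly vec list"
  assumes m: "0 < m" and min: "minimal_basis m V bs" and u: "u \<in> carrier_vec (length bs)"
    and j: "j < length bs" "u $ j \<noteq> 0"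
    and pol: "\<And>i. i < m \<Longrightarrow> (basis_mat m bs *\<^sub>v u) $ i \<in> polys"
    and deg: "\<And>i. i < m \<Longrightarrow> (basis_mat m bs *\<^sub>v u) $ i = 0 \<or> rdeg ((basis_mat m bs *\<^sub>v u) $ i) \<le> d"
  shows "int (vec_degree (bs ! j)) \<le> d"
proof -
  let ?K = "basis_mat m bs"
  have "\<forall>i. \<exists>a. i < m \<longrightarrow> (?K *\<^sub>v u) $ i = to_fract a" using pol by blast
  then obtain a where a: "\<And>i. i < m \<Longrightarrow> (?K *\<^sub>v u) $ i = to_fract (a i)" by metis
  have p: "map_vec to_fract (vec m a) = ?K *\<^sub>v u"
    by (rule eq_vecI) (simp_all only: a[symmetric] dim_mult_mat_vec basis_mat_carrier index_map_vec dim_vec index_vec)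
  have dega: "a i = 0 \<or> int (degree (a i)) \<le> d" if "i < m" for i
    using deg[OF that] unfolding a[OF that] by (cases "a i = 0") (auto simp: rdeg_to_fract)
  have "d \<ge> 0"
  proof (rule ccontr)
    assume "\<not> d \<ge> 0"
    then have "a i = 0" if "i < m" for i using dega[OF that] by linarith
    then have "?K *\<^sub>v u = 0\<^sub>v m" unfolding p[symmetric] by (intro eq_vecI) simp_all
    then have "u = 0\<^sub>v (length bs)"
      using min u unfolding minimal_basis_def polynomial_basis_iff by blast
    then show False using j by simp
  qed
  have "vec_degree (vec m a) \<le> nat d"
  proof (rule vec_degree_le[OF _ m])
    show "degree (vec m a $ i) \<le> nat d" if "i < m" for i
      using dega[OF that] that \<open>d \<ge> 0\<close> by (cases "a i = 0") auto
  qed simp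
  moreover have "vec_degree (bs ! j) \<le> vec_degree (vec m a)"
    by (rule minimal_basis_exchange[OF min u j _ p]) simp
  ultimately show ?thesis using \<open>d \<ge> 0\<close> by linarith
qed

lemma ex_maximal_weight:
  fixes e :: "nat \<Rightarrow> 'c::linorder"
  assumes "finite J" "J \<noteq> {}"
  obtains j where "j \<in> J" "\<And>b. b \<in> J \<Longrightarrow> e b \<le> e j"
proof -
  have "Max (e ` J) \<in> e ` J" using assms by simp
  then obtain j where "j \<in> J" "e j = Max (e ` J)" by auto
  then show ?thesis using that[of j] assms by simp
qed

text \<open>Polynomial parts of the coefficients can be subtracted. What remains has strictly proper
  coefficients, and so smaller degree than the basis vector of largest degree that it involves, unless it
  involves none.\<close>

lemma minimal_basis_saturated_polys:
  fixes bs :: "'a::field poly vec list"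
  assumes m: "0 < m" and min: "minimal_basis m V bs" and u: "u \<in> carrier_vec (length bs)"
    and pol: "\<And>i. i < m \<Longrightarrow> (basis_mat m bs *\<^sub>v u) $ i \<in> polys"
    and b: "b < length bs"
  shows "u $ b \<in> polys"
proof -
  let ?r = "length bs"
  let ?K = "basis_mat m bs"
  have bs: "set bs \<subseteq> carrier_vec m" using min by (simp add: minimal_basis_def polynomial_basis_def)
  have K: "?K \<in> carrier_mat m ?r" by simp
  have KS: "?K $$ (i, b) \<in> polys" if "i < m" "b < ?r" for i b
    using that by (simp add: basis_mat_index)
  have "\<forall>b. \<exists>p. p \<in> polys \<and> (u $ b - p = 0 \<or> rdeg (u $ b - p) < 0)" by (metis polynomial_part)
  then obtain p where p: "\<And>b. p b \<in> polys" "\<And>b. u $ b - p b = 0 \<or> rdeg (u $ b - p b) < 0" by metis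
  define w where "w = vec ?r (\<lambda>b. u $ b - p b)"
  have w: "w \<in> carrier_vec ?r" by (simp add: w_def)
  have Kw: "(?K *\<^sub>v w) $ i = (?K *\<^sub>v u) $ i - (\<Sum>b<?r. ?K $$ (i, b) * p b)" if "i < m" for i
    unfolding mult_mat_vec_index[OF K w that] mult_mat_vec_index[OF K u that] sum_subtractf[symmetric]
    by (intro sum.cong) (simp_all add: w_def right_diff_distrib)
  have Kwp: "(?K *\<^sub>v w) $ i \<in> polys" if "i < m" for i
    unfolding Kw[OF that] using pol[OF that] KS[OF that] p
    by (intro polys.diff_mem polys.sum_mem polys.mult_mem) auto
  have "w $ c = 0" if c: "c < ?r" for c
  proof (rule ccontr)
    assume "w $ c \<noteq> 0"
    then have "{c. c < ?r \<and> w $ c \<noteq> 0} \<noteq> {}" using c by blast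
    then obtain j where j: "j \<in> {c. c < ?r \<and> w $ c \<noteq> 0}"
      and jmax: "\<And>b. b \<in> {c. c < ?r \<and> w $ c \<noteq> 0} \<Longrightarrow> vec_degree (bs ! b) \<le> vec_degree (bs ! j)"
      using ex_maximal_weight[of "{c. c < ?r \<and> w $ c \<noteq> 0}" "\<lambda>b. vec_degree (bs ! b)"] by auto
    have "int (vec_degree (bs ! j)) \<le> int (vec_degree (bs ! j)) - 1"
    proof (rule minimal_basis_degree[OF m min w])
      show "j < ?r" "w $ j \<noteq> 0" using j by auto
      show "(?K *\<^sub>v w) $ i \<in> polys" if "i < m" for i by (rule Kwp[OF that])
      show "(?K *\<^sub>v w) $ i = 0 \<or> rdeg ((?K *\<^sub>v w) $ i) \<le> int (vec_degree (bs ! j)) - 1" if i: "i < m" for i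
        unfolding mult_mat_vec_index[OF K w i]
      proof (rule rdeg_sum_le)
        fix b assume "b \<in> {..<?r}"
        then have b: "b < ?r" by simp
        show "?K $$ (i, b) * w $ b = 0 \<or> rdeg (?K $$ (i, b) * w $ b) \<le> int (vec_degree (bs ! j)) - 1"
        proof (cases "w $ b = 0")
          case False
          then have "rdeg (w $ b) \<le> - 1" using p(2)[of b] b by (auto simp: w_def)
          moreover have "vec_degree (bs ! b) \<le> vec_degree (bs ! j)" using jmax b False by simp
          ultimately show ?thesis
            using basis_mat_entry_degree[OF bs i b] by (intro rdeg_mult_le[of _ "int (vec_degree (bs ! b))" _ "- 1"]) auto
        qed simp
      qed
    qed
    then show False by simp
  qed
  then have "u $ b = p b" using b by (simp add: w_def)
  then show ?thesis using p by simp
qed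

text \<open>If some coefficient were not proper, let \<open>t > 0\<close> be the largest degree of a coefficient and \<open>e\<^sub>j\<close>
  the largest weight among those attaining it. After scaling by \<open>s\<close> to the power \<open>e\<^sub>j - t\<close>, the
  polynomial parts of the coefficients give a combination of degree less than \<open>e\<^sub>j\<close> that involves the
  basis vector \<open>j\<close>.\<close>

lemma minimal_basis_saturated_propers:
  fixes bs :: "'a::field poly vec list"
  assumes m: "0 < m" and min: "minimal_basis m V bs" and u: "u \<in> carrier_vec (length bs)"
    and pro: "\<And>i. i < m \<Longrightarrow>
      (basis_mat m bs * sdiag (length bs) (\<lambda>i. - int (vec_degree (bs ! i))) *\<^sub>v u) $ i \<in> propers"
    and b: "b < length bs"
  shows "u $ b \<in> propers"
proof (rule ccontr)
  let ?r = "length bs"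
  let ?K = "basis_mat m bs"
  let ?e = "\<lambda>b. int (vec_degree (bs ! b))"
  assume "u $ b \<notin> propers"
  then have nb: "u $ b \<noteq> 0" "rdeg (u $ b) > 0" by (auto simp: proper_iff_rdeg)
  have bs: "set bs \<subseteq> carrier_vec m" using min by (simp add: minimal_basis_def polynomial_basis_def)
  have K: "?K \<in> carrier_mat m ?r" by simp
  have KS: "?K $$ (i, b) \<in> polys" if "i < m" "b < ?r" for i b
    using that by (simp add: basis_mat_index)
  have "b \<in> {c. c < ?r \<and> u $ c \<noteq> 0}" using b nb by simp
  then have "{c. c < ?r \<and> u $ c \<noteq> 0} \<noteq> {}" by blast
  then obtain j0 where j0: "j0 \<in> {c. c < ?r \<and> u $ c \<noteq> 0}"
    and j0max: "\<And>b. b \<in> {c. c < ?r \<and> u $ c \<noteq> 0} \<Longrightarrow> rdeg (u $ b) \<le> rdeg (u $ j0)"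
    using ex_maximal_weight[of "{c. c < ?r \<and> u $ c \<noteq> 0}" "\<lambda>b. rdeg (u $ b)"] by auto
  define t where "t = rdeg (u $ j0)"
  have t: "t > 0" unfolding t_def using j0max[of b] b nb by simp
  have tmax: "rdeg (u $ c) \<le> t" if "c < ?r" "u $ c \<noteq> 0" for c
    unfolding t_def using j0max[of c] that by simp
  have "{c. c < ?r \<and> u $ c \<noteq> 0 \<and> rdeg (u $ c) = t} \<noteq> {}" using j0 unfolding t_def by blast
  then obtain j where "j \<in> {c. c < ?r \<and> u $ c \<noteq> 0 \<and> rdeg (u $ c) = t}"
    and "\<And>b. b \<in> {c. c < ?r \<and> u $ c \<noteq> 0 \<and> rdeg (u $ c) = t} \<Longrightarrow> ?e b \<le> ?e j"
    using ex_maximal_weight[of "{c. c < ?r \<and> u $ c \<noteq> 0 \<and> rdeg (u $ c) = t}" ?e] by auto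
  then have j: "j < ?r" "u $ j \<noteq> 0" "rdeg (u $ j) = t"
    and jmax: "\<And>b. b < ?r \<Longrightarrow> u $ b \<noteq> 0 \<Longrightarrow> rdeg (u $ b) = t \<Longrightarrow> ?e b \<le> ?e j" by auto
  define w where "w c = spow (?e j - t - ?e c) * u $ c" for c
  have wdeg: "rdeg (w c) = ?e j - t - ?e c + rdeg (u $ c)" if "u $ c \<noteq> 0" for c
    unfolding w_def using that rdeg_mult[of "spow (?e j - t - ?e c)" "u $ c"] rdeg_spow spow_nonzero by metis
  have "\<forall>c. \<exists>p. p \<in> polys \<and> (w c - p = 0 \<or> rdeg (w c - p) < 0)" by (metis polynomial_part)
  then obtain p where p: "\<And>c. p c \<in> polys" "\<And>c. w c - p c = 0 \<or> rdeg (w c - p c) < 0" by metis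
  have Kw: "(\<Sum>c<?r. ?K $$ (i, c) * w c) = 0 \<or> rdeg (\<Sum>c<?r. ?K $$ (i, c) * w c) \<le> ?e j - 1"
    if i: "i < m" for i
  proof -
    have "(?K * sdiag ?r (\<lambda>i. - ?e i) *\<^sub>v u) $ i = (\<Sum>c<?r. ?K $$ (i, c) * spow (- ?e c) * u $ c)"
      using i by (subst mult_mat_vec_index[of _ m ?r])
        (auto simp: u mat_diag_mult_right[OF K] intro: sum.cong)
    moreover have "(\<Sum>c<?r. ?K $$ (i, c) * w c) = spow (?e j - t) * (\<Sum>c<?r. ?K $$ (i, c) * spow (- ?e c) * u $ c)"
      unfolding sum_distrib_left w_def
    proof (rule sum.cong[OF refl])
      fix c
      have "spow (?e j - t - ?e c) = spow (?e j - t) * (spow (- ?e c) :: 'a ratfun)"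
        by (simp only: spow_add[symmetric]) simp
      then show "?K $$ (i, c) * (spow (?e j - t - ?e c) * u $ c) =
          spow (?e j - t) * (?K $$ (i, c) * spow (- ?e c) * u $ c)"
        by (simp only: mult_ac)
    qed
    ultimately have *: "(\<Sum>c<?r. ?K $$ (i, c) * w c) =
        spow (?e j - t) * (?K * sdiag ?r (\<lambda>i. - ?e i) *\<^sub>v u) $ i" by simp
    show ?thesis unfolding *
      using pro[OF i] t
      by (intro rdeg_mult_le[of _ "?e j - t" _ 0]) (auto simp: proper_iff_rdeg rdeg_spow)
  qed
  have rest: "?K $$ (i, c) * (w c - p c) = 0 \<or> rdeg (?K $$ (i, c) * (w c - p c)) \<le> ?e j - 1"
    if i: "i < m" and c: "c < ?r" for i c
  proof (cases "?e c \<le> ?e j")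
    case True
    have "w c - p c = 0 \<or> rdeg (w c - p c) \<le> - 1" using p(2)[of c] by linarith
    then show ?thesis
      using basis_mat_entry_degree[OF bs i c] True by (intro rdeg_mult_le[of _ "?e c" _ "- 1"]) auto
  next
    case False
    have wc: "w c = 0 \<or> rdeg (w c) \<le> ?e j - ?e c - 1"
    proof (cases "u $ c = 0")
      case nz: False
      then have "rdeg (u $ c) \<noteq> t" using jmax[OF c] False by auto
      then have "rdeg (u $ c) < t" using tmax[OF c nz] by simp
      then show ?thesis using wdeg[OF nz] by simp
    qed (simp add: w_def)
    have "p c = 0"
    proof (rule ccontr)
      assume "p c \<noteq> 0"
      have "w c + - (w c - p c) = 0 \<or> rdeg (w c + - (w c - p c)) \<le> - 1"
        using wc p(2)[of c] False by (intro rdeg_add_le) (auto simp del: minus_diff_eq)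
      then have "rdeg (p c) \<le> - 1" using \<open>p c \<noteq> 0\<close> by simp
      then show False using polys_rdeg_nonneg[OF p(1) \<open>p c \<noteq> 0\<close>] by simp
    qed
    then show ?thesis
      using basis_mat_entry_degree[OF bs i c] wc by (intro rdeg_mult_le[of _ "?e c" _ "?e j - ?e c - 1"]) auto
  qed
  have "p j \<noteq> 0"
  proof
    assume "p j = 0"
    moreover have "rdeg (w j) = 0" using wdeg[OF j(2)] j(3) by simp
    moreover have "w j \<noteq> 0" using j(2) by (simp add: w_def)
    ultimately show False using p(2)[of j] by simp
  qed
  define q where "q = vec ?r p"
  have q: "q \<in> carrier_vec ?r" by (simp add: q_def)
  have Kq: "(?K *\<^sub>v q) $ i = (\<Sum>c<?r. ?K $$ (i, c) * p c)" if "i < m" for i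
    unfolding mult_mat_vec_index[OF K q that] by (simp add: q_def)
  have "?e j \<le> ?e j - 1"
  proof (rule minimal_basis_degree[OF m min q j(1)])
    show "q $ j \<noteq> 0" using \<open>p j \<noteq> 0\<close> j by (simp add: q_def)
    show "(?K *\<^sub>v q) $ i \<in> polys" if "i < m" for i
      unfolding Kq[OF that] using KS[OF that] p(1) by (intro polys.sum_mem polys.mult_mem) auto
    show "(?K *\<^sub>v q) $ i = 0 \<or> rdeg ((?K *\<^sub>v q) $ i) \<le> ?e j - 1" if i: "i < m" for i
    proof -
      have "(?K *\<^sub>v q) $ i = (\<Sum>c<?r. ?K $$ (i, c) * w c) + - (\<Sum>c<?r. ?K $$ (i, c) * (w c - p c))"
        unfolding Kq[OF i] by (simp add: right_diff_distrib sum_subtractf)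
      moreover have "(\<Sum>c<?r. ?K $$ (i, c) * (w c - p c)) = 0 \<or>
          rdeg (\<Sum>c<?r. ?K $$ (i, c) * (w c - p c)) \<le> ?e j - 1"
        using rest[OF i] by (intro rdeg_sum_le) auto
      ultimately show ?thesis using rdeg_add_le[OF Kw[OF i], of "- (\<Sum>c<?r. ?K $$ (i, c) * (w c - p c))"] by simp
    qed
  qed
  then show False by simp
qed

lemma minimal_basis_reduced:
  fixes bs :: "'a::field poly vec list"
  assumes m: "0 < m" and min: "minimal_basis m V bs"
  shows "reduced m (length bs) (basis_mat m bs) (\<lambda>i. int (vec_degree (bs ! i)))"
    and "col_image m (length bs) (basis_mat m bs) = V"
proof -
  let ?r = "length bs"
  let ?K = "basis_mat m bs"
  let ?D = "sdiag ?r (\<lambda>i. - int (vec_degree (bs ! i))) :: 'a ratfun mat"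
  let ?D' = "sdiag ?r (\<lambda>i. int (vec_degree (bs ! i))) :: 'a ratfun mat"
  have bs: "set bs \<subseteq> carrier_vec m"
    and inj: "\<And>u. u \<in> carrier_vec ?r \<Longrightarrow> ?K *\<^sub>v u = 0\<^sub>v m \<Longrightarrow> u = 0\<^sub>v ?r"
    and V: "col_image m ?r ?K = V"
    using min unfolding minimal_basis_def polynomial_basis_iff by blast+
  have K: "?K \<in> carrier_mat m ?r" by simp
  have Kp: "?K \<in> mats polys m ?r" using K by (auto simp: mats_def basis_mat_index)
  have KD: "?K * ?D \<in> mats propers m ?r" by (rule basis_mat_proper[OF bs])
  have "\<exists>X \<in> mats polys ?r m. X * ?K = 1\<^sub>m ?r"
    using minimal_basis_saturated_polys[OF m min] inj by (intro polys.left_inverse_if_saturated[OF Kp]) blast+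
  moreover have "\<exists>Z \<in> mats propers ?r m. Z * (?K * ?D) = 1\<^sub>m ?r"
  proof (rule propers.left_inverse_if_saturated[OF KD])
    show "u $ b \<in> propers" if "u \<in> carrier_vec ?r" "\<And>i. i < m \<Longrightarrow> (?K * ?D *\<^sub>v u) $ i \<in> propers" "b < ?r" for u b
      by (rule minimal_basis_saturated_propers[OF m min that])
    show "u = 0\<^sub>v ?r" if u: "u \<in> carrier_vec ?r" "?K * ?D *\<^sub>v u = 0\<^sub>v m" for u
    proof -
      have "?K *\<^sub>v (?D *\<^sub>v u) = 0\<^sub>v m" using u assoc_mult_mat_vec[OF K mat_diag_dim u(1)] by simp
      then have D0: "?D *\<^sub>v u = 0\<^sub>v ?r" using inj[of "?D *\<^sub>v u"] u(1) mult_mat_vec_carrier[OF mat_diag_dim] by blast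
      have "u = ?D' * ?D *\<^sub>v u" unfolding sdiag_inverse using u(1) by simp
      also have "\<dots> = ?D' *\<^sub>v (?D *\<^sub>v u)" by (rule assoc_mult_mat_vec[OF mat_diag_dim mat_diag_dim u(1)])
      also have "\<dots> = 0\<^sub>v ?r" unfolding D0 by (auto simp: mat_diag_def)
      finally show ?thesis .
    qed
  qed
  ultimately show "reduced m ?r ?K (\<lambda>i. int (vec_degree (bs ! i)))"
    unfolding reduced_def using Kp KD by simp
  show "col_image m (length bs) (basis_mat m bs) = V" by (rule V)
qed

lemma minimal_basis_permute:
  assumes "minimal_basis p V bs" "mset cs = mset bs"
  shows "minimal_basis p V cs"
proof -
  have "set cs = set bs" "distinct cs = distinct bs"
    using assms(2) by (metis set_mset_mset, metis mset_eq_imp_distinct_iff)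
  moreover have "basis_order cs = basis_order bs"
    unfolding basis_order_def by (metis assms(2) mset_map sum_mset_sum_list)
  ultimately show ?thesis using assms(1) unfolding minimal_basis_def polynomial_basis_def by simp
qed

text \<open>Both orders of the indices are provided, because increasing indices of the column space will be
  paired with decreasing indices of the row space.\<close>

lemma has_minimal_indices_reduced:
  fixes V :: "'a::field ratfun vec set"
  assumes m: "0 < m" and V: "has_minimal_indices m V ks"
  obtains K L where "reduced m (length ks) K (\<lambda>i. int (ks ! i))" "col_image m (length ks) K = V"
    "reduced m (length ks) L (\<lambda>i. int (rev ks ! i))" "col_image m (length ks) L = V"
proof -
  obtain bs where bs: "minimal_basis m V bs" "ks = rev (sort (map vec_degree bs))"
    using V unfolding has_minimal_indices_def by blast
  define cs where "cs = sort_key vec_degree bs"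
  have cs: "minimal_basis m V cs" "minimal_basis m V (rev cs)"
    using minimal_basis_permute[OF bs(1)] unfolding cs_def by simp_all
  have "sort (map vec_degree bs) = map vec_degree cs"
    unfolding cs_def by (rule properties_for_sort) simp_all
  then have deg: "map vec_degree cs = rev ks" "map vec_degree (rev cs) = ks"
    using bs(2) by (simp_all add: rev_map)
  have len: "length cs = length ks" using arg_cong[OF deg(1), of length] by simp
  have "(\<lambda>i. int (vec_degree (cs ! i))) i = int (rev ks ! i)" if "i < length ks" for i
    using arg_cong[OF deg(1), of "\<lambda>l. l ! i"] that len by simp
  moreover have "(\<lambda>i. int (vec_degree (rev cs ! i))) i = int (ks ! i)" if "i < length ks" for i
    using arg_cong[OF deg(2), of "\<lambda>l. l ! i"] that len by simp
  moreover have cong: "reduced m r K e \<Longrightarrow> (\<And>i. i < r \<Longrightarrow> e i = f i) \<Longrightarrow> reduced m r K f"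
    for r and K :: "'a ratfun mat" and e f
  proof -
    assume "reduced m r K e" "\<And>i. i < r \<Longrightarrow> e i = f i"
    moreover have "mat_diag r (\<lambda>i. spow (- e i)) = (mat_diag r (\<lambda>i. spow (- f i)) :: 'a ratfun mat)"
      using calculation(2) unfolding mat_diag_def by (intro cong_mat) auto
    ultimately show "reduced m r K f" unfolding reduced_def by simp
  qed
  ultimately show ?thesis
    using minimal_basis_reduced[OF m cs(1)] minimal_basis_reduced[OF m cs(2)] len
    by (intro that[of "basis_mat m (rev cs)" "basis_mat m cs"]) (auto intro: cong)
qed

text \<open>Another basis of the column space is \<open>K T\<close> with \<open>T\<close> polynomial. Normalizing both at infinity
  bounds the degree of \<open>det T\<close>, which is not negative, by the difference of the orders.\<close>

lemma reduced_minimal_basis: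
  fixes K :: "'a::field ratfun mat"
  assumes m: "0 < m" and red: "reduced m r K (\<lambda>i. int (k i))"
  obtains bs where "minimal_basis m (col_image m r K) bs" "map vec_degree bs = map k [0..<r]"
proof -
  let ?D = "sdiag r (\<lambda>i. - int (k i)) :: 'a ratfun mat"
  let ?D' = "sdiag r (\<lambda>i. int (k i)) :: 'a ratfun mat"
  obtain X Z where K: "K \<in> mats polys m r" and X: "X \<in> mats polys r m" "X * K = 1\<^sub>m r"
    and KD: "K * ?D \<in> mats propers m r" and Z: "Z \<in> mats propers r m" "Z * (K * ?D) = 1\<^sub>m r"
    using red unfolding reduced_def by blast
  note Kc = K[THEN mats_carrier] and Xc = X(1)[THEN mats_carrier] and Zc = Z(1)[THEN mats_carrier]
  have "\<forall>i j. \<exists>a. i < m \<and> j < r \<longrightarrow> K $$ (i, j) = to_fract a" using K by (auto simp: mats_def)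
  then obtain a where a: "\<And>i j. i < m \<Longrightarrow> j < r \<Longrightarrow> K $$ (i, j) = to_fract (a i j)" by metis
  define bs where "bs = map (\<lambda>j. vec m (\<lambda>i. a i j)) [0..<r]"
  have len: "length bs = r" and bs: "set bs \<subseteq> carrier_vec m" by (auto simp: bs_def)
  have bm: "basis_mat m bs = K"
    using Kc by (intro eq_matI) (auto simp: basis_mat_index len bs_def a)
  have ZK: "Z * K = ?D'" by (rule left_inverse_unscale[OF Kc Zc Z(2)])
  have KDi: "(K * ?D) $$ (i, j) = K $$ (i, j) * spow (- int (k j))" if "i < m" "j < r" for i j
    using that by (simp add: mat_diag_mult_right[OF Kc])
  have deg: "vec_degree (bs ! j) = k j" if j: "j < r" for j
  proof (rule antisym)
    have bj: "bs ! j \<in> carrier_vec m" and bji: "\<And>i. i < m \<Longrightarrow> bs ! j $ i = a i j"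
      using j by (auto simp: bs_def)
    show "vec_degree (bs ! j) \<le> k j"
    proof (rule vec_degree_le[OF bj m])
      fix i assume i: "i < m"
      show "degree (bs ! j $ i) \<le> k j"
      proof (cases "a i j = 0")
        case False
        have "proper_ratfun (K $$ (i, j) * spow (- int (k j)))" using KD i j KDi by (auto simp: mats_def)
        then have "rdeg (K $$ (i, j) * spow (- int (k j))) \<le> 0"
          using False a[OF i j] spow_nonzero unfolding proper_iff_rdeg by (metis mult_eq_0_iff to_fract_eq_0_iff)
        then show ?thesis using False a[OF i j] bji[OF i] rdeg_mult[of "K $$ (i, j)" "spow (- int (k j))"]
          by (simp add: rdeg_to_fract rdeg_spow)
      qed (simp add: bji[OF i])
    qed
    show "k j \<le> vec_degree (bs ! j)"
    proof (rule ccontr)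
      assume "\<not> k j \<le> vec_degree (bs ! j)"
      then have lt: "vec_degree (bs ! j) < k j" by simp
      have "(\<Sum>i<m. Z $$ (j, i) * (K $$ (i, j) * spow (- int (k j)))) = 0 \<or>
        rdeg (\<Sum>i<m. Z $$ (j, i) * (K $$ (i, j) * spow (- int (k j)))) \<le> - 1"
      proof (rule rdeg_sum_le)
        fix i assume "i \<in> {..<m}"
        then have i: "i < m" by simp
        have 1: "K $$ (i, j) * spow (- int (k j)) = 0 \<or> rdeg (K $$ (i, j) * spow (- int (k j))) \<le> - 1"
          using basis_mat_entry_degree[OF bs i, of j] j len lt unfolding bm
          by (intro rdeg_mult_le[of _ "int (vec_degree (bs ! j))" _ "- int (k j)"]) (auto simp: rdeg_spow)
        have 2: "Z $$ (j, i) = 0 \<or> rdeg (Z $$ (j, i)) \<le> 0"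
          using Z(1) i j by (auto simp: mats_def proper_iff_rdeg)
        show "Z $$ (j, i) * (K $$ (i, j) * spow (- int (k j))) = 0 \<or>
            rdeg (Z $$ (j, i) * (K $$ (i, j) * spow (- int (k j)))) \<le> - 1"
          by (rule rdeg_mult_le[OF 2 1]) simp
      qed
      moreover have "(\<Sum>i<m. Z $$ (j, i) * (K $$ (i, j) * spow (- int (k j)))) = (Z * (K * ?D)) $$ (j, j)"
        using j Zc by (simp add: mat_diag_mult_right[OF Kc] scalar_prod_def atLeast0LessThan)
      ultimately show False unfolding Z(2) using j by simp
    qed
  qed
  have inj: "u = 0\<^sub>v r" if u: "u \<in> carrier_vec r" "K *\<^sub>v u = 0\<^sub>v m" for u
  proof -
    have "u = X * K *\<^sub>v u" using u(1) X(2) by simp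
    also have "\<dots> = X *\<^sub>v (K *\<^sub>v u)" using Xc Kc u(1) by (intro assoc_mult_mat_vec) auto
    also have "\<dots> = 0\<^sub>v r" unfolding u(2) using Xc by auto
    finally show ?thesis .
  qed
  have pb: "polynomial_basis m (col_image m r K) bs"
    unfolding polynomial_basis_iff len bm using bs inj by blast
  have "basis_order bs \<le> basis_order cs" if cs: "polynomial_basis m (col_image m r K) cs" for cs
  proof -
    let ?C = "basis_mat m cs"
    have csc: "set cs \<subseteq> carrier_vec m" using cs by (simp add: polynomial_basis_def)
    have lc: "length cs = r"
      using polynomial_basis_length[OF cs Kc refl] polynomial_basis_length[OF pb Kc refl] len by simp
    have Cc: "?C \<in> carrier_mat m r" using basis_mat_carrier(1)[of m cs] lc by simp
    have Cp: "?C \<in> mats polys m r" using Cc lc by (auto simp: mats_def basis_mat_index)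
    have Cimg: "col_image m r ?C = col_image m r K"
      and Cinj: "\<And>u. u \<in> carrier_vec r \<Longrightarrow> ?C *\<^sub>v u = 0\<^sub>v m \<Longrightarrow> u = 0\<^sub>v r"
      using cs unfolding polynomial_basis_iff lc by blast+
    define T where "T = X * ?C"
    have Tp: "T \<in> mats polys r r" unfolding T_def by (rule polys.mult_mats[OF X(1) Cp])
    note Tc = Tp[THEN mats_carrier]
    have "?C *\<^sub>v u = K * T *\<^sub>v u" if u: "u \<in> carrier_vec r" for u
    proof -
      have "?C *\<^sub>v u \<in> col_image m r ?C" using u Cc by (auto simp: col_image_def)
      then obtain z where z: "z \<in> carrier_vec r" "K *\<^sub>v z = ?C *\<^sub>v u"
        unfolding Cimg by (auto simp: col_image_def)
      have "T *\<^sub>v u = X *\<^sub>v (K *\<^sub>v z)" unfolding T_def z(2) using Xc Cc u by (intro assoc_mult_mat_vec) auto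
      also have "\<dots> = X * K *\<^sub>v z" using Xc Kc z by (intro assoc_mult_mat_vec[symmetric]) auto
      also have "\<dots> = z" unfolding X(2) using z by simp
      finally show ?thesis using z Kc Tc u by simp
    qed
    then have CKT: "?C = K * T"
    proof -
      assume *: "\<And>u. u \<in> carrier_vec r \<Longrightarrow> ?C *\<^sub>v u = K * T *\<^sub>v u"
      have KTc: "K * T \<in> carrier_mat m r" using Kc Tc by simp
      show ?thesis
      proof (rule mat_col_eqI)
        fix i assume "i < dim_col (K * T)"
        then have i: "i < r" using carrier_matD(2)[OF KTc] by (simp only:)
        show "col ?C i = col (K * T) i"
          using *[of "unit_vec r i"] mult_unit_vec[OF Cc i] mult_unit_vec[OF KTc i] by simp
      qed (simp_all only: carrier_matD[OF KTc] carrier_matD[OF Cc])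
    qed
    have "det T \<noteq> 0"
    proof
      assume "det T = 0"
      then obtain u where u: "u \<in> carrier_vec r" "u \<noteq> 0\<^sub>v r" "T *\<^sub>v u = 0\<^sub>v r"
        using det_0_iff_vec_prod_zero_field[OF Tc] by blast
      have "?C *\<^sub>v u = K *\<^sub>v (T *\<^sub>v u)" unfolding CKT using Kc Tc u(1) by (intro assoc_mult_mat_vec) auto
      also have "\<dots> = 0\<^sub>v m" unfolding u(3) using Kc by auto
      finally show False using Cinj[OF u(1)] u(2) by blast
    qed
    let ?E = "sdiag r (\<lambda>i. - int (vec_degree (cs ! i))) :: 'a ratfun mat"
    have "?C * ?E \<in> mats propers m r" using basis_mat_proper[OF csc] unfolding lc .
    then have "Z * (?C * ?E) \<in> mats propers r r" by (rule propers.mult_mats[OF Z(1)])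
    moreover have "Z * (?C * ?E) = ?D' * (T * ?E)"
      unfolding CKT ZK[symmetric] using Zc Kc Tc
      by (simp add: assoc_mult_mat[of _ m r _ r _ r] assoc_mult_mat[of _ r m _ r _ r])
    ultimately have "det (?D' * (T * ?E)) \<in> propers" by (metis propers.det_mem)
    also have "det (?D' * (T * ?E)) = det ?D' * (det T * det ?E)"
      using Tc by (simp add: det_mult[of _ r])
    finally have pr: "det ?D' * (det T * det ?E) \<in> propers" .
    have "det ?D' = spow (\<Sum>i<r. int (k i))" "det ?E = spow (\<Sum>i<r. - int (vec_degree (cs ! i)))"
      by (simp_all only: det_mat_diag spow_prod)
    then have "rdeg (det ?D' * (det T * det ?E)) =
        (\<Sum>i<r. int (k i)) + (rdeg (det T) + (\<Sum>i<r. - int (vec_degree (cs ! i))))"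
      and "det ?D' * (det T * det ?E) \<noteq> 0"
      using \<open>det T \<noteq> 0\<close> by (simp_all only: rdeg_mult rdeg_spow spow_nonzero mult_eq_0_iff simp_thms not_False_eq_True)
    moreover have "rdeg (det T) \<ge> 0" using polys_rdeg_nonneg[OF polys.det_mem[OF Tp] \<open>det T \<noteq> 0\<close>] .
    ultimately have "(\<Sum>i<r. int (k i)) \<le> (\<Sum>i<r. int (vec_degree (cs ! i)))"
      using pr by (simp add: proper_iff_rdeg sum_negf)
    moreover have "basis_order bs = (\<Sum>i<r. k i)"
      unfolding basis_order_def sum_list_sum_nth using deg len by (simp add: atLeast0LessThan)
    moreover have "basis_order cs = (\<Sum>i<r. vec_degree (cs ! i))"
      unfolding basis_order_def sum_list_sum_nth using lc by (simp add: atLeast0LessThan)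
    ultimately show ?thesis by (simp flip: of_nat_sum)
  qed
  then have "minimal_basis m (col_image m r K) bs" unfolding minimal_basis_def using pb by blast
  moreover have "map vec_degree bs = map k [0..<r]" using deg len by (intro nth_equalityI) auto
  ultimately show ?thesis by (rule that)
qed

lemma reduced_has_minimal_indices:
  fixes K :: "'a::field ratfun mat"
  assumes m: "0 < m" and red: "reduced m r K (\<lambda>i. int (k i))"
    and ks: "is_partition ks" "mset ks = mset (map k [0..<r])"
  shows "has_minimal_indices m (col_image m r K) ks"
proof -
  obtain bs where bs: "minimal_basis m (col_image m r K) bs" "map vec_degree bs = map k [0..<r]"
    using reduced_minimal_basis[OF m red] by blast
  have "sort (map vec_degree bs) = rev ks"
    using ks bs(2) by (intro properties_for_sort) (auto simp: is_partition_def sorted_wrt_rev)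
  then show ?thesis unfolding has_minimal_indices_def using bs(1) by (metis rev_rev_ident)
qed

section \<open>Minors\<close>

text \<open>Rows and columns are selected by functions instead of sets. Repetitions give 0, and no sign
  conventions or orderings of index sets are needed.\<close>

definition minor :: "'b::comm_ring_1 mat \<Rightarrow> nat \<Rightarrow> (nat \<Rightarrow> nat) \<Rightarrow> (nat \<Rightarrow> nat) \<Rightarrow> 'b" where
  "minor A t f g = det (mat t t (\<lambda>(i, j). A $$ (f i, g j)))"

lemma det_mat_expand:
  fixes A :: "nat \<Rightarrow> nat \<Rightarrow> 'b::comm_ring_1"
  shows "det (mat t t (\<lambda>(i, j). A i j)) = (\<Sum>p | p permutes {0..<t}. signof p * (\<Prod>i=0..<t. A i (p i)))"
  by (subst det_def'[of _ t]) (auto simp: permutes_in_image intro!: sum.cong prod.cong)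

lemma det_row_combinations:
  fixes P E :: "nat \<Rightarrow> nat \<Rightarrow> 'b::comm_ring_1"
  assumes "finite H"
  shows "det (mat t t (\<lambda>(i, j). \<Sum>h\<in>H. P i h * E h j)) =
    (\<Sum>\<phi>\<in>{0..<t} \<rightarrow>\<^sub>E H. (\<Prod>i=0..<t. P i (\<phi> i)) * det (mat t t (\<lambda>(i, j). E (\<phi> i) j)))"
proof -
  have "det (mat t t (\<lambda>(i, j). \<Sum>h\<in>H. P i h * E h j)) =
    (\<Sum>p | p permutes {0..<t}. signof p * (\<Prod>i=0..<t. \<Sum>h\<in>H. P i h * E h (p i)))"
    by (rule det_mat_expand)
  also have "\<dots> = (\<Sum>p | p permutes {0..<t}. \<Sum>\<phi>\<in>{0..<t} \<rightarrow>\<^sub>E H.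
      (\<Prod>i=0..<t. P i (\<phi> i)) * (signof p * (\<Prod>i=0..<t. E (\<phi> i) (p i))))"
    using assms
    by (intro sum.cong refl, subst prod_sum_PiE) (auto simp: sum_distrib_left prod.distrib mult_ac)
  also have "\<dots> = (\<Sum>\<phi>\<in>{0..<t} \<rightarrow>\<^sub>E H. (\<Prod>i=0..<t. P i (\<phi> i)) *
      (\<Sum>p | p permutes {0..<t}. signof p * (\<Prod>i=0..<t. E (\<phi> i) (p i))))"
    by (subst sum.swap) (simp add: sum_distrib_left)
  also have "\<dots> = (\<Sum>\<phi>\<in>{0..<t} \<rightarrow>\<^sub>E H. (\<Prod>i=0..<t. P i (\<phi> i)) * det (mat t t (\<lambda>(i, j). E (\<phi> i) j)))"
    by (simp only: det_mat_expand)
  finally show ?thesis .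
qed

lemma minor_transpose:
  fixes A :: "'b::comm_ring_1 mat"
  assumes A: "A \<in> carrier_mat m n" and f: "\<And>i. i < t \<Longrightarrow> f i < m" and g: "\<And>i. i < t \<Longrightarrow> g i < n"
  shows "minor (transpose_mat A) t g f = minor A t f g"
proof -
  have "mat t t (\<lambda>(i, j). transpose_mat A $$ (g i, f j)) = transpose_mat (mat t t (\<lambda>(i, j). A $$ (f i, g j)))"
    using assms by (intro eq_matI) auto
  then show ?thesis unfolding minor_def by (simp add: det_transpose[of _ t])
qed

context coeff_ring
begin

text \<open>By multilinearity, multiples \<open>c S\<close> that contain all minors of a matrix also contain those of its
  products with matrices over \<open>S\<close>.\<close>

lemma multiples_zero: "0 \<in> (*) c ` S"
  by (rule image_eqI[of _ _ 0]) simp_all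

lemma multiples_add: "x \<in> (*) c ` S \<Longrightarrow> y \<in> (*) c ` S \<Longrightarrow> x + y \<in> (*) c ` S"
  by (auto simp: distrib_left[symmetric] intro!: imageI add_mem)

lemma multiples_mult: "a \<in> S \<Longrightarrow> x \<in> (*) c ` S \<Longrightarrow> a * x \<in> (*) c ` S"
  by (auto simp: mult.left_commute[of a] intro!: imageI mult_mem)

lemma multiples_sum: "(\<And>i. i \<in> A \<Longrightarrow> h i \<in> (*) c ` S) \<Longrightarrow> sum h A \<in> (*) c ` S"
  by (induction A rule: infinite_finite_induct) (auto intro: multiples_zero multiples_add)

lemma minor_mult_left:
  assumes P: "P \<in> mats S a m" and E: "E \<in> carrier_mat m n"
    and N: "\<And>h. (\<And>i. i < t \<Longrightarrow> h i < m) \<Longrightarrow> minor E t h g \<in> (*) c ` S"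
    and f: "\<And>i. i < t \<Longrightarrow> f i < a" and g: "\<And>i. i < t \<Longrightarrow> g i < n"
  shows "minor (P * E) t f g \<in> (*) c ` S"
proof -
  have Pc: "P \<in> carrier_mat a m" using P by (rule mats_carrier)
  have "mat t t (\<lambda>(i, j). (P * E) $$ (f i, g j)) =
    mat t t (\<lambda>(i, j). \<Sum>h\<in>{..<m}. P $$ (f i, h) * E $$ (h, g j))"
    using Pc E f g by (intro cong_mat) (auto simp: scalar_prod_def atLeast0LessThan intro!: sum.cong)
  then have "minor (P * E) t f g = (\<Sum>\<phi>\<in>{0..<t} \<rightarrow>\<^sub>E {..<m}. (\<Prod>i=0..<t. P $$ (f i, \<phi> i)) * minor E t \<phi> g)"
    unfolding minor_def by (simp only: det_row_combinations[OF finite_lessThan, where E = "\<lambda>h j. E $$ (h, g j)" and P = "\<lambda>i h. P $$ (f i, h)"])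
  also have "\<dots> \<in> (*) c ` S"
  proof (rule multiples_sum)
    fix \<phi> assume "\<phi> \<in> {0..<t} \<rightarrow>\<^sub>E {..<m}"
    then have \<phi>: "\<phi> i < m" if "i < t" for i using that by (auto simp: PiE_iff)
    show "(\<Prod>i=0..<t. P $$ (f i, \<phi> i)) * minor E t \<phi> g \<in> (*) c ` S"
      using P f \<phi> by (intro multiples_mult N prod_mem) (auto simp: mats_def)
  qed
  finally show ?thesis .
qed

lemma minor_mult_both:
  assumes P: "P \<in> mats S a m" and E: "E \<in> carrier_mat m n" and Q: "Q \<in> mats S n b"
    and N: "\<And>h h'. (\<And>i. i < t \<Longrightarrow> h i < m) \<Longrightarrow> (\<And>i. i < t \<Longrightarrow> h' i < n) \<Longrightarrow> minor E t h h' \<in> (*) c ` S"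
    and f: "\<And>i. i < t \<Longrightarrow> f i < a" and g: "\<And>i. i < t \<Longrightarrow> g i < b"
  shows "minor (P * E * Q) t f g \<in> (*) c ` S"
proof -
  have Pc: "P \<in> carrier_mat a m" and Qc: "Q \<in> carrier_mat n b" using P Q by (auto intro: mats_carrier)
  have PE: "P * E \<in> carrier_mat a n" using Pc E by simp
  have "minor (transpose_mat Q * transpose_mat (P * E)) t g f \<in> (*) c ` S"
  proof (rule minor_mult_left[OF mats_transpose[OF Q]])
    show "transpose_mat (P * E) \<in> carrier_mat n a" using PE by simp
    show "minor (transpose_mat (P * E)) t h f \<in> (*) c ` S" if h: "\<And>i. i < t \<Longrightarrow> h i < n" for h
    proof -
      have "minor (P * E) t f h \<in> (*) c ` S"
        by (rule minor_mult_left[OF P E]) (use N f h in auto)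
      then show ?thesis using minor_transpose[OF PE, of t f h] f h by simp
    qed
  qed (use f g in auto)
  then have "minor (transpose_mat (P * E * Q)) t g f \<in> (*) c ` S"
    using transpose_mult[OF PE Qc] by simp
  then show ?thesis using minor_transpose[of "P * E * Q" a b t f g] PE Qc f g by simp
qed

text \<open>The elements of \<open>I\<close>, in increasing order, are at least \<open>0, 1, \<dots>\<close>, and later members of the chain
  are multiples of earlier ones.\<close>

lemma chain_prod:
  assumes chain: "\<And>i j. i \<le> j \<Longrightarrow> j < r \<Longrightarrow> d j \<in> (*) (d i) ` S"
  shows "I \<subseteq> {..<r} \<Longrightarrow> (\<Prod>i\<in>I. d i) \<in> (*) (\<Prod>i<card I. d i) ` S"
proof (induction "card I" arbitrary: I)
  case 0
  then have "I = {}" using finite_subset[of I "{..<r}"] by simp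
  then show ?case by simp
next
  case (Suc c)
  then have fin: "finite I" and ne: "I \<noteq> {}" using finite_subset[of I "{..<r}"] by auto
  define M where "M = Max I"
  have M: "M \<in> I" unfolding M_def using fin ne by simp
  have "I \<subseteq> {..M}" unfolding M_def using fin by auto
  then have "card I \<le> card {..M}" by (intro card_mono) auto
  then have cM: "c \<le> M" "M < r" using Suc(2) M Suc.prems by auto
  have c: "c = card (I - {M})" using Suc(2) M fin by simp
  obtain x where x: "x \<in> S" "(\<Prod>i\<in>I - {M}. d i) = (\<Prod>i<c. d i) * x"
    using Suc(1)[OF c] Suc.prems c by auto
  obtain y where y: "y \<in> S" "d M = d c * y" using chain[OF cM] by auto
  have "(\<Prod>i\<in>I. d i) = d M * (\<Prod>i\<in>I - {M}. d i)" using fin M by (rule prod.remove)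
  also have "\<dots> = (\<Prod>i<card I. d i) * (x * y)"
    unfolding x(2) y(2) Suc(2)[symmetric] by (simp add: mult_ac)
  finally show ?case using x(1) y(1) by (auto intro!: imageI mult_mem)
qed

text \<open>With repeated rows the minor is 0; otherwise each term of its expansion is 0 or, up to sign, a product
  of distinct diagonal entries.\<close>

lemma minor_padded_diag:
  assumes chain: "\<And>i j. i \<le> j \<Longrightarrow> j < length d \<Longrightarrow> d ! j \<in> (*) (d ! i) ` S"
    and f: "\<And>i. i < t \<Longrightarrow> f i < m" and g: "\<And>i. i < t \<Longrightarrow> g i < n"
  shows "minor (padded_diag_mat m n d) t f g \<in> (*) (\<Prod>i<t. d ! i) ` S"
proof (cases "inj_on f {..<t}")
  case False
  then obtain i j where ij: "i < t" "j < t" "i \<noteq> j" "f i = f j" by (auto simp: inj_on_def)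
  have "minor (padded_diag_mat m n d) t f g = 0"
    unfolding minor_def by (rule det_identical_rows[of _ t i j]) (use ij in \<open>auto intro!: eq_vecI\<close>)
  then show ?thesis using multiples_zero by simp
next
  case inj: True
  have "signof p * (\<Prod>i=0..<t. padded_diag_mat m n d $$ (f i, g (p i))) \<in> (*) (\<Prod>i<t. d ! i) ` S"
    if p: "p permutes {0..<t}" for p
  proof (cases "\<forall>i<t. f i = g (p i) \<and> f i < length d")
    case True
    have "(\<Prod>i=0..<t. padded_diag_mat m n d $$ (f i, g (p i))) = (\<Prod>i<t. d ! f i)"
      using True f g p permutes_in_image[OF p]
      by (intro prod.cong) (auto simp: padded_diag_mat_def atLeast0LessThan)
    also have "\<dots> = (\<Prod>x\<in>f ` {..<t}. d ! x)" by (rule prod.reindex[OF inj, unfolded comp_def, symmetric])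
    also have "\<dots> \<in> (*) (\<Prod>i<card (f ` {..<t}). d ! i) ` S"
      using True by (intro chain_prod[of "length d"] chain) auto
    also have "card (f ` {..<t}) = t" using card_image[OF inj] by simp
    finally show ?thesis by (intro multiples_mult signof_mem)
  next
    case False
    then obtain i where i: "i < t" "\<not> (f i = g (p i) \<and> f i < length d)" by blast
    then have "padded_diag_mat m n d $$ (f i, g (p i)) = 0"
      using f g permutes_in_image[OF p, of i] by (auto simp: padded_diag_mat_def)
    then have "(\<Prod>i=0..<t. padded_diag_mat m n d $$ (f i, g (p i))) = 0"
      using i by (intro prod_zero) (auto intro!: bexI[of _ i])
    then show ?thesis using multiples_zero by (simp only: mult_zero_right)
  qed
  then show ?thesis unfolding minor_def det_mat_expand by (intro multiples_sum) auto
qed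

end

section \<open>Nonzero minors of large weight\<close>

text \<open>The second factor is the minor of the Schur complement of the pivot.\<close>

lemma minor_pivot:
  fixes E :: "'b::field mat"
  assumes e: "E $$ (p, 0) \<noteq> 0"
  shows "minor E (Suc t) (case_nat p f) (case_nat 0 g) =
    E $$ (p, 0) * det (mat t t (\<lambda>(i, j). E $$ (f i, g j) - E $$ (f i, 0) / E $$ (p, 0) * E $$ (p, g j)))"
proof -
  let ?one = "1\<^sub>m 1 :: 'b mat"
  let ?c = "mat t 1 (\<lambda>(i, j). E $$ (f i, 0) / E $$ (p, 0))"
  let ?e = "mat 1 1 (\<lambda>_. E $$ (p, 0))"
  let ?w = "mat 1 t (\<lambda>(i, j). E $$ (p, g j))"
  let ?S = "mat t t (\<lambda>(i, j). E $$ (f i, g j) - E $$ (f i, 0) / E $$ (p, 0) * E $$ (p, g j))"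
  have "mat (Suc t) (Suc t) (\<lambda>(i, j). E $$ (case_nat p f i, case_nat 0 g j)) =
    four_block_mat ?one (0\<^sub>m 1 t) ?c (1\<^sub>m t) * four_block_mat ?e ?w (0\<^sub>m t 1) ?S"
    using e by (subst mult_four_block_mat[of _ 1 1 _ t _ t _ _ 1 _ t])
      (auto intro!: eq_matI simp: scalar_prod_def split: nat.split)
  moreover have "det (four_block_mat ?one (0\<^sub>m 1 t) ?c (1\<^sub>m t)) = 1"
    by (subst det_four_block_mat_upper_right_zero[of _ 1 _ t]) auto
  moreover have "det (four_block_mat ?e ?w (0\<^sub>m t 1) ?S) = E $$ (p, 0) * det ?S"
    by (subst det_four_block_mat_lower_left_zero[of _ 1 _ t]) (auto simp: det_single)
  ultimately show ?thesis unfolding minor_def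
    by (subst \<open>mat (Suc t) (Suc t) _ = _\<close>, subst det_mult[of _ "Suc t"]) auto
qed

text \<open>As the weights increase, an element of \<open>A\<close> up to \<open>p\<close> weighs at most as much as the predecessor of the
  next element of \<open>A\<close>, and the last one at most as much as \<open>p\<close>.\<close>

lemma weight_shift:
  fixes \<kappa> :: "nat \<Rightarrow> int"
  assumes mono: "\<And>i j. i \<le> j \<Longrightarrow> j \<le> r \<Longrightarrow> \<kappa> i \<le> \<kappa> j"
  shows "finite A \<Longrightarrow> A \<noteq> {} \<Longrightarrow> Min A \<le> p \<Longrightarrow> p \<le> r \<Longrightarrow>
    (\<Sum>j\<in>A. \<kappa> j) \<le> \<kappa> p + (\<Sum>j\<in>A - {Min A}. \<kappa> (if j \<le> p then j - 1 else j))"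
proof (induction A arbitrary: p rule: finite_linorder_max_induct)
  case empty
  then show ?case by simp
next
  case (insert M A)
  show ?case
  proof (cases "A = {}")
    case True
    then show ?thesis using insert mono[of M p] by simp
  next
    case False
    have Mn: "M \<notin> A" using insert by auto
    have "Min A < M" using insert False by simp
    then have min: "Min (insert M A) = Min A" using insert False by simp
    have minne: "Min A \<noteq> M" using \<open>Min A < M\<close> by simp
    have split: "(\<Sum>j\<in>insert M A - {Min A}. h j) = h M + (\<Sum>j\<in>A - {Min A}. h j)" for h :: "nat \<Rightarrow> int"
    proof -
      have "insert M A - {Min A} = insert M (A - {Min A})" using minne by auto
      then show ?thesis using insert(1) Mn by simp
    qed
    show ?thesis
    proof (cases "M \<le> p")
      case False
      then show ?thesis using insert.IH[of p] insert.prems insert(1) Mn \<open>A \<noteq> {}\<close> unfolding min split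
        by simp
    next
      case True
      have le: "j \<le> M - 1" if "j \<in> A" for j using insert(2) that by fastforce
      have "(\<Sum>j\<in>A. \<kappa> j) \<le> \<kappa> (M - 1) + (\<Sum>j\<in>A - {Min A}. \<kappa> (if j \<le> M - 1 then j - 1 else j))"
        using insert.IH[of "M - 1"] False \<open>Min A < M\<close> True insert.prems by simp
      also have "(\<Sum>j\<in>A - {Min A}. \<kappa> (if j \<le> M - 1 then j - 1 else j)) =
          (\<Sum>j\<in>A - {Min A}. \<kappa> (if j \<le> p then j - 1 else j))"
      proof (rule sum.cong[OF refl])
        fix j assume "j \<in> A - {Min A}"
        then have "j \<le> M - 1" using le by simp
        moreover from this have "j \<le> p" using True by linarith
        ultimately show "\<kappa> (if j \<le> M - 1 then j - 1 else j) = \<kappa> (if j \<le> p then j - 1 else j)"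
          by simp
      qed
      finally have "(\<Sum>j\<in>A. \<kappa> j) \<le> \<kappa> (M - 1) + (\<Sum>j\<in>A - {Min A}. \<kappa> (if j \<le> p then j - 1 else j))" .
      moreover have "\<kappa> M \<le> \<kappa> p" using mono[of M p] True insert.prems by simp
      ultimately show ?thesis unfolding min split using insert(1) Mn True by simp
    qed
  qed
qed

text \<open>A kernel vector of the Schur complement, extended by the entry that the pivot row determines, is a
  kernel vector of \<open>E\<close>.\<close>

lemma pivot_complement_nonsingular:
  fixes E :: "'b::field mat"
  assumes E: "E \<in> carrier_mat (Suc r) (Suc r)" and det: "det E \<noteq> 0"
    and p: "p \<le> r" "E $$ (p, 0) \<noteq> 0"
  defines "sk \<equiv> \<lambda>a. if a < p then a else Suc a"
  shows "det (mat r r (\<lambda>(a, b). E $$ (sk a, Suc b) - E $$ (sk a, 0) / E $$ (p, 0) * E $$ (p, Suc b))) \<noteq> 0"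
    (is "det ?E' \<noteq> 0")
proof
  assume "det ?E' = 0"
  then obtain v where v: "v \<in> carrier_vec r" "v \<noteq> 0\<^sub>v r" "?E' *\<^sub>v v = 0\<^sub>v r"
    using det_0_iff_vec_prod_zero_field[of ?E' r] by auto
  define s where "s = (\<Sum>b<r. E $$ (p, Suc b) * v $ b)"
  define w where "w = vec (Suc r) (case_nat (- s / E $$ (p, 0)) (\<lambda>b. v $ b))"
  have w: "w \<in> carrier_vec (Suc r)" by (simp add: w_def)
  have Ew: "(E *\<^sub>v w) $ i = E $$ (i, 0) * (- s / E $$ (p, 0)) + (\<Sum>b<r. E $$ (i, Suc b) * v $ b)"
    if "i < Suc r" for i
    unfolding mult_mat_vec_index[OF E w that] sum.lessThan_Suc_shift by (simp add: w_def)
  have "(E *\<^sub>v w) $ i = 0" if i: "i < Suc r" for i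
  proof (cases "i = p")
    case True
    then show ?thesis using Ew[OF i] p by (simp add: s_def)
  next
    case False
    define a where "a = (if i < p then i else i - 1)"
    have a: "a < r" "sk a = i" using False i p by (auto simp: a_def sk_def)
    have "(\<Sum>b<r. (E $$ (i, Suc b) - E $$ (i, 0) / E $$ (p, 0) * E $$ (p, Suc b)) * v $ b) = (?E' *\<^sub>v v) $ a"
      using a by (subst mult_mat_vec_index[OF _ v(1)]) auto
    also have "\<dots> = 0" unfolding v(3) using a by simp
    finally have "(\<Sum>b<r. E $$ (i, Suc b) * v $ b) = E $$ (i, 0) / E $$ (p, 0) * s"
      unfolding s_def sum_distrib_left by (simp add: left_diff_distrib sum_subtractf mult.assoc)
    then show ?thesis using Ew[OF i] by simp
  qed
  then have "E *\<^sub>v w = 0\<^sub>v (Suc r)" using E by (intro eq_vecI) auto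
  then have w0: "w = 0\<^sub>v (Suc r)" using det w det_0_iff_vec_prod_zero_field[OF E] by blast
  have "v $ b = 0" if "b < r" for b
  proof -
    have "w $ Suc b = 0" unfolding w0 using that by simp
    then show ?thesis using that by (simp add: w_def)
  qed
  then show False using v by (metis eq_vecI carrier_vecD index_zero_vec)
qed

text \<open>Gaussian elimination in the first column, with the last nonzero entry as pivot, so that rows
  are only changed by multiples of a row of at least the same weight. If \<open>S\<close> meets the rows up to
  the pivot, the pivot is put into the minor: \<open>weight_shift\<close> shows that re-pairing the remaining rows
  and columns does not lose weight, as the two weights are ordered oppositely.\<close>

lemma nonzero_minor_of_large_weight:
  fixes E :: "'b::field mat" and \<kappa> l :: "nat \<Rightarrow> int"
  assumes "E \<in> carrier_mat r r" "det E \<noteq> 0"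
    and "\<And>i j. i \<le> j \<Longrightarrow> j < r \<Longrightarrow> \<kappa> i \<le> \<kappa> j"
    and "\<And>i j. i \<le> j \<Longrightarrow> j < r \<Longrightarrow> l j \<le> l i"
    and "S \<subseteq> {..<r}"
  shows "\<exists>f g. (\<forall>a < card S. f a < r \<and> g a < r) \<and> minor E (card S) f g \<noteq> 0 \<and>
    (\<Sum>j\<in>S. \<kappa> j + l j) \<le> (\<Sum>a<card S. \<kappa> (f a) + l (g a))"
  using assms
proof (induction r arbitrary: E \<kappa> l S)
  case 0
  then show ?case by (simp add: minor_def)
next
  case (Suc r)
  show ?case
  proof (cases "S = {}")
    case True
    then show ?thesis by (simp add: minor_def)
  next
    case ne: False
    have fin: "finite S" using Suc.prems(5) finite_subset by blast
    define R where "R = {i. i \<le> r \<and> E $$ (i, 0) \<noteq> 0}"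
    have "R \<noteq> {}"
    proof
      assume R: "R = {}"
      have "E *\<^sub>v unit_vec (Suc r) 0 = 0\<^sub>v (Suc r)"
        using mult_unit_vec[OF Suc.prems(1), of 0] R Suc.prems(1) by (auto simp: R_def intro!: eq_vecI)
      then have "unit_vec (Suc r) 0 = (0\<^sub>v (Suc r) :: 'b vec)"
        using Suc.prems(2) det_0_iff_vec_prod_zero_field[OF Suc.prems(1)] unit_vec_carrier by blast
      then show False by (metis index_unit_vec(1) index_zero_vec(1) zero_less_Suc zero_neq_one)
    qed
    define p where "p = Max R"
    have "finite R" unfolding R_def by simp
    then have "p \<in> R" "\<And>i. i \<in> R \<Longrightarrow> i \<le> p" unfolding p_def using \<open>R \<noteq> {}\<close> by auto
    then have p: "p \<le> r" "E $$ (p, 0) \<noteq> 0" and pmax: "\<And>i. p < i \<Longrightarrow> i \<le> r \<Longrightarrow> E $$ (i, 0) = 0"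
      unfolding R_def by (auto simp: not_less[symmetric])
    define sk where "sk = (\<lambda>a. if a < p then a else Suc a)"
    define E' where "E' = mat r r (\<lambda>(a, b). E $$ (sk a, Suc b) - E $$ (sk a, 0) / E $$ (p, 0) * E $$ (p, Suc b))"
    have E': "E' \<in> carrier_mat r r" by (simp add: E'_def)
    have detE': "det E' \<noteq> 0"
      using pivot_complement_nonsingular[OF Suc.prems(1,2) p] unfolding E'_def sk_def .
    have sk: "sk a < Suc r" if "a < r" for a using that by (auto simp: sk_def)
    define \<kappa>' where "\<kappa>' a = \<kappa> (sk a)" for a
    define l' where "l' b = l (Suc b)" for b
    have mono': "\<kappa>' i \<le> \<kappa>' j" if "i \<le> j" "j < r" for i j
      unfolding \<kappa>'_def using that by (intro Suc.prems(3)) (auto simp: sk_def)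
    have anti': "l' j \<le> l' i" if "i \<le> j" "j < r" for i j
      unfolding l'_def using that by (intro Suc.prems(4)) auto
    have \<kappa>'1: "\<kappa>' (j - 1) = \<kappa> (if j \<le> p then j - 1 else j)" if "j > 0" for j
      using that by (auto simp: \<kappa>'_def sk_def)
    have shift: "(\<Sum>j\<in>(\<lambda>j. j - 1) ` T. \<kappa>' j + l' j) = (\<Sum>j\<in>T. \<kappa> (if j \<le> p then j - 1 else j)) + (\<Sum>j\<in>T. l j)"
      and shiftc: "card ((\<lambda>j. j - 1) ` T) = card T"
      and shifts: "(\<lambda>j. j - 1) ` T \<subseteq> {..<r}"
      if T: "T \<subseteq> S" "\<And>j. j \<in> T \<Longrightarrow> j > 0" for T
    proof -
      have inj: "inj_on (\<lambda>j::nat. j - 1) T" using T(2) by (auto intro!: inj_onI) (metis Suc_pred)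
      show "card ((\<lambda>j. j - 1) ` T) = card T" by (rule card_image[OF inj])
      show "(\<lambda>j. j - 1) ` T \<subseteq> {..<r}" using T Suc.prems(5) by fastforce
      have "(\<Sum>j\<in>(\<lambda>j. j - 1) ` T. \<kappa>' j + l' j) = (\<Sum>j\<in>T. \<kappa> (if j \<le> p then j - 1 else j) + l j)"
        unfolding sum.reindex[OF inj] comp_def using T(2) by (intro sum.cong) (auto simp: \<kappa>'1[unfolded One_nat_def] l'_def)
      then show "(\<Sum>j\<in>(\<lambda>j. j - 1) ` T. \<kappa>' j + l' j) =
          (\<Sum>j\<in>T. \<kappa> (if j \<le> p then j - 1 else j)) + (\<Sum>j\<in>T. l j)" by (simp add: sum.distrib)
    qed
    show ?thesis
    proof (cases "Min S \<le> p")
      case True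
      let ?T = "S - {Min S}"
      have Tpos: "j > 0" if "j \<in> ?T" for j
        using Min_le[OF fin, of j] that by (cases j) auto
      note T = shift[of ?T] shiftc[of ?T] shifts[of ?T]
      let ?S' = "(\<lambda>j. j - 1) ` ?T"
      have cS: "card S = Suc (card ?S')"
        using T(2) Tpos fin ne Min_in[OF fin ne] card_Suc_Diff1[OF fin] by auto
      obtain f g where fg: "\<forall>a < card ?S'. f a < r \<and> g a < r" "minor E' (card ?S') f g \<noteq> 0"
        "(\<Sum>j\<in>?S'. \<kappa>' j + l' j) \<le> (\<Sum>a<card ?S'. \<kappa>' (f a) + l' (g a))"
        using Suc.IH[where E = E' and \<kappa> = \<kappa>' and l = l' and S = ?S', OF E' detE' mono' anti'] T(3) Tpos by auto
      let ?F = "case_nat p (\<lambda>a. sk (f a))" and ?G = "case_nat 0 (\<lambda>a. Suc (g a))"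
      have "minor E' (card ?S') f g = det (mat (card ?S') (card ?S') (\<lambda>(i, j).
          E $$ (sk (f i), Suc (g j)) - E $$ (sk (f i), 0) / E $$ (p, 0) * E $$ (p, Suc (g j))))"
        unfolding minor_def E'_def using fg(1) by (intro arg_cong[of _ _ det] cong_mat) auto
      then have "minor E (card S) ?F ?G \<noteq> 0"
        unfolding cS minor_pivot[where p = p and E = E, OF p(2)] using fg(2) p(2) by simp
      moreover have "?F a < Suc r \<and> ?G a < Suc r" if "a < card S" for a
        using that fg(1) p sk unfolding cS by (auto split: nat.split)
      moreover have "(\<Sum>j\<in>S. \<kappa> j + l j) \<le> (\<Sum>a<card S. \<kappa> (?F a) + l (?G a))"
      proof -
        have "(\<Sum>j\<in>S. l j) = l (Min S) + (\<Sum>j\<in>?T. l j)"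
          using fin Min_in[OF fin ne] by (rule sum.remove)
        moreover have "l (Min S) \<le> l 0" using Suc.prems(4)[of 0 "Min S"] True p by simp
        moreover have "(\<Sum>j\<in>S. \<kappa> j) \<le> \<kappa> p + (\<Sum>j\<in>?T. \<kappa> (if j \<le> p then j - 1 else j))"
          by (rule weight_shift[of r]) (use Suc.prems(3) fin ne True p in auto)
        moreover have "(\<Sum>a<card S. \<kappa> (?F a) + l (?G a)) =
            \<kappa> p + l 0 + (\<Sum>a<card ?S'. \<kappa>' (f a) + l' (g a))"
          unfolding cS sum.lessThan_Suc_shift by (simp add: \<kappa>'_def l'_def)
        ultimately show ?thesis using fg(3) T(1) Tpos by (simp add: sum.distrib)
      qed
      ultimately show ?thesis by blast
    next
      case False
      have big: "p < j" if "j \<in> S" for j using Min_le[OF fin that] False by simp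
      then have pos: "j > 0" if "j \<in> S" for j using that by force
      note T = shift[of S] shiftc[of S] shifts[of S]
      let ?S' = "(\<lambda>j. j - 1) ` S"
      have cS: "card ?S' = card S" using T(2) pos by simp
      obtain f g where fg: "\<forall>a < card S. f a < r \<and> g a < r" "minor E' (card S) f g \<noteq> 0"
        "(\<Sum>j\<in>?S'. \<kappa>' j + l' j) \<le> (\<Sum>a<card S. \<kappa>' (f a) + l' (g a))"
        using Suc.IH[where E = E' and \<kappa> = \<kappa>' and l = l' and S = ?S', OF E' detE' mono' anti'] T(3) pos unfolding cS by auto
      let ?t = "card S"
      \<comment> \<open>Row \<open>i\<close> of the minor of \<open>E'\<close> is a combination of row \<open>sk (f i)\<close> and the pivot row of \<open>E\<close>.\<close>
      define P where "P i h = (if h = sk (f i) then 1 else 0) - (if h = p then E $$ (sk (f i), 0) / E $$ (p, 0) else 0)" for i h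
      have "mat ?t ?t (\<lambda>(i, j). E' $$ (f i, g j)) = mat ?t ?t (\<lambda>(i, j). \<Sum>h\<in>{..<Suc r}. P i h * E $$ (h, Suc (g j)))"
      proof (rule cong_mat[OF refl refl])
        fix i j assume ij: "i < ?t" "j < ?t"
        have "(\<Sum>h\<in>{..<Suc r}. P i h * E $$ (h, Suc (g j))) =
          (\<Sum>h\<in>{..<Suc r}. if h = sk (f i) then E $$ (h, Suc (g j)) else 0) -
          (\<Sum>h\<in>{..<Suc r}. if h = p then E $$ (sk (f i), 0) / E $$ (p, 0) * E $$ (h, Suc (g j)) else 0)"
          unfolding sum_subtractf[symmetric] P_def by (intro sum.cong) auto
        also have "\<dots> = E $$ (sk (f i), Suc (g j)) - E $$ (sk (f i), 0) / E $$ (p, 0) * E $$ (p, Suc (g j))"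
          using sk[of "f i"] fg(1) ij p by (simp del: sum.lessThan_Suc)
        finally show "(case (i, j) of (i, j) \<Rightarrow> E' $$ (f i, g j)) =
            (case (i, j) of (i, j) \<Rightarrow> \<Sum>h\<in>{..<Suc r}. P i h * E $$ (h, Suc (g j)))"
          using fg(1) ij by (simp add: E'_def)
      qed
      then have "minor E' ?t f g = (\<Sum>\<phi>\<in>{0..<?t} \<rightarrow>\<^sub>E {..<Suc r}. (\<Prod>i=0..<?t. P i (\<phi> i)) * minor E ?t \<phi> (\<lambda>j. Suc (g j)))"
        unfolding minor_def by (simp only: det_row_combinations[OF finite_lessThan, where E = "\<lambda>h j. E $$ (h, Suc (g j))"])
      then obtain \<phi> where \<phi>: "\<phi> \<in> {0..<?t} \<rightarrow>\<^sub>E {..<Suc r}"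
        "(\<Prod>i=0..<?t. P i (\<phi> i)) * minor E ?t \<phi> (\<lambda>j. Suc (g j)) \<noteq> 0"
        using fg(2) by (metis (no_types, lifting) sum.neutral)
      have "\<kappa>' (f a) \<le> \<kappa> (\<phi> a)" if a: "a < ?t" for a
      proof -
        have "P a (\<phi> a) \<noteq> 0" using \<phi>(2) a by (auto simp: prod_zero_iff)
        then consider "\<phi> a = sk (f a)" | "\<phi> a = p" "E $$ (sk (f a), 0) \<noteq> 0"
          unfolding P_def by (auto split: if_splits)
        then show ?thesis
        proof cases
          case 1
          then show ?thesis by (simp add: \<kappa>'_def)
        next
          case 2
          then have "sk (f a) \<le> p" using pmax[of "sk (f a)"] sk[of "f a"] fg(1) a by force
          then show ?thesis unfolding \<kappa>'_def 2 using Suc.prems(3) p by simp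
        qed
      qed
      then have "(\<Sum>a<?t. \<kappa>' (f a) + l' (g a)) \<le> (\<Sum>a<?t. \<kappa> (\<phi> a) + l (Suc (g a)))"
        by (intro sum_mono) (auto simp: l'_def)
      moreover have "(\<Sum>j\<in>?S'. \<kappa>' j + l' j) = (\<Sum>j\<in>S. \<kappa> j + l j)"
      proof -
        have "(\<Sum>j\<in>S. \<kappa> (if j \<le> p then j - 1 else j)) = (\<Sum>j\<in>S. \<kappa> j)"
          using big by (intro sum.cong) force+
        then show ?thesis using T(1) pos by (simp add: sum.distrib)
      qed
      ultimately have "(\<Sum>j\<in>S. \<kappa> j + l j) \<le> (\<Sum>a<?t. \<kappa> (\<phi> a) + l (Suc (g a)))" using fg(3) by simp
      moreover have "\<forall>a < ?t. \<phi> a < Suc r \<and> Suc (g a) < Suc r"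
        using \<phi>(1) fg(1) by (auto simp: PiE_iff)
      moreover have "minor E ?t \<phi> (\<lambda>j. Suc (g j)) \<noteq> 0" using \<phi>(2) by auto
      ultimately show ?thesis by (intro exI[of _ \<phi>] exI[of _ "\<lambda>j. Suc (g j)"] conjI)
    qed
  qed
qed

section \<open>Majorization\<close>

lemma sum_le_initial_sum:
  fixes g :: "nat \<Rightarrow> 'c::linordered_idom"
  assumes anti: "\<And>i j. i \<le> j \<Longrightarrow> j < r \<Longrightarrow> g j \<le> g i"
  shows "I \<subseteq> {..<r} \<Longrightarrow> (\<Sum>i\<in>I. g i) \<le> (\<Sum>i<card I. g i)"
proof (induction "card I" arbitrary: I)
  case 0
  then have "I = {}" using finite_subset[of I "{..<r}"] by simp
  then show ?case by simp
next
  case (Suc c)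
  then have fin: "finite I" and ne: "I \<noteq> {}" using finite_subset[of I "{..<r}"] by auto
  define M where "M = Max I"
  have M: "M \<in> I" unfolding M_def using fin ne by simp
  have "I \<subseteq> {..M}" unfolding M_def using fin by auto
  then have "card I \<le> card {..M}" by (intro card_mono) auto
  then have cM: "c \<le> M" "M < r" using Suc(2) M Suc.prems by auto
  have c: "c = card (I - {M})" using Suc(2) M fin by simp
  have "(\<Sum>i\<in>I. g i) = g M + (\<Sum>i\<in>I - {M}. g i)" using fin M by (rule sum.remove)
  also have "\<dots> \<le> g c + (\<Sum>i<c. g i)"
    using Suc(1)[OF c] Suc.prems anti[OF cM] c by (intro add_mono) auto
  also have "\<dots> = (\<Sum>i<card I. g i)" using Suc(2)[symmetric] by simp
  finally show ?case .
qed

lemma sum_list_take_rev: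
  fixes f :: "nat \<Rightarrow> int"
  assumes "j \<le> r"
  shows "sum_list (take j (map f (rev [0..<r]))) = (\<Sum>i<r. f i) - (\<Sum>i<r - j. f i)"
proof -
  have "take j (map f (rev [0..<r])) = rev (map f [r - j..<r])"
    by (simp add: rev_map[symmetric] take_rev drop_map take_map)
  then have "sum_list (take j (map f (rev [0..<r]))) = (\<Sum>i\<in>{r - j..<r}. f i)"
    by (simp add: sum_list_rev interv_sum_list_conv_sum_set_nat)
  moreover have "(\<Sum>i<r. f i) = (\<Sum>i<r - j. f i) + (\<Sum>i\<in>{r - j..<r}. f i)"
    using sum.atLeastLessThan_concat[of 0 "r - j" r f] by (simp add: atLeast0LessThan)
  ultimately show ?thesis by simp
qed

text \<open>Since the sums are equal, comparing sums of final segments amounts to comparing sums of initial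
  segments in the opposite direction. The initial sums of the sorted list are the maximal sums over
  index sets of the given size, which makes the condition independent of the order of the \<open>h\<^sub>j\<close>.\<close>

lemma majorized_by_iff:
  fixes a h :: "nat \<Rightarrow> int" and g :: "nat list"
  assumes g: "is_partition g" "length g = r"
    and h: "mset (map int g) = mset (map h [0..<r])"
  shows "majorized_by (map (\<lambda>i. - int (g ! i)) (rev [0..<r])) (map a (rev [0..<r])) \<longleftrightarrow>
    (\<forall>S \<subseteq> {..<r}. (\<Sum>i<card S. a i) \<le> - (\<Sum>j\<in>S. h j)) \<and> (\<Sum>i<r. a i) = - (\<Sum>j<r. h j)"
    (is "?maj \<longleftrightarrow> ?sub \<and> ?tot")
proof -
  obtain \<sigma> where \<sigma>: "\<sigma> permutes {..<r}" "permute_list \<sigma> (map h [0..<r]) = map int g"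
    using mset_eq_permutation[OF h] by auto
  have gh: "int (g ! i) = h (\<sigma> i)" if "i < r" for i
    using arg_cong[OF \<sigma>(2), of "\<lambda>l. l ! i"] that g permutes_in_image[OF \<sigma>(1), of i] \<sigma>(1)
    by (simp add: permute_list_nth)
  have tot: "(\<Sum>i<r. h i) = (\<Sum>i<r. int (g ! i))"
    using sum.permute[OF \<sigma>(1), of h] gh by (simp add: comp_def)
  have anti: "int (g ! j) \<le> int (g ! i)" if "i \<le> j" "j < r" for i j
    using g that unfolding is_partition_def by (cases "i = j") (auto simp: sorted_wrt_iff_nth_less)
  have A: "sum_list (map (\<lambda>i. - int (g ! i)) (rev [0..<r])) = - (\<Sum>i<r. int (g ! i))"
    "sum_list (map a (rev [0..<r])) = (\<Sum>i<r. a i)"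
    using sum_list_take_rev[of r r "\<lambda>i. - int (g ! i)"] sum_list_take_rev[of r r a] by (simp_all add: sum_negf)
  have maj: "?maj \<longleftrightarrow> (\<forall>t\<in>{1..<r}. (\<Sum>i<t. a i) \<le> - (\<Sum>i<t. int (g ! i))) \<and> ?tot" (is "_ \<longleftrightarrow> ?B \<and> _")
  proof (cases "?tot")
    case True
    have *: "sum_list (take j (map (\<lambda>i. - int (g ! i)) (rev [0..<r]))) \<le> sum_list (take j (map a (rev [0..<r])))
      \<longleftrightarrow> (\<Sum>i<r - j. a i) \<le> - (\<Sum>i<r - j. int (g ! i))" if "j \<in> {1..<r}" for j
      using that True tot by (subst (1 2) sum_list_take_rev) (auto simp: sum_negf)
    have "?maj \<longleftrightarrow> (\<forall>j\<in>{1..<r}. (\<Sum>i<r - j. a i) \<le> - (\<Sum>i<r - j. int (g ! i)))"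
      unfolding majorized_by_def A using True tot * by simp
    also have "\<dots> \<longleftrightarrow> ?B"
    proof
      assume *: "\<forall>j\<in>{1..<r}. (\<Sum>i<r - j. a i) \<le> - (\<Sum>i<r - j. int (g ! i))"
      show ?B
      proof
        fix t assume "t \<in> {1..<r}"
        then have "r - t \<in> {1..<r}" "r - (r - t) = t" by auto
        then show "(\<Sum>i<t. a i) \<le> - (\<Sum>i<t. int (g ! i))" using * by metis
      qed
    next
      assume ?B
      moreover have "r - j \<in> {1..<r}" if "j \<in> {1..<r}" for j using that by auto
      ultimately show "\<forall>j\<in>{1..<r}. (\<Sum>i<r - j. a i) \<le> - (\<Sum>i<r - j. int (g ! i))" by blast
    qed
    finally show ?thesis using True by simp
  next
    case False
    then show ?thesis unfolding majorized_by_def A using tot by auto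
  qed
  have "?B \<longleftrightarrow> ?sub" if ?tot
  proof
    assume B: ?B
    show ?sub
    proof (intro allI impI)
      fix S assume S: "S \<subseteq> {..<r}"
      have inj: "inj_on (Hilbert_Choice.inv \<sigma>) S" using permutes_inj[OF permutes_inv[OF \<sigma>(1)]] by (rule inj_on_subset) simp
      have img: "Hilbert_Choice.inv \<sigma> ` S \<subseteq> {..<r}" using S permutes_in_image[OF permutes_inv[OF \<sigma>(1)]] by blast
      have cS: "card S \<le> r" using S by (metis card_lessThan card_mono finite_lessThan)
      have "(\<Sum>j\<in>S. h j) = (\<Sum>i\<in>Hilbert_Choice.inv \<sigma> ` S. int (g ! i))"
        unfolding sum.reindex[OF inj] comp_def
      proof (rule sum.cong[OF refl])
        fix j assume "j \<in> S"
        then have "Hilbert_Choice.inv \<sigma> j < r" using img by auto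
        then show "h j = int (g ! Hilbert_Choice.inv \<sigma> j)" using gh permutes_inverses(1)[OF \<sigma>(1)] by metis
      qed
      also have "\<dots> \<le> (\<Sum>i<card S. int (g ! i))"
        using sum_le_initial_sum[of r "\<lambda>i. int (g ! i)", OF anti img] card_image[OF inj] by simp
      finally have 1: "(\<Sum>j\<in>S. h j) \<le> (\<Sum>i<card S. int (g ! i))" .
      have "(\<Sum>i<card S. a i) \<le> - (\<Sum>i<card S. int (g ! i))"
      proof (cases "card S = 0 \<or> card S = r")
        case True
        then show ?thesis using that tot by auto
      next
        case False
        then show ?thesis using B cS by simp
      qed
      then show "(\<Sum>i<card S. a i) \<le> - (\<Sum>j\<in>S. h j)" using 1 by simp
    qed
  next
    assume sub: ?sub
    show ?B
    proof
      fix t assume t: "t \<in> {1..<r}"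
      have inj: "inj_on \<sigma> {..<t}" using permutes_inj[OF \<sigma>(1)] by (rule inj_on_subset) simp
      have "\<sigma> i < r" if "i < t" for i using permutes_in_image[OF \<sigma>(1), of i] that t by simp
      then have "\<sigma> ` {..<t} \<subseteq> {..<r}" by blast
      then have "(\<Sum>i<card (\<sigma> ` {..<t}). a i) \<le> - (\<Sum>j\<in>\<sigma> ` {..<t}. h j)" using sub by blast
      then show "(\<Sum>i<t. a i) \<le> - (\<Sum>i<t. int (g ! i))"
        unfolding sum.reindex[OF inj] card_image[OF inj] comp_def using t gh by simp
    qed
  qed
  then show ?thesis using maj by blast
qed

lemma majorization_condition_iff:
  assumes "length k = r" "length l = r"
  shows "majorization_condition r eps psi q (reordered_sums k l) \<longleftrightarrow>
    (\<forall>S \<subseteq> {..<r}. (\<Sum>i<card S. int (degree (eps ! i)) - int (degree (psi ! i)) + q ! i)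
        \<le> - (\<Sum>j\<in>S. int (rev k ! j) + int (l ! j))) \<and>
    (\<Sum>i<r. int (degree (eps ! i)) - int (degree (psi ! i)) + q ! i) = - (\<Sum>j<r. int (rev k ! j) + int (l ! j))"
  unfolding majorization_condition_def
proof (rule majorized_by_iff)
  show "is_partition (reordered_sums k l)"
    unfolding is_partition_def reordered_sums_def sorted_wrt_rev by simp
  show "length (reordered_sums k l) = r" using assms by (simp add: reordered_sums_def)
  have "map2 (+) (rev k) l = map (\<lambda>j. rev k ! j + l ! j) [0..<r]"
    using assms by (intro nth_equalityI) auto
  then have "mset (reordered_sums k l) = mset (map (\<lambda>j. rev k ! j + l ! j) [0..<r])"
    unfolding reordered_sums_def by simp
  then have "image_mset int (mset (reordered_sums k l)) = image_mset int (mset (map (\<lambda>j. rev k ! j + l ! j) [0..<r]))"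
    by simp
  then show "mset (map int (reordered_sums k l)) = mset (map (\<lambda>j. int (rev k ! j) + int (l ! j)) [0..<r])"
    by (simp add: multiset.map_comp comp_def)
qed

section \<open>Necessity\<close>

lemma col_image_subset_factor:
  fixes K :: "'b::field mat"
  assumes K: "K \<in> carrier_mat m r" and R: "R \<in> carrier_mat m n" and sub: "col_image m n R \<subseteq> col_image m r K"
  obtains A where "A \<in> carrier_mat r n" "R = K * A"
proof -
  have "\<exists>u. u \<in> carrier_vec r \<and> K *\<^sub>v u = col R j" if j: "j < n" for j
  proof -
    have "col R j \<in> col_image m n R"
      unfolding col_image_def using mult_unit_vec[OF R j] R by (auto intro!: bexI[of _ "unit_vec n j"])
    then show ?thesis using sub unfolding col_image_def by auto
  qed
  then obtain u where u: "\<And>j. j < n \<Longrightarrow> u j \<in> carrier_vec r" "\<And>j. j < n \<Longrightarrow> K *\<^sub>v u j = col R j" by metis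
  define A where "A = mat r n (\<lambda>(i, j). u j $ i)"
  have A: "A \<in> carrier_mat r n" by (simp add: A_def)
  have "R = K * A"
  proof (rule eq_matI)
    fix i j assume ij: "i < dim_row (K * A)" "j < dim_col (K * A)"
    then have i: "i < m" and j: "j < n" using K A by auto
    have "col A j = u j" using j u(1)[OF j] by (intro eq_vecI) (auto simp: A_def)
    then have "(K * A) $$ (i, j) = (K *\<^sub>v u j) $ i" using i j K A by simp
    then show "R $$ (i, j) = (K * A) $$ (i, j)" using u(2)[OF j] i j R by simp
  qed (use K A R in auto)
  then show ?thesis using that A by blast
qed

lemma col_image_mult:
  fixes K :: "'b::field mat"
  assumes "K \<in> carrier_mat m r" "A \<in> carrier_mat r n"
  shows "col_image m n (K * A) \<subseteq> col_image m r K"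
proof
  fix y assume "y \<in> col_image m n (K * A)"
  then obtain u where u: "u \<in> carrier_vec n" "K * A *\<^sub>v u = y" "y \<in> carrier_vec m" by (auto simp: col_image_def)
  then have "K *\<^sub>v (A *\<^sub>v u) = y" using assms by (simp add: assoc_mult_mat_vec[of _ m r _ n])
  then show "y \<in> col_image m r K"
    using u assms mult_mat_vec_carrier[OF assms(2) u(1)] unfolding col_image_def by blast
qed

lemma col_space_col_image:
  fixes R :: "'a::field ratfun mat"
  assumes "R \<in> carrier_mat m n"
  shows "vec_space.col_space m R = col_image m n R"
  using vec_space.col_space_eq[OF assms] assms by (simp add: col_image_def)

lemma assoc_mult_five:
  fixes A :: "'b::field mat"
  assumes "A \<in> carrier_mat m r" "B \<in> carrier_mat r r" "M \<in> carrier_mat r r" "C \<in> carrier_mat r r" "L \<in> carrier_mat r n"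
  shows "A * B * M * (C * L) = A * (B * (M * C)) * L"
  using assms by (simp add: assoc_mult_mat[of _ m r _ r _ r] assoc_mult_mat[of _ m r _ r _ n]
    assoc_mult_mat[of _ r r _ r _ r] assoc_mult_mat[of _ r r _ r _ n])

lemma det_sdiag_mult:
  fixes E :: "'a::field ratfun mat"
  assumes E: "E \<in> carrier_mat t t"
  shows "det (sdiag t e * E * sdiag t f) = spow (\<Sum>i<t. e i) * spow (\<Sum>i<t. f i) * det E"
  unfolding det_mult[OF mult_carrier_mat[OF mat_diag_dim E] mat_diag_dim] det_mult[OF mat_diag_dim E]
    det_mat_diag spow_prod by (simp only: mult_ac)

lemma scaled_factorization:
  fixes K :: "'a::field ratfun mat"
  assumes K: "K \<in> carrier_mat m r" and E: "E \<in> carrier_mat r r" and L: "L \<in> carrier_mat n r"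
  shows "K * E * transpose_mat L = K * sdiag r (\<lambda>i. - \<kappa> i) * (sdiag r \<kappa> * E * sdiag r \<mu>) *
    transpose_mat (L * sdiag r (\<lambda>i. - \<mu> i))"
proof -
  let ?Dk = "sdiag r (\<lambda>i. - \<kappa> i) :: 'a ratfun mat" and ?Dl = "sdiag r (\<lambda>i. - \<mu> i) :: 'a ratfun mat"
  let ?Dk' = "sdiag r \<kappa> :: 'a ratfun mat" and ?Dl' = "sdiag r \<mu> :: 'a ratfun mat"
  define M where "M = ?Dk' * E * ?Dl'"
  have M: "M \<in> carrier_mat r r" unfolding M_def by (rule mult_carrier_mat[OF mult_carrier_mat[OF mat_diag_dim E] mat_diag_dim])
  have "M * ?Dl = ?Dk' * E * (?Dl' * ?Dl)"
    unfolding M_def by (rule assoc_mult_mat[OF mult_carrier_mat[OF mat_diag_dim E] mat_diag_dim mat_diag_dim])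
  then have "?Dk * (M * ?Dl) = ?Dk * (?Dk' * E)"
    unfolding sdiag_inverse right_mult_one_mat[OF mult_carrier_mat[OF mat_diag_dim E]] by simp
  also have "\<dots> = ?Dk * ?Dk' * E" by (rule assoc_mult_mat[OF mat_diag_dim mat_diag_dim E, symmetric])
  finally have "?Dk * (M * ?Dl) = E" unfolding sdiag_inverse using E by simp
  moreover have "K * ?Dk * M * (?Dl * transpose_mat L) = K * (?Dk * (M * ?Dl)) * transpose_mat L"
    by (rule assoc_mult_five[OF K mat_diag_dim M mat_diag_dim]) (use L in simp)
  moreover have "transpose_mat (L * ?Dl) = ?Dl * transpose_mat L"
    using transpose_mult[OF L mat_diag_dim] by simp
  ultimately show ?thesis unfolding M_def[symmetric] by simp
qed

text \<open>\<open>K X\<close> acts as the identity on the column space of \<open>R\<close>, and \<open>L U\<close> on that of the transpose. Writing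
  \<open>K\<close> as \<open>R C\<close> shows that the middle factor has a right inverse.\<close>

lemma full_rank_factorization:
  fixes R :: "'b::field mat"
  assumes R: "R \<in> carrier_mat m n" and K: "K \<in> carrier_mat m r" and L: "L \<in> carrier_mat n r"
    and X: "X \<in> carrier_mat r m" "X * K = 1\<^sub>m r" and U: "U \<in> carrier_mat r n" "U * L = 1\<^sub>m r"
    and RK: "col_image m n R = col_image m r K" and RL: "col_image n m (transpose_mat R) = col_image n r L"
  shows "R = K * (X * R * transpose_mat U) * transpose_mat L"
    and "det (X * R * transpose_mat U) \<noteq> 0"
proof -
  have proj: "B * (Y * M) = M" if prem: "M \<in> carrier_mat a b" "B \<in> carrier_mat a r" "Y \<in> carrier_mat r a" "Y * B = 1\<^sub>m r"
    "col_image a b M \<subseteq> col_image a r B" for a b and M B Y :: "'b mat"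
  proof -
    obtain A where A: "A \<in> carrier_mat r b" "M = B * A"
      using col_image_subset_factor[OF prem(2) prem(1) prem(5)] by blast
    have "Y * M = Y * B * A" unfolding A(2) using prem A(1) by (intro assoc_mult_mat[symmetric]) auto
    then have "Y * M = A" using prem(4) A(1) by simp
    then show ?thesis using A(2) by simp
  qed
  have 1: "K * (X * R) = R" using proj[OF R K X(1,2)] RK by simp
  have "L * (U * transpose_mat R) = transpose_mat R" using proj[OF _ L U(1,2)] R RL by simp
  then have "transpose_mat (L * (U * transpose_mat R)) = R" by simp
  moreover have "transpose_mat (L * (U * transpose_mat R)) = transpose_mat (U * transpose_mat R) * transpose_mat L"
    using L U R by (intro transpose_mult) auto
  moreover have "transpose_mat (U * transpose_mat R) = R * transpose_mat U"
    using U R by (subst transpose_mult[of _ r n]) auto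
  ultimately have 2: "R * transpose_mat U * transpose_mat L = R" by simp
  let ?E = "X * R * transpose_mat U"
  have E: "?E \<in> carrier_mat r r" using X U R by auto
  have "K * ?E * transpose_mat L = K * (X * R) * transpose_mat U * transpose_mat L"
    using K X R U L by (simp add: assoc_mult_mat[of _ m r _ n _ r] assoc_mult_mat[of _ r m _ n _ r]
        assoc_mult_mat[of _ m r _ m _ r] assoc_mult_mat[of _ m r _ r _ n] assoc_mult_mat[of _ m m _ r _ n])
  then show RE: "R = K * ?E * transpose_mat L" unfolding 1 2 by simp
  obtain C where C: "C \<in> carrier_mat n r" "K = R * C"
    using col_image_subset_factor[OF R K] RK by blast
  have "?E * (transpose_mat L * C) = X * (K * ?E * transpose_mat L * C)"
  proof -
    have "X * (K * ?E * transpose_mat L * C) = X * K * (?E * (transpose_mat L * C))"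
      using X(1) K E L C(1) by (simp add: assoc_mult_mat[of _ r m _ r _ r] assoc_mult_mat[of _ m r _ r _ r]
          assoc_mult_mat[of _ m r _ r _ n] assoc_mult_mat[of _ m r _ n _ r])
    then show ?thesis unfolding X(2) using X(1) E L C(1) by simp
  qed
  also have "\<dots> = 1\<^sub>m r" unfolding RE[symmetric] C(2)[symmetric] by (rule X(2))
  finally have "det (?E * (transpose_mat L * C)) = 1" by simp
  then show "det ?E \<noteq> 0" using E L C(1) by (subst (asm) det_mult[of _ r]) auto
qed

lemma unimodular_inv_over:
  fixes U :: "'a::field poly mat"
  assumes "U \<in> carrier_mat n n" "unimodular U"
  shows "\<exists>P'. inv_over polys n (map_mat to_fract U) P'"
proof -
  obtain B where B: "inverts_mat U B" "inverts_mat B U"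
    using assms(2) unfolding unimodular_def invertible_mat_def by blast
  have Bc: "B \<in> carrier_mat n n"
    using B assms(1) unfolding inverts_mat_def
    by (metis carrier_matD(2) carrier_matI index_mult_mat(2,3) index_one_mat(2,3) carrier_matD(1))
  have "U * B = 1\<^sub>m n" using B assms(1) unfolding inverts_mat_def by simp
  interpret h: comm_ring_hom "to_fract :: 'a poly \<Rightarrow> 'a ratfun"
    by unfold_locales simp_all
  have "map_mat to_fract U * map_mat to_fract B = (1\<^sub>m n :: 'a ratfun mat)"
    using h.mat_hom_mult[OF assms(1) Bc] h.mat_hom_one \<open>U * B = 1\<^sub>m n\<close> by metis
  moreover have "map_mat to_fract U \<in> mats polys n n" "map_mat to_fract B \<in> mats polys n n"
    using assms(1) Bc by (auto simp: mats_def)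
  ultimately show ?thesis using inv_overI by blast
qed

lemma biproper_inv_over:
  fixes B :: "'a::field ratfun mat"
  assumes "B \<in> carrier_mat n n" "biproper B"
  shows "\<exists>B'. inv_over propers n B B'"
proof -
  obtain C where C: "inverts_mat B C" "inverts_mat C B" "proper_mat C" and B: "proper_mat B"
    using assms(2) unfolding biproper_def by blast
  have Cc: "C \<in> carrier_mat n n"
    using C assms(1) unfolding inverts_mat_def
    by (metis carrier_matD(2) carrier_matI index_mult_mat(2,3) index_one_mat(2,3) carrier_matD(1))
  have "B * C = 1\<^sub>m n" using C assms(1) unfolding inverts_mat_def by simp
  moreover have "B \<in> mats propers n n" "C \<in> mats propers n n"
    using assms(1) Cc B C(3) by (auto simp: mats_def proper_mat_def)
  ultimately show ?thesis using inv_overI by blast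
qed

context coeff_ring
begin

lemma padded_diag_factor:
  assumes P: "inv_over S m P P'" and Q: "inv_over S n Q Q'" and R: "R \<in> carrier_mat m n"
    and D: "P * R * Q = D"
  shows "R = P' * D * Q'"
proof -
  note c = inv_over_carrier[OF P] inv_over_carrier[OF Q]
  have "P' * (P * R * Q) * Q' = P' * (P * R) * (Q * Q')"
    using c R
    by (simp add: assoc_mult_mat[of _ m m _ m _ n] assoc_mult_mat[of _ m m _ n _ n] assoc_mult_mat[of _ m n _ n _ n])
  also have "P' * (P * R) = P' * P * R" using c R by (intro assoc_mult_mat[symmetric]) auto
  finally have "P' * D * Q' = P' * P * R * (Q * Q')" unfolding D .
  moreover have "P' * P = 1\<^sub>m m" "Q * Q' = 1\<^sub>m n" using P Q by (simp_all add: inv_over_def)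
  ultimately show ?thesis using R by simp
qed

text \<open>The rows and columns of \<open>X R Y\<close> are combinations over \<open>S\<close> of those of the diagonal form.\<close>

lemma minor_of_product:
  assumes P: "inv_over S m P P'" and Q: "inv_over S n Q Q'" and R: "R \<in> carrier_mat m n"
    and D: "P * R * Q = padded_diag_mat m n d"
    and chain: "\<And>i j. i \<le> j \<Longrightarrow> j < length d \<Longrightarrow> d ! j \<in> (*) (d ! i) ` S"
    and X: "X \<in> mats S a m" and Y: "Y \<in> mats S n b"
    and f: "\<And>i. i < t \<Longrightarrow> f i < a" and g: "\<And>i. i < t \<Longrightarrow> g i < b"
  shows "minor (X * R * Y) t f g \<in> (*) (\<Prod>i<t. d ! i) ` S"
proof -
  let ?D = "padded_diag_mat m n d"
  have Dc: "?D \<in> carrier_mat m n" by (simp add: padded_diag_mat_def)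
  note c = inv_over_carrier[OF P] inv_over_carrier[OF Q] X[THEN mats_carrier] Y[THEN mats_carrier]
  have XP: "X * P' \<in> mats S a m" and QY: "Q' * Y \<in> mats S n b"
    using P Q X Y by (auto simp: inv_over_def intro: mult_mats)
  have "X * R * Y = X * P' * ?D * (Q' * Y)"
    unfolding padded_diag_factor[OF P Q R D] using c Dc
    by (simp add: assoc_mult_mat[of _ a m _ m _ n] assoc_mult_mat[of _ m m _ n _ n] assoc_mult_mat[of _ a m _ n _ n]
        assoc_mult_mat[of _ a m _ n _ b] assoc_mult_mat[of _ m m _ n _ b] assoc_mult_mat[of _ m n _ n _ b])
  moreover have "minor (X * P' * ?D * (Q' * Y)) t f g \<in> (*) (\<Prod>i<t. d ! i) ` S"
    by (rule minor_mult_both[OF XP Dc QY minor_padded_diag[OF chain] f g]) auto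
  ultimately show ?thesis by simp
qed

text \<open>The leading square block of the diagonal form is \<open>A E B\<close> with \<open>A\<close> and \<open>B\<close> over \<open>S\<close>.\<close>

lemma det_divides_diag:
  assumes P: "inv_over S m P P'" and Q: "inv_over S n Q Q'"
    and D: "P * (K * E * M) * Q = padded_diag_mat m n d"
    and K: "K \<in> mats S m r" and E: "E \<in> carrier_mat r r" and M: "M \<in> mats S r n"
    and r: "length d = r" "r \<le> m" "r \<le> n"
  shows "(\<Prod>i<r. d ! i) \<in> (*) (det E) ` S"
proof -
  note c = inv_over_carrier[OF P] inv_over_carrier[OF Q] K[THEN mats_carrier] M[THEN mats_carrier]
  have PK: "P * K \<in> mats S m r" and MQ: "M * Q \<in> mats S r n"
    using P Q K M by (auto simp: inv_over_def intro: mult_mats)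
  define G where "G = P * K"
  define H where "H = M * Q"
  define A where "A = mat r r (\<lambda>(i, j). G $$ (i, j))"
  define B where "B = mat r r (\<lambda>(i, j). H $$ (i, j))"
  have A: "A \<in> mats S r r" and B: "B \<in> mats S r r"
    using PK MQ r unfolding G_def[symmetric] H_def[symmetric] by (auto simp: A_def B_def mats_def)
  have GH: "G \<in> carrier_mat m r" "H \<in> carrier_mat r n"
    using PK MQ by (auto simp: G_def H_def intro: mats_carrier)
  note AB = A[THEN mats_carrier] B[THEN mats_carrier]
  have eq: "G * E * H = padded_diag_mat m n d"
    unfolding D[symmetric] G_def H_def using c E
    by (simp add: assoc_mult_mat[of _ m r _ r _ n] assoc_mult_mat[of _ m m _ r _ r] assoc_mult_mat[of _ m m _ r _ n]
        assoc_mult_mat[of _ m m _ n _ n] assoc_mult_mat[of _ m r _ n _ n] assoc_mult_mat[of _ r r _ n _ n])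
  have "mat_diag r (\<lambda>i. d ! i) = A * E * B"
  proof (rule eq_matI)
    fix i j assume "i < dim_row (A * E * B)" "j < dim_col (A * E * B)"
    then have i: "i < r" and j: "j < r" using AB E by auto
    define AE where "AE = A * E"
    define GE where "GE = G * E"
    have AEc: "AE \<in> carrier_mat r r" "GE \<in> carrier_mat m r" using AB E GH by (auto simp: AE_def GE_def)
    have "AE $$ (i, h) = GE $$ (i, h)" if "h < r" for h
      using i that r E GH by (simp add: A_def AE_def GE_def scalar_prod_def)
    then have "(AE * B) $$ (i, j) = (GE * H) $$ (i, j)"
      using i j r AEc GH by (simp add: scalar_prod_def B_def)
    then have "(A * E * B) $$ (i, j) = (G * E * H) $$ (i, j)" by (simp only: AE_def GE_def)
    then show "mat_diag r (\<lambda>i. d ! i) $$ (i, j) = (A * E * B) $$ (i, j)"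
      unfolding eq using i j r by (auto simp: padded_diag_mat_def mat_diag_def)
  qed (use AB E in \<open>auto simp: mat_diag_def\<close>)
  then have "(\<Prod>i<r. d ! i) = det (A * E * B)" by (metis det_mat_diag)
  also have "\<dots> = det E * (det A * det B)" using AB E by (simp add: det_mult[of _ r])
  finally show ?thesis using det_mem[OF A] det_mem[OF B] by (auto intro!: imageI mult_mem)
qed

end

lemma invariant_fraction_data_chain:
  assumes "invariant_fraction_data eps psi" "i \<le> j" "j < length eps"
  shows "eps ! i dvd eps ! j" "psi ! j dvd psi ! i"
proof -
  have "eps ! i dvd eps ! j \<and> psi ! j dvd psi ! i"
    using assms(2,3)
  proof (induction j rule: dec_induct)
    case (step j)
    then show ?case using assms(1) unfolding invariant_fraction_data_def by (meson Suc_lessD dvd_trans)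
  qed simp
  then show "eps ! i dvd eps ! j" "psi ! j dvd psi ! i" by auto
qed

lemma invariant_fraction_data_nonzero:
  assumes "invariant_fraction_data eps psi" "i < length eps"
  shows "eps ! i \<noteq> 0" "psi ! i \<noteq> 0"
proof -
  have "lead_coeff (eps ! i) = 1" "lead_coeff (psi ! i) = 1"
    using assms unfolding invariant_fraction_data_def by blast+
  then show "eps ! i \<noteq> 0" "psi ! i \<noteq> 0" by auto
qed

lemma rdeg_multiples_polys:
  assumes "x \<in> (*) c ` polys" "x \<noteq> 0"
  shows "rdeg c \<le> rdeg x"
proof -
  obtain y where y: "y \<in> polys" "x = c * y" using assms(1) by blast
  then have "c \<noteq> 0" "y \<noteq> 0" using assms(2) by auto
  then show ?thesis using polys_rdeg_nonneg[OF y(1)] y(2) by (simp add: rdeg_mult)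
qed

lemma rdeg_multiples_propers: "x \<in> (*) c ` propers \<Longrightarrow> x \<noteq> 0 \<Longrightarrow> rdeg x \<le> rdeg c"
  by (auto simp: rdeg_mult proper_iff_rdeg)

text \<open>With \<open>R = K E L\<^sup>T\<close>, the finite structure of \<open>R\<close> is that of \<open>E\<close>, and the structure at infinity
  that of \<open>D\<^sub>\<kappa> E D\<^sub>\<mu>\<close>. A minor of \<open>E\<close> is a polynomial multiple of the product of the
  first invariant fractions, so its degree is bounded below; the corresponding minor at infinity bounds
  its degree above. Taking a nonzero minor of large weight gives the inequalities, and the
  determinant of \<open>E\<close> gives the equality.\<close>

lemma structural_inequalities:
  fixes R :: "'a::field ratfun mat"
  assumes R: "R \<in> carrier_mat m n" and r: "r \<le> m" "r \<le> n"
    and K: "reduced m r K \<kappa>" "col_image m n R = col_image m r K"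
    and L: "reduced n r L \<mu>" "col_image n m (transpose_mat R) = col_image n r L"
    and \<kappa>: "\<And>i j. i \<le> j \<Longrightarrow> j < r \<Longrightarrow> \<kappa> i \<le> \<kappa> j"
    and \<mu>: "\<And>i j. i \<le> j \<Longrightarrow> j < r \<Longrightarrow> \<mu> j \<le> \<mu> i"
    and frac: "has_invariant_rational_functions R eps psi" "length eps = r"
    and inf: "has_invariant_orders_at_infinity R q" "length q = r"
  defines "a \<equiv> \<lambda>i. int (degree (eps ! i)) - int (degree (psi ! i)) + q ! i"
  shows "S \<subseteq> {..<r} \<Longrightarrow> (\<Sum>i<card S. a i) \<le> - (\<Sum>j\<in>S. \<kappa> j + \<mu> j)"
    and "(\<Sum>i<r. a i) = - (\<Sum>j<r. \<kappa> j + \<mu> j)"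
proof -
  let ?Dk = "sdiag r (\<lambda>i. - \<kappa> i) :: 'a ratfun mat" and ?Dl = "sdiag r (\<lambda>i. - \<mu> i) :: 'a ratfun mat"
  let ?Dk' = "sdiag r \<kappa> :: 'a ratfun mat" and ?Dl' = "sdiag r \<mu> :: 'a ratfun mat"
  obtain X Z where Kp: "K \<in> mats polys m r" and X: "X \<in> mats polys r m" "X * K = 1\<^sub>m r"
    and KD: "K * ?Dk \<in> mats propers m r" and Z: "Z \<in> mats propers r m" "Z * (K * ?Dk) = 1\<^sub>m r"
    using K(1) unfolding reduced_def by blast
  obtain U W where Lp: "L \<in> mats polys n r" and U: "U \<in> mats polys r n" "U * L = 1\<^sub>m r"
    and LD: "L * ?Dl \<in> mats propers n r" and W: "W \<in> mats propers r n" "W * (L * ?Dl) = 1\<^sub>m r"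
    using L(1) unfolding reduced_def by blast
  note c = Kp[THEN mats_carrier] X(1)[THEN mats_carrier] Z(1)[THEN mats_carrier]
    Lp[THEN mats_carrier] U(1)[THEN mats_carrier] W(1)[THEN mats_carrier]
  define E where "E = X * R * transpose_mat U"
  have E: "E \<in> carrier_mat r r" using c R by (auto simp: E_def)
  have RE: "R = K * E * transpose_mat L" and detE: "det E \<noteq> 0"
    using full_rank_factorization[OF R c(1,4,2) X(2) c(5) U(2) K(2) L(2)] by (simp_all add: E_def)
  have tW: "transpose_mat L * transpose_mat W = ?Dl'"
    using transpose_mult[OF c(6,4)] left_inverse_unscale[OF c(4,6) W(2)] by simp
  have DED: "Z * R * transpose_mat W = ?Dk' * E * ?Dl'"
    unfolding left_inverse_unscale[OF c(1,3) Z(2), symmetric] tW[symmetric]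
    by (subst RE) (use c E in \<open>simp add: assoc_mult_mat[of _ r m _ r _ r] assoc_mult_mat[of _ m r _ r _ n]
      assoc_mult_mat[of _ m r _ r _ r] assoc_mult_mat[of _ r m _ n _ r] assoc_mult_mat[of _ m r _ n _ r] assoc_mult_mat[of _ r r _ n _ r]\<close>)
  have REi: "R = K * ?Dk * (?Dk' * E * ?Dl') * transpose_mat (L * ?Dl)"
    by (subst RE) (rule scaled_factorization[OF c(1) E c(4)])
  obtain U0 V0 where UV: "U0 \<in> carrier_mat m m" "V0 \<in> carrier_mat n n" "unimodular U0" "unimodular V0"
    and fD: "map_mat to_fract U0 * R * map_mat to_fract V0 = padded_diag_mat m n (map2 Fract eps psi)"
    and data: "invariant_fraction_data eps psi"
    using frac(1) R unfolding has_invariant_rational_functions_def by auto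
  obtain P' Q' where P: "inv_over polys m (map_mat to_fract U0) P'" and Q: "inv_over polys n (map_mat to_fract V0) Q'"
    using unimodular_inv_over UV by blast
  obtain B1 B2 where B: "B1 \<in> carrier_mat m m" "B2 \<in> carrier_mat n n" "biproper B1" "biproper B2"
    and iD: "B1 * R * B2 = padded_diag_mat m n (map (\<lambda>e. spow (- e)) q)" and sq: "sorted q"
    using inf(1) R unfolding has_invariant_orders_at_infinity_def spow_def by auto
  obtain B1' B2' where B1: "inv_over propers m B1 B1'" and B2: "inv_over propers n B2 B2'"
    using biproper_inv_over B by blast
  have lpsi: "length psi = r" using data frac(2) by (simp add: invariant_fraction_data_def)
  let ?d = "map2 Fract eps psi" and ?d' = "map (\<lambda>e. spow (- e)) q :: 'a ratfun list"
  have di: "?d ! i = Fract (eps ! i) (psi ! i)" "eps ! i \<noteq> 0" "psi ! i \<noteq> 0" if "i < r" for i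
    using that frac(2) lpsi invariant_fraction_data_nonzero[OF data] by auto
  have chain: "?d ! j \<in> (*) (?d ! i) ` polys" if ij: "i \<le> j" "j < length ?d" for i j
  proof -
    have j: "j < r" "i < r" using ij frac(2) lpsi by auto
    obtain x y where "eps ! j = eps ! i * x" "psi ! i = psi ! j * y"
      using invariant_fraction_data_chain[OF data ij(1)] j frac(2) by (auto elim!: dvdE)
    then have "?d ! j = ?d ! i * to_fract (x * y)"
      using di[OF j(1)] di[OF j(2)] by (simp add: to_fract_def eq_fract mult_ac)
    then show ?thesis by blast
  qed
  have chain': "?d' ! j \<in> (*) (?d' ! i) ` propers" if ij: "i \<le> j" "j < length ?d'" for i j
  proof -
    have "?d' ! j = ?d' ! i * spow (- (q ! j) + q ! i)"
      using ij spow_add[of "- (q ! i)" "- (q ! j) + q ! i"] by simp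
    moreover have "spow (- (q ! j) + q ! i) \<in> propers"
      using sorted_nth_mono[OF sq ij(1)] ij by (simp add: proper_iff_rdeg)
    ultimately show ?thesis by blast
  qed
  have rd: "rdeg (\<Prod>i<t. ?d ! i) = (\<Sum>i<t. int (degree (eps ! i)) - int (degree (psi ! i)))"
    "(\<Prod>i<t. ?d ! i) \<noteq> 0" if "t \<le> r" for t
  proof -
    have nz: "?d ! i \<noteq> 0" if "i < t" for i
      using di[of i] that \<open>t \<le> r\<close> by (simp add: Zero_fract_def eq_fract)
    then show "(\<Prod>i<t. ?d ! i) \<noteq> 0" by simp
    have "rdeg (\<Prod>i<t. ?d ! i) = (\<Sum>i<t. rdeg (?d ! i))" by (rule rdeg_prod) (use nz in auto)
    also have "\<dots> = (\<Sum>i<t. int (degree (eps ! i)) - int (degree (psi ! i)))"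
      using di that by (intro sum.cong) (auto simp: rdeg_Fract)
    finally show "rdeg (\<Prod>i<t. ?d ! i) = (\<Sum>i<t. int (degree (eps ! i)) - int (degree (psi ! i)))" .
  qed
  have rd': "(\<Prod>i<t. ?d' ! i) = spow (- (\<Sum>i<t. q ! i))" if "t \<le> r" for t
  proof -
    have "(\<Prod>i<t. ?d' ! i) = (\<Prod>i<t. spow (- (q ! i)))" using that inf(2) by (intro prod.cong) auto
    then show ?thesis by (simp only: spow_prod sum_negf)
  qed
  have asum: "(\<Sum>i<t. a i) = (\<Sum>i<t. int (degree (eps ! i)) - int (degree (psi ! i))) + (\<Sum>i<t. q ! i)" for t
    unfolding a_def by (rule sum.distrib)
  show le: "(\<Sum>i<card S. a i) \<le> - (\<Sum>j\<in>S. \<kappa> j + \<mu> j)" if S: "S \<subseteq> {..<r}" for S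
  proof -
    let ?t = "card S"
    have t: "?t \<le> r" using S by (metis card_lessThan card_mono finite_lessThan)
    obtain f g where fg: "\<forall>i < ?t. f i < r \<and> g i < r" and nz: "minor E ?t f g \<noteq> 0"
      and w: "(\<Sum>j\<in>S. \<kappa> j + \<mu> j) \<le> (\<Sum>i<?t. \<kappa> (f i) + \<mu> (g i))"
      using nonzero_minor_of_large_weight[where \<kappa> = \<kappa> and l = \<mu>, OF E detE \<kappa> \<mu> S] by blast
    have "minor E ?t f g \<in> (*) (\<Prod>i<?t. ?d ! i) ` polys"
      unfolding E_def by (rule polys.minor_of_product[OF P Q R fD chain X(1) mats_transpose[OF U(1)]]) (use fg in auto)
    then have 1: "(\<Sum>i<?t. int (degree (eps ! i)) - int (degree (psi ! i))) \<le> rdeg (minor E ?t f g)"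
      unfolding rd(1)[OF t, symmetric] by (rule rdeg_multiples_polys[OF _ nz])
    have "minor (?Dk' * E * ?Dl') ?t f g = spow (\<Sum>i<?t. \<kappa> (f i)) * spow (\<Sum>i<?t. \<mu> (g i)) * minor E ?t f g"
    proof -
      let ?M = "mat ?t ?t (\<lambda>(i, j). E $$ (f i, g j))"
      have DE: "?Dk' * E * ?Dl' = mat r r (\<lambda>(i, j). spow (\<kappa> i) * E $$ (i, j) * spow (\<mu> j))"
        using E by (subst mat_diag_mult_right[of _ r]) (auto simp: mat_diag_mult_left[OF E] intro!: eq_matI)
      have "mat ?t ?t (\<lambda>(i, j). (?Dk' * E * ?Dl') $$ (f i, g j)) =
          mat_diag ?t (\<lambda>i. spow (\<kappa> (f i))) * ?M * mat_diag ?t (\<lambda>i. spow (\<mu> (g i)))"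
        unfolding DE using fg
        by (subst mat_diag_mult_right[of _ ?t]) (auto simp: mat_diag_mult_left[of _ ?t ?t] intro!: eq_matI)
      then show ?thesis unfolding minor_def by (simp only: det_sdiag_mult[OF mat_carrier])
    qed
    moreover have "minor (?Dk' * E * ?Dl') ?t f g \<in> (*) (\<Prod>i<?t. ?d' ! i) ` propers"
      unfolding DED[symmetric]
      by (rule propers.minor_of_product[OF B1 B2 R iD chain' Z(1) mats_transpose[OF W(1)]]) (use fg in auto)
    ultimately have "rdeg (spow (\<Sum>i<?t. \<kappa> (f i)) * spow (\<Sum>i<?t. \<mu> (g i)) * minor E ?t f g) \<le> - (\<Sum>i<?t. q ! i)"
      using rdeg_multiples_propers[of "minor (?Dk' * E * ?Dl') ?t f g" "\<Prod>i<?t. ?d' ! i"] nz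
      unfolding rd'[OF t] by simp
    then have 2: "(\<Sum>i<?t. \<kappa> (f i)) + (\<Sum>i<?t. \<mu> (g i)) + rdeg (minor E ?t f g) \<le> - (\<Sum>i<?t. q ! i)"
      using nz by (simp add: rdeg_mult)
    show ?thesis using 1 2 w asum[of ?t] by (simp add: sum.distrib)
  qed
  show "(\<Sum>i<r. a i) = - (\<Sum>j<r. \<kappa> j + \<mu> j)"
  proof (rule antisym)
    show "(\<Sum>i<r. a i) \<le> - (\<Sum>j<r. \<kappa> j + \<mu> j)" using le[of "{..<r}"] by simp
    have "(\<Prod>i<r. ?d ! i) \<in> (*) (det E) ` polys"
      by (rule polys.det_divides_diag[OF P Q _ Kp E mats_transpose[OF Lp]])
        (use fD RE frac(2) lpsi r in auto)
    then have 1: "rdeg (det E) \<le> (\<Sum>i<r. int (degree (eps ! i)) - int (degree (psi ! i)))"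
      unfolding rd(1)[OF order_refl, symmetric] by (rule rdeg_multiples_polys[OF _ rd(2)[OF order_refl]])
    have "(\<Prod>i<r. ?d' ! i) \<in> (*) (det (?Dk' * E * ?Dl')) ` propers"
      by (rule propers.det_divides_diag[OF B1 B2 _ KD
            mult_carrier_mat[OF mult_carrier_mat[OF mat_diag_dim E] mat_diag_dim] mats_transpose[OF LD]])
        (use iD REi inf(2) r in auto)
    then have "spow (- (\<Sum>i<r. q ! i)) \<in> (*) (det (?Dk' * E * ?Dl')) ` propers"
      unfolding rd'[OF order_refl] .
    then have "- (\<Sum>i<r. q ! i) \<le> rdeg (det (?Dk' * E * ?Dl'))"
      using rdeg_multiples_propers[OF _ spow_nonzero] by (metis rdeg_spow)
    also have "det (?Dk' * E * ?Dl') = spow (\<Sum>i<r. \<kappa> i) * spow (\<Sum>i<r. \<mu> i) * det E"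
      by (rule det_sdiag_mult[OF E])
    also have "rdeg \<dots> = (\<Sum>i<r. \<kappa> i) + rdeg (det E) + (\<Sum>i<r. \<mu> i)"
      using detE by (simp add: rdeg_mult)
    finally show "- (\<Sum>j<r. \<kappa> j + \<mu> j) \<le> (\<Sum>i<r. a i)"
      using 1 asum[of r] by (simp add: sum.distrib)
  qed
qed

lemma left_null_space_alt:
  fixes R :: "'b::field mat"
  assumes R: "R \<in> carrier_mat m n"
  shows "left_null_space R = {x \<in> carrier_vec m. transpose_mat R *\<^sub>v x = 0\<^sub>v n}"
proof -
  have "mat_of_row x * R = 0\<^sub>m 1 n \<longleftrightarrow> transpose_mat R *\<^sub>v x = 0\<^sub>v n" if x: "x \<in> carrier_vec m" for x
  proof -
    have "(mat_of_row x * R) $$ (0, j) = (transpose_mat R *\<^sub>v x) $ j" if "j < n" for j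
      using that R x by (auto simp: mat_of_row_def scalar_prod_def mult.commute intro!: sum.cong)
    moreover have "mat_of_row x * R = 0\<^sub>m 1 n \<longleftrightarrow> (\<forall>j<n. (mat_of_row x * R) $$ (0, j) = 0)"
      using R by (auto simp: mat_eq_iff mat_of_row_def)
    moreover have "transpose_mat R *\<^sub>v x = 0\<^sub>v n \<longleftrightarrow> (\<forall>j<n. (transpose_mat R *\<^sub>v x) $ j = 0)"
      using R by (auto simp: vec_eq_iff simp del: index_mult_mat_vec)
    ultimately show ?thesis by auto
  qed
  then show ?thesis using R unfolding left_null_space_def by auto
qed

lemma left_null_space_transpose:
  "R \<in> carrier_mat m n \<Longrightarrow> left_null_space (transpose_mat R) = mat_kernel (R :: 'b::field mat)"
  by (subst left_null_space_alt[of _ n m]) (auto simp: mat_kernel_def)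

text \<open>A minimal basis of the column space and one of the left null space are orthogonal and complementary.\<close>

lemma dual_index_sum:
  fixes R :: "'a::field ratfun mat"
  assumes R: "R \<in> carrier_mat m n" and m: "0 < m"
    and k: "has_minimal_indices m (col_image m n R) k" and v: "has_minimal_indices m (left_null_space R) v"
    and len: "length k + length v = m"
  shows "sum_list v = sum_list k"
proof -
  obtain K where K: "reduced m (length k) K (\<lambda>i. int (k ! i))" "col_image m (length k) K = col_image m n R"
    using has_minimal_indices_reduced[OF m k] by metis
  obtain Y where Y: "reduced m (length v) Y (\<lambda>i. int (v ! i))" "col_image m (length v) Y = left_null_space R"
    using has_minimal_indices_reduced[OF m v] by metis
  have Kc: "K \<in> carrier_mat m (length k)" and Yc: "Y \<in> carrier_mat m (length v)"
    using K(1) Y(1) by (auto simp: reduced_def intro: mats_carrier)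
  obtain C where C: "C \<in> carrier_mat n (length k)" "K = R * C"
    using col_image_subset_factor[OF R Kc] K(2) by blast
  have "transpose_mat R * Y = 0\<^sub>m n (length v)"
  proof (rule mat_col_eqI)
    fix j assume "j < dim_col (0\<^sub>m n (length v) :: 'a ratfun mat)"
    then have j: "j < length v" by simp
    have "col Y j \<in> col_image m (length v) Y"
      unfolding col_image_def using mult_unit_vec[OF Yc j] Yc by (auto intro!: bexI[of _ "unit_vec (length v) j"])
    then have "transpose_mat R *\<^sub>v col Y j = 0\<^sub>v n"
      unfolding Y(2) left_null_space_alt[OF R] by simp
    then show "col (transpose_mat R * Y) j = col (0\<^sub>m n (length v)) j"
      using col_mult2[of "transpose_mat R" n m Y "length v" j] R Yc j by simp
  qed (use R Yc in auto)
  then have "transpose_mat (transpose_mat R * Y) = 0\<^sub>m (length v) n" by simp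
  then have YR: "transpose_mat Y * R = 0\<^sub>m (length v) n"
    using transpose_mult[of "transpose_mat R" n m Y "length v"] R Yc by simp
  have "transpose_mat Y * K = transpose_mat Y * R * C"
    unfolding C(2) using R Yc C(1) by (intro assoc_mult_mat[symmetric]) auto
  then have "transpose_mat Y * K = 0\<^sub>m (length v) (length k)"
    unfolding YR using C(1) by simp
  then have "(\<Sum>i<length k. int (k ! i)) = (\<Sum>i<length v. int (v ! i))"
    by (rule reduced_dual_sum[OF K(1) Y(1) len])
  then have "int (sum_list k) = int (sum_list v)"
    unfolding sum_list_sum_nth atLeast0LessThan by simp
  then show ?thesis by simp
qed

lemma structural_data_necessary:
  fixes R :: "'a::field ratfun mat"
  assumes mn: "0 < m" "0 < n" "r \<le> m" "r \<le> n" and R: "R \<in> carrier_mat m n"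
    and len: "length eps = r" "length q = r" "length k = r" "length l = r" "length d = n - r" "length v = m - r"
    and part: "is_partition k" "is_partition l"
    and data: "has_structural_data R r eps psi q k l d v"
  shows "index_sum_condition k l d v \<and> majorization_condition r eps psi q (reordered_sums k l)"
proof
  have Rt: "transpose_mat R \<in> carrier_mat n m" using R by simp
  have k: "has_minimal_indices m (col_image m n R) k"
    and l: "has_minimal_indices n (col_image n m (transpose_mat R)) l"
    and d: "has_minimal_indices n (left_null_space (transpose_mat R)) d"
    and v: "has_minimal_indices m (left_null_space R) v"
    using data R col_space_col_image[OF R] col_space_col_image[OF Rt] left_null_space_transpose[OF R]
    unfolding has_structural_data_def has_colspan_minimal_indices_def has_rowspan_minimal_indices_def
      has_right_minimal_indices_def has_left_minimal_indices_def by auto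
  show "index_sum_condition k l d v"
    unfolding index_sum_condition_def
    using dual_index_sum[OF R mn(1) k v] dual_index_sum[OF Rt mn(2) l d] len mn by simp
  obtain K where K: "reduced m r K (\<lambda>i. int (rev k ! i))" "col_image m r K = col_image m n R"
    using has_minimal_indices_reduced[OF mn(1) k] len by metis
  obtain L where L: "reduced n r L (\<lambda>i. int (l ! i))" "col_image n r L = col_image n m (transpose_mat R)"
    using has_minimal_indices_reduced[OF mn(2) l] len by metis
  have sk: "sorted (rev k)" using part(1) by (simp add: is_partition_def sorted_wrt_rev)
  have \<kappa>: "int (rev k ! i) \<le> int (rev k ! j)" if "i \<le> j" "j < r" for i j
    using sorted_nth_mono[OF sk that(1)] that len by simp
  have \<mu>: "int (l ! j) \<le> int (l ! i)" if "i \<le> j" "j < r" for i j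
    using part(2) that len unfolding is_partition_def by (cases "i = j") (auto simp: sorted_wrt_iff_nth_less)
  have fr: "has_invariant_rational_functions R eps psi" and inf: "has_invariant_orders_at_infinity R q"
    using data by (auto simp: has_structural_data_def)
  note ineq = structural_inequalities[where \<kappa> = "\<lambda>i. int (rev k ! i)" and \<mu> = "\<lambda>i. int (l ! i)", OF R mn(3,4) K(1) K(2)[symmetric] L(1) L(2)[symmetric] \<kappa> \<mu> fr len(1) inf len(2)]
  show "majorization_condition r eps psi q (reordered_sums k l)"
    unfolding majorization_condition_iff[OF len(3,4)] using ineq by blast
qed

section \<open>Reduced matrices with prescribed column degrees and dual degrees\<close>

text \<open>A reduced matrix \<open>K\<close> with column degrees \<open>k\<close> and a reduced matrix \<open>G\<close> with row degrees \<open>v\<close>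
  and \<open>G K = 0\<close>, together with the one-sided inverses of both over the two subrings. The last
  axioms describe the first row of \<open>K\<close> and the first column of \<open>G\<close>; they make the inductive
  construction possible.\<close>

locale dual_pair =
  fixes m :: nat and k v :: "nat list" and K X Z G U W :: "nat \<Rightarrow> nat \<Rightarrow> 'a::field ratfun" and c :: "'a ratfun"
  assumes K: "i < m \<Longrightarrow> b < length k \<Longrightarrow> K i b \<in> polys"
    and X: "a < length k \<Longrightarrow> i < m \<Longrightarrow> X a i \<in> polys"
    and XK: "a < length k \<Longrightarrow> b < length k \<Longrightarrow> (\<Sum>i<m. X a i * K i b) = (if a = b then 1 else 0)"
    and Kinf: "i < m \<Longrightarrow> b < length k \<Longrightarrow> K i b * spow (- int (k ! b)) \<in> propers"
    and Z: "a < length k \<Longrightarrow> i < m \<Longrightarrow> Z a i \<in> propers"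
    and ZK: "a < length k \<Longrightarrow> b < length k \<Longrightarrow> (\<Sum>i<m. Z a i * K i b) = (if a = b then spow (int (k ! a)) else 0)"
    and G: "a < length v \<Longrightarrow> i < m \<Longrightarrow> G a i \<in> polys"
    and U: "i < m \<Longrightarrow> b < length v \<Longrightarrow> U i b \<in> polys"
    and GU: "a < length v \<Longrightarrow> b < length v \<Longrightarrow> (\<Sum>i<m. G a i * U i b) = (if a = b then 1 else 0)"
    and Ginf: "a < length v \<Longrightarrow> i < m \<Longrightarrow> spow (- int (v ! a)) * G a i \<in> propers"
    and W: "i < m \<Longrightarrow> b < length v \<Longrightarrow> W i b \<in> propers"
    and GW: "a < length v \<Longrightarrow> b < length v \<Longrightarrow> (\<Sum>i<m. G a i * W i b) = (if a = b then spow (int (v ! a)) else 0)"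
    and GK: "a < length v \<Longrightarrow> b < length k \<Longrightarrow> (\<Sum>i<m. G a i * K i b) = 0"
    and K0: "b < length k \<Longrightarrow> K 0 b = (if b = 0 then 1 else 0)"
    and c: "c * c = 1" "c \<in> polys" "c \<in> propers"
    and G0: "a < length v \<Longrightarrow> G a 0 = (if a = 0 then c * spow (int (v ! 0)) else 0)"

lemma spow_propers: "n \<le> 0 \<Longrightarrow> spow n \<in> propers"
  by (simp add: proper_iff_rdeg)

text \<open>If the first degree \<open>v\<^sub>1\<close> is at most \<open>k\<^sub>1\<close>, a new first coordinate shortens \<open>k\<^sub>1\<close> by \<open>v\<^sub>1\<close>: the
  new row of \<open>G\<close> has entries \<open>s\<close> to the power \<open>v\<^sub>1\<close> and \<open>-1\<close> in the two first coordinates.\<close>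

lemma dual_pair_extend_rows:
  fixes K' X' Z' G' U' W' :: "nat \<Rightarrow> nat \<Rightarrow> 'a::field ratfun"
  assumes le: "v1 \<le> k1" and m: "0 < m" and dp: "dual_pair m ((k1 - v1) # ks) vs K' X' Z' G' U' W' c'"
  shows "\<exists>K X Z G U W c. dual_pair (Suc m) (k1 # ks) (v1 # vs) K X Z G U W (c :: 'a ratfun)"
proof -
  interpret d: dual_pair m "(k1 - v1) # ks" vs K' X' Z' G' U' W' c' by (rule dp)
  define f :: "nat \<Rightarrow> 'a ratfun" where "f b = (if b = 0 then spow (int v1) else 1)" for b
  define K where "K i b = (case i of 0 \<Rightarrow> if b = 0 then 1 else 0 | Suc i \<Rightarrow> K' i b * f b)" for i b :: nat
  define X where "X a i = (case i of 0 \<Rightarrow> if a = 0 then 1 else 0 | Suc i \<Rightarrow> if a = 0 then 0 else X' a i)" for a i :: nat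
  define Z where "Z a i = (case i of 0 \<Rightarrow> 0 | Suc i \<Rightarrow> Z' a i)" for a i :: nat
  define G where "G a i = (case a of 0 \<Rightarrow> (case i of 0 \<Rightarrow> spow (int v1) | Suc i \<Rightarrow> if i = 0 then - 1 else 0)
    | Suc a \<Rightarrow> (case i of 0 \<Rightarrow> 0 | Suc i \<Rightarrow> G' a i))" for a i :: nat
  define U where "U i b = (case i of 0 \<Rightarrow> 0 | Suc i \<Rightarrow>
    (case b of 0 \<Rightarrow> - K' i 0 | Suc b \<Rightarrow> U' i b - K' i 0 * U' 0 b))" for i b :: nat
  define W where "W i b = (case i of 0 \<Rightarrow> (case b of 0 \<Rightarrow> 1 | Suc b \<Rightarrow> spow (- int v1) * W' 0 b)
    | Suc i \<Rightarrow> (case b of 0 \<Rightarrow> 0 | Suc b \<Rightarrow> W' i b))" for i b :: nat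
  have len: "length ((k1 - v1) # ks) = length (k1 # ks)" by simp
  have kf: "spow (int ((k1 # ks) ! b)) = spow (int (((k1 - v1) # ks) ! b)) * f b" for b
    using le by (cases b) (simp_all add: f_def spow_add[symmetric])
  have kf': "f b * spow (- int ((k1 # ks) ! b)) = spow (- int (((k1 - v1) # ks) ! b))" for b
    using le by (cases b) (simp_all add: f_def spow_add[symmetric])
  have fp: "f b \<in> polys" for b by (auto simp: f_def intro: spow_mem_polys)
  have Gsum: "(\<Sum>i<Suc m. G a i * y i) = (case a of 0 \<Rightarrow> spow (int v1) * y 0 - y (Suc 0)
      | Suc a \<Rightarrow> (\<Sum>i<m. G' a i * y (Suc i)))" for a y
  proof (cases a)
    case 0
    have "(\<Sum>i<m. (if i = 0 then - 1 else 0) * y (Suc i)) = (\<Sum>i<m. if i = 0 then - y (Suc i) else 0)"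
      by (rule sum.cong) auto
    then show ?thesis using m 0 unfolding sum.lessThan_Suc_shift by (simp add: G_def)
  next
    case (Suc a)
    then show ?thesis unfolding sum.lessThan_Suc_shift by (simp add: G_def)
  qed
  have G'K0: "(\<Sum>i<m. G' a i * K' i b) = 0" if "a < length vs" "b < length (k1 # ks)" for a b
    using d.GK[of a b] that by simp
  have "dual_pair (Suc m) (k1 # ks) (v1 # vs) K X Z G U W 1"
  proof
    fix i b assume i: "i < Suc m" and b: "b < length (k1 # ks)"
    show "K i b \<in> polys"
      using d.K[of "i - 1" b] i b fp by (cases i) (auto simp: K_def intro!: polys.mult_mem)
    show "K i b * spow (- int ((k1 # ks) ! b)) \<in> propers"
    proof (cases i)
      case 0
      then show ?thesis by (auto simp: K_def proper_iff_rdeg)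
    next
      case (Suc i')
      then have "K i b * spow (- int ((k1 # ks) ! b)) = K' i' b * spow (- int (((k1 - v1) # ks) ! b))"
        by (simp only: K_def nat.case mult.assoc kf')
      then show ?thesis using d.Kinf[of i' b] i b Suc by simp
    qed
  next
    fix a i assume a: "a < length (k1 # ks)" and i: "i < Suc m"
    show "X a i \<in> polys" using d.X[of a "i - 1"] a i by (cases i) (auto simp: X_def)
    show "Z a i \<in> propers" using d.Z[of a "i - 1"] a i by (cases i) (auto simp: Z_def proper_iff_rdeg)
  next
    fix a b assume a: "a < length (k1 # ks)" and b: "b < length (k1 # ks)"
    show "(\<Sum>i<Suc m. X a i * K i b) = (if a = b then 1 else 0)"
    proof (cases "a = 0")
      case True
      then show ?thesis unfolding sum.lessThan_Suc_shift by (simp add: X_def K_def)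
    next
      case False
      then have "(\<Sum>i<Suc m. X a i * K i b) = (\<Sum>i<m. X' a i * K' i b) * f b"
        unfolding sum.lessThan_Suc_shift sum_distrib_right by (simp add: X_def K_def mult.assoc)
      then show ?thesis using d.XK[of a b] a b False by (simp add: f_def)
    qed
    have eq: "(\<Sum>i<Suc m. Z a i * K i b) = (\<Sum>i<m. Z' a i * K' i b) * f b"
      unfolding sum.lessThan_Suc_shift sum_distrib_right by (simp add: Z_def K_def mult.assoc)
    show "(\<Sum>i<Suc m. Z a i * K i b) = (if a = b then spow (int ((k1 # ks) ! a)) else 0)"
      unfolding eq using d.ZK[of a b] a b kf[of b] by simp
  next
    fix a i assume a: "a < length (v1 # vs)" and i: "i < Suc m"
    show "G a i \<in> polys"
      using d.G[of "a - 1" "i - 1"] a i spow_mem_polys[of "int v1"] polys.uminus_mem[OF polys.one_mem]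
      by (cases a; cases i) (auto simp: G_def)
    show "spow (- int ((v1 # vs) ! a)) * G a i \<in> propers"
      using d.Ginf[of "a - 1" "i - 1"] a i spow_propers[of "- int v1"] propers.uminus_mem[of "spow (- int v1)"]
      by (cases a; cases i) (auto simp: G_def spow_minus proper_iff_rdeg)
  next
    fix i b assume i: "i < Suc m" and b: "b < length (v1 # vs)"
    show "U i b \<in> polys"
      using d.U[of "i - 1" "b - 1"] d.K[of "i - 1" 0] d.U[of 0 "b - 1"] i b m
      by (cases i; cases b) (auto simp: U_def intro!: polys.diff_mem polys.mult_mem polys.uminus_mem)
    show "W i b \<in> propers"
      using d.W[of "i - 1" "b - 1"] d.W[of 0 "b - 1"] propers.mult_mem[OF spow_propers[of "- int v1"]] i b m
      by (cases i; cases b) (auto simp: W_def proper_iff_rdeg)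
  next
    fix a b assume a: "a < length (v1 # vs)" and b: "b < length (v1 # vs)"
    have K00: "K' 0 0 = 1" using d.K0[of 0] by simp
    show "(\<Sum>i<Suc m. G a i * U i b) = (if a = b then 1 else 0)"
    proof (cases a)
      case 0
      then show ?thesis unfolding Gsum by (cases b) (simp_all add: U_def K00)
    next
      case (Suc a')
      show ?thesis
      proof (cases b)
        case 0
        then show ?thesis unfolding Gsum using G'K0[of a' 0] Suc a by (simp add: U_def sum_negf)
      next
        case (Suc b')
        have "(\<Sum>i<m. G' a' i * (U' i b' - K' i 0 * U' 0 b')) =
            (\<Sum>i<m. G' a' i * U' i b') - (\<Sum>i<m. G' a' i * K' i 0) * U' 0 b'"
          by (simp add: right_diff_distrib sum_subtractf sum_distrib_right mult.assoc)
        then show ?thesis unfolding Gsum using d.GU[of a' b'] G'K0[of a' 0] \<open>a = Suc a'\<close> Suc a b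
          by (simp add: U_def)
      qed
    qed
    show "(\<Sum>i<Suc m. G a i * W i b) = (if a = b then spow (int ((v1 # vs) ! a)) else 0)"
    proof (cases a)
      case 0
      have "spow (int v1) * (spow (- int v1) * y) = y" for y :: "'a ratfun"
        by (simp add: mult.assoc[symmetric] spow_minus)
      then show ?thesis unfolding Gsum using 0 by (cases b) (simp_all add: W_def)
    next
      case (Suc a')
      then show ?thesis unfolding Gsum using d.GW[of a' "b - 1"] a b by (cases b) (simp_all add: W_def)
    qed
  next
    fix a b assume a: "a < length (v1 # vs)" and b: "b < length (k1 # ks)"
    show "(\<Sum>i<Suc m. G a i * K i b) = 0"
    proof (cases a)
      case 0
      then show ?thesis unfolding Gsum using d.K0[of b] b by (simp add: K_def f_def)
    next
      case (Suc a')
      have "(\<Sum>i<m. G' a' i * (K' i b * f b)) = (\<Sum>i<m. G' a' i * K' i b) * f b"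
        by (simp add: sum_distrib_right mult.assoc)
      then show ?thesis unfolding Gsum using G'K0[of a' b] Suc a b by (simp add: K_def)
    qed
  next
    show "K 0 b = (if b = 0 then 1 else 0)" for b by (simp add: K_def)
    show "(1 :: 'a ratfun) * 1 = 1" "(1 :: 'a ratfun) \<in> polys" "(1 :: 'a ratfun) \<in> propers"
      by (simp_all add: proper_iff_rdeg)
    show "G a 0 = (if a = 0 then 1 * spow (int ((v1 # vs) ! 0)) else 0)" for a
      by (cases a) (simp_all add: G_def)
  qed
  then show ?thesis by blast
qed

text \<open>If \<open>k\<^sub>1 < v\<^sub>1\<close>, a new first coordinate shortens \<open>v\<^sub>1\<close> by \<open>k\<^sub>1\<close>. The first row of the old \<open>G\<close>,
  normalized, is the functional \<open>w\<close> that annihilates the old columns and separates off the new one.\<close>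

lemma dual_pair_extend_columns:
  fixes K' X' Z' G' U' W' :: "nat \<Rightarrow> nat \<Rightarrow> 'a::field ratfun"
  assumes le: "k1 \<le> v1" and m: "0 < m" and dp: "dual_pair m ks ((v1 - k1) # vs) K' X' Z' G' U' W' c'"
  shows "\<exists>K X Z G U W c. dual_pair (Suc m) (k1 # ks) (v1 # vs) K X Z G U W (c :: 'a ratfun)"
proof -
  interpret d: dual_pair m ks "(v1 - k1) # vs" K' X' Z' G' U' W' c' by (rule dp)
  define w where "w i = c' * (spow (- int (v1 - k1)) * G' 0 i)" for i
  define K where "K i b = (case i of 0 \<Rightarrow> if b = 0 then 1 else 0
    | Suc i \<Rightarrow> (case b of 0 \<Rightarrow> if i = 0 then spow (int k1) else 0 | Suc b \<Rightarrow> K' i b))" for i b :: nat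
  define X where "X a i = (case a of 0 \<Rightarrow> if i = 0 then 1 else 0
    | Suc a \<Rightarrow> (case i of 0 \<Rightarrow> - spow (int k1) * X' a 0 | Suc i \<Rightarrow> X' a i))" for a i :: nat
  define Z where "Z a i = (case i of 0 \<Rightarrow> 0
    | Suc i \<Rightarrow> (case a of 0 \<Rightarrow> w i | Suc a \<Rightarrow> Z' a i - Z' a 0 * w i))" for a i :: nat
  define G where "G a i = (case i of 0 \<Rightarrow> if a = 0 then - c' * spow (int v1) else 0 | Suc i \<Rightarrow> G' a i)" for a i :: nat
  define U where "U i b = (case i of 0 \<Rightarrow> 0 | Suc i \<Rightarrow> U' i b)" for i b :: nat
  define W where "W i b = (case i of 0 \<Rightarrow> if b = 0 then - c' else 0 | Suc i \<Rightarrow> if b = 0 then 0 else W' i b)" for i b :: nat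
  have Ksum: "(\<Sum>i<Suc m. y i * K i b) = (case b of 0 \<Rightarrow> y 0 + y (Suc 0) * spow (int k1)
      | Suc b \<Rightarrow> (\<Sum>i<m. y (Suc i) * K' i b))" for b y
  proof (cases b)
    case 0
    have "(\<Sum>i<m. y (Suc i) * (if i = 0 then spow (int k1) else 0)) =
        (\<Sum>i<m. if i = 0 then y (Suc i) * spow (int k1) else 0)"
      by (rule sum.cong) auto
    then show ?thesis using m 0 unfolding sum.lessThan_Suc_shift by (simp add: K_def)
  next
    case (Suc b)
    then show ?thesis unfolding sum.lessThan_Suc_shift by (simp add: K_def)
  qed
  have G00: "G' a 0 = (if a = 0 then c' * spow (int (v1 - k1)) else 0)" if "a < length (v1 # vs)" for a
    using d.G0[of a] that by simp
  have w0: "w 0 = 1"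
  proof -
    have "w 0 = c' * c' * (spow (- int (v1 - k1)) * spow (int (v1 - k1)))"
      unfolding w_def using G00[of 0] by (simp add: mult_ac)
    then show ?thesis by (simp only: d.c spow_minus mult_1)
  qed
  have wp: "w i \<in> propers" if "i < m" for i
    unfolding w_def using d.Ginf[of 0 i] that propers.mult_mem[OF d.c(3)] by simp
  have wK: "(\<Sum>i<m. w i * K' i b) = 0" if "b < length ks" for b
  proof -
    have "(\<Sum>i<m. w i * K' i b) = c' * spow (- int (v1 - k1)) * (\<Sum>i<m. G' 0 i * K' i b)"
      unfolding w_def sum_distrib_left by (simp add: mult.assoc)
    then show ?thesis using d.GK[of 0 b] that by simp
  qed
  have sv: "spow (int (v1 - k1)) * spow (int k1) = spow (int v1)"
    using le by (simp add: spow_add[symmetric])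
  have mc: "- c' \<in> polys" "- c' \<in> propers" using d.c polys.uminus_mem propers.uminus_mem by blast+
  have vv: "int ((v1 # vs) ! a) = int (((v1 - k1) # vs) ! a) + (if a = 0 then int k1 else 0)" for a
    using le by (cases a) simp_all
  have "dual_pair (Suc m) (k1 # ks) (v1 # vs) K X Z G U W (- c')"
  proof
    fix i b assume i: "i < Suc m" and b: "b < length (k1 # ks)"
    show "K i b \<in> polys"
      using d.K[of "i - 1" "b - 1"] i b spow_mem_polys[of "int k1"] by (cases i; cases b) (auto simp: K_def)
    show "K i b * spow (- int ((k1 # ks) ! b)) \<in> propers"
      using d.Kinf[of "i - 1" "b - 1"] i b spow_propers[of "- int k1"]
      by (cases i; cases b) (auto simp: K_def spow_minus proper_iff_rdeg)
  next
    fix a i assume a: "a < length (k1 # ks)" and i: "i < Suc m"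
    show "X a i \<in> polys"
      using d.X[of "a - 1" "i - 1"] d.X[of "a - 1" 0] a i m
        polys.uminus_mem[OF polys.mult_mem[OF spow_mem_polys[of "int k1"]]]
      by (cases a; cases i) (auto simp: X_def)
    show "Z a i \<in> propers"
    proof (cases i)
      case 0
      then show ?thesis using propers.zero_mem by (simp add: Z_def)
    next
      case (Suc i')
      then have i': "i' < m" using i by simp
      show ?thesis
      proof (cases a)
        case 0
        then show ?thesis using wp[OF i'] Suc by (simp add: Z_def)
      next
        case (Suc a')
        have "Z' a' i' - Z' a' 0 * w i' \<in> propers"
          using d.Z[of a' i'] d.Z[of a' 0] wp[OF i'] Suc a i' m
          by (intro propers.diff_mem propers.mult_mem) auto
        then show ?thesis using Suc \<open>i = Suc i'\<close> by (simp add: Z_def)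
      qed
    qed
  next
    fix a b assume a: "a < length (k1 # ks)" and b: "b < length (k1 # ks)"
    show "(\<Sum>i<Suc m. X a i * K i b) = (if a = b then 1 else 0)"
      unfolding Ksum using d.XK[of "a - 1" "b - 1"] a b
      by (cases a; cases b) (simp_all add: X_def)
    show "(\<Sum>i<Suc m. Z a i * K i b) = (if a = b then spow (int ((k1 # ks) ! a)) else 0)"
    proof (cases a)
      case 0
      then show ?thesis unfolding Ksum using wK[of "b - 1"] b by (cases b) (simp_all add: Z_def w0)
    next
      case (Suc a')
      show ?thesis
      proof (cases b)
        case 0
        then show ?thesis unfolding Ksum using Suc by (simp add: Z_def w0)
      next
        case b': (Suc b')
        have "(\<Sum>i<m. (Z' a' i - Z' a' 0 * w i) * K' i b') =
            (\<Sum>i<m. Z' a' i * K' i b') - Z' a' 0 * (\<Sum>i<m. w i * K' i b')"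
          by (simp add: left_diff_distrib sum_subtractf sum_distrib_left mult.assoc)
        then show ?thesis unfolding Ksum using d.ZK[of a' b'] wK[of b'] Suc b' a b by (simp add: Z_def)
      qed
    qed
  next
    fix a i assume a: "a < length (v1 # vs)" and i: "i < Suc m"
    show "G a i \<in> polys"
      using d.G[of a "i - 1"] a i polys.mult_mem[OF mc(1) spow_mem_polys[of "int v1"]]
      by (cases i) (auto simp: G_def)
    show "spow (- int ((v1 # vs) ! a)) * G a i \<in> propers"
    proof (cases i)
      case 0
      have "spow (- int v1) * (- c' * spow (int v1)) = - c' * (spow (- int v1) * spow (int v1))"
        by (simp only: mult_ac)
      also have "\<dots> = - c'" by (simp only: spow_minus mult_1_right)
      finally have *: "spow (- int v1) * (- c' * spow (int v1)) = - c'" .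
      show ?thesis
      proof (cases "a = 0")
        case True
        have "spow (- int ((v1 # vs) ! a)) * G a i = - c'"
          using * unfolding 0 True by (simp only: G_def nat.case if_True nth_Cons_0 simp_thms)
        then show ?thesis using mc(2) by simp
      qed (simp add: 0 G_def proper_iff_rdeg)
    next
      case (Suc i')
      have eq: "spow (- int ((v1 # vs) ! a)) = spow (- (if a = 0 then int k1 else 0)) * spow (- int (((v1 - k1) # vs) ! a))"
        unfolding vv by (simp only: spow_add[symmetric] minus_add_distrib add.commute)
      have "spow (- int ((v1 # vs) ! a)) * G a i =
          spow (- (if a = 0 then int k1 else 0)) * (spow (- int (((v1 - k1) # vs) ! a)) * G' a i')"
        unfolding eq using Suc by (simp only: G_def nat.case mult.assoc)
      moreover have "spow (- (if a = 0 then int k1 else 0)) \<in> (propers :: 'a ratfun set)" by (rule spow_propers) simp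
      moreover have "spow (- int (((v1 - k1) # vs) ! a)) * G' a i' \<in> propers"
        using d.Ginf[of a i'] a i Suc by simp
      ultimately show ?thesis by (simp only: propers.mult_mem)
    qed
  next
    fix i b assume i: "i < Suc m" and b: "b < length (v1 # vs)"
    show "U i b \<in> polys" using d.U[of "i - 1" b] i b by (cases i) (auto simp: U_def)
    show "W i b \<in> propers"
      using d.W[of "i - 1" b] mc(2) propers.zero_mem i b by (cases i) (auto simp: W_def)
  next
    fix a b assume a: "a < length (v1 # vs)" and b: "b < length (v1 # vs)"
    show "(\<Sum>i<Suc m. G a i * U i b) = (if a = b then 1 else 0)"
      unfolding sum.lessThan_Suc_shift using d.GU[of a b] a b by (simp add: G_def U_def)
    show "(\<Sum>i<Suc m. G a i * W i b) = (if a = b then spow (int ((v1 # vs) ! a)) else 0)"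
    proof (cases "b = 0")
      case True
      have "- c' * spow (int v1) * - c' = c' * c' * spow (int v1)" by (simp add: mult_ac)
      then have "- c' * spow (int v1) * - c' = spow (int v1)" by (simp only: d.c mult_1)
      then show ?thesis unfolding sum.lessThan_Suc_shift using True by (simp add: G_def W_def)
    next
      case False
      then show ?thesis unfolding sum.lessThan_Suc_shift using d.GW[of a b] a b
        by (cases a) (simp_all add: G_def W_def)
    qed
  next
    fix a b assume a: "a < length (v1 # vs)" and b: "b < length (k1 # ks)"
    show "(\<Sum>i<Suc m. G a i * K i b) = 0"
    proof (cases b)
      case 0
      have "c' * spow (int (v1 - k1)) * spow (int k1) = c' * spow (int v1)" by (simp only: mult.assoc sv)
      then show ?thesis unfolding Ksum using 0 G00[OF a] by (simp add: G_def)
    next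
      case (Suc b')
      then show ?thesis unfolding Ksum using d.GK[of a b'] a b by (simp add: G_def)
    qed
  next
    show "K 0 b = (if b = 0 then 1 else 0)" for b by (simp add: K_def)
    show "- c' * - c' = 1" "- c' \<in> polys" "- c' \<in> propers" using d.c mc by simp_all
    show "G a 0 = (if a = 0 then - c' * spow (int ((v1 # vs) ! 0)) else 0)" for a
      by (simp add: G_def)
  qed
  then show ?thesis by blast
qed

text \<open>Cutting the interval from 0 to the common sum into intervals of lengths \<open>k\<^sub>i\<close> and into intervals
  of lengths \<open>v\<^sub>j\<close>, the induction removes the shorter one of the two first intervals. The end points of
  all intervals are the coordinates.\<close>

lemma dual_pair_exists:
  "k \<noteq> [] \<Longrightarrow> sum_list k = sum_list v \<Longrightarrow>
    \<exists>K X Z G U W c. dual_pair (length k + length v) k v K X Z G U W (c :: 'a::field ratfun)"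
proof (induction "length k + length v" arbitrary: k v rule: less_induct)
  case less
  obtain k1 ks where k: "k = k1 # ks" using less.prems by (cases k) auto
  show ?case
  proof (cases v)
    case Nil
    then have k0: "k ! b = 0" if "b < length k" for b
      using less.prems that by simp
    let ?I = "\<lambda>i j :: nat. if i = j then 1 else (0 :: 'a ratfun)"
    have "(\<Sum>i<length k. ?I a i * ?I i b) = ?I a b" if "a < length k" for a b
    proof -
      have "(\<Sum>i<length k. ?I a i * ?I i b) = (\<Sum>i<length k. if i = a then ?I i b else 0)"
        by (rule sum.cong) auto
      then show ?thesis using that by simp
    qed
    then have "dual_pair (length k) k [] ?I ?I ?I ?I ?I ?I 1"
      using k0 by unfold_locales (auto simp: proper_iff_rdeg)
    then show ?thesis unfolding Nil list.size add_0_right by (intro exI)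
  next
    case v: (Cons v1 vs)
    show ?thesis
    proof (cases "v1 \<le> k1")
      case True
      have "\<exists>K X Z G U W c. dual_pair (length ((k1 - v1) # ks) + length vs) ((k1 - v1) # ks) vs K X Z G U W (c :: 'a ratfun)"
        by (rule less.hyps) (use True less.prems in \<open>auto simp: k v\<close>)
      then show ?thesis using dual_pair_extend_rows[OF True] unfolding k v by fastforce
    next
      case False
      then have ks: "ks \<noteq> []" using less.prems by (auto simp: k v)
      have "\<exists>K X Z G U W c. dual_pair (length ks + length ((v1 - k1) # vs)) ks ((v1 - k1) # vs) K X Z G U W (c :: 'a ratfun)"
        by (rule less.hyps) (use False ks less.prems in \<open>auto simp: k v\<close>)
      then show ?thesis using dual_pair_extend_columns[of k1 v1] False unfolding k v by fastforce
    qed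
  qed
qed

lemma reduced_dual_exists:
  assumes k: "k \<noteq> []" "sum_list k = sum_list v" and m: "length k + length v = m"
  obtains K Y :: "'a::field ratfun mat"
    where "reduced m (length k) K (\<lambda>i. int (k ! i))" "reduced m (length v) Y (\<lambda>i. int (v ! i))"
      "transpose_mat Y * K = 0\<^sub>m (length v) (length k)"
proof -
  obtain K X Z G U W and c :: "'a ratfun" where dp: "dual_pair m k v K X Z G U W c"
    using dual_pair_exists[OF k] unfolding m by blast
  interpret dual_pair m k v K X Z G U W c by (rule dp)
  let ?r = "length k" and ?r' = "length v"
  define MK where "MK = mat m ?r (\<lambda>(i, j). K i j)"
  define MX where "MX = mat ?r m (\<lambda>(i, j). X i j)"
  define MY where "MY = mat m ?r' (\<lambda>(i, j). G j i)"
  define MU where "MU = mat ?r' m (\<lambda>(i, j). U j i)"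
  have cY: "MY \<in> carrier_mat m ?r'" and cK: "MK \<in> carrier_mat m ?r" by (simp_all add: MY_def MK_def)
  have KD: "MK * sdiag ?r (\<lambda>i. - int (k ! i)) = mat m ?r (\<lambda>(i, j). K i j * spow (- int (k ! j)))"
    by (subst mat_diag_mult_right[OF cK]) (auto simp: MK_def)
  have YD: "MY * sdiag ?r' (\<lambda>i. - int (v ! i)) = mat m ?r' (\<lambda>(i, j). spow (- int (v ! j)) * G j i)"
    by (subst mat_diag_mult_right[OF cY]) (auto simp: MY_def mult.commute)
  have "reduced m ?r MK (\<lambda>i. int (k ! i))"
    unfolding reduced_def
  proof (intro conjI bexI)
    show "MK \<in> mats polys m ?r" "MX \<in> mats polys ?r m" using K X by (auto simp: mats_def MK_def MX_def)
    show "MX * MK = 1\<^sub>m ?r"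
      using XK by (intro eq_matI) (auto simp: MX_def MK_def scalar_prod_def atLeast0LessThan)
    show "MK * sdiag ?r (\<lambda>i. - int (k ! i)) \<in> mats propers m ?r"
      unfolding KD using Kinf by (auto simp: mats_def)
    show "mat ?r m (\<lambda>(i, j). Z i j) \<in> mats propers ?r m" using Z by (auto simp: mats_def)
    have "(\<Sum>i<m. Z a i * (K i b * spow (- int (k ! b)))) = (if a = b then 1 else 0)" if "a < ?r" "b < ?r" for a b
    proof -
      have "(\<Sum>i<m. Z a i * (K i b * spow (- int (k ! b)))) = (\<Sum>i<m. Z a i * K i b) * spow (- int (k ! b))"
        by (simp add: sum_distrib_right mult.assoc)
      then show ?thesis using ZK[OF that] by (simp add: spow_minus)
    qed
    then show "mat ?r m (\<lambda>(i, j). Z i j) * (MK * sdiag ?r (\<lambda>i. - int (k ! i))) = 1\<^sub>m ?r"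
      unfolding KD by (intro eq_matI) (auto simp: scalar_prod_def atLeast0LessThan)
  qed
  moreover have "reduced m ?r' MY (\<lambda>i. int (v ! i))"
    unfolding reduced_def
  proof (intro conjI bexI)
    show "MY \<in> mats polys m ?r'" "MU \<in> mats polys ?r' m" using G U by (auto simp: mats_def MY_def MU_def)
    show "MU * MY = 1\<^sub>m ?r'"
      using GU by (intro eq_matI) (auto simp: MU_def MY_def scalar_prod_def atLeast0LessThan mult.commute)
    show "MY * sdiag ?r' (\<lambda>i. - int (v ! i)) \<in> mats propers m ?r'"
      unfolding YD using Ginf by (auto simp: mats_def)
    show "mat ?r' m (\<lambda>(i, j). W j i) \<in> mats propers ?r' m" using W by (auto simp: mats_def)
    have "(\<Sum>i<m. W i a * (spow (- int (v ! b)) * G b i)) = (if a = b then 1 else 0)" if "a < ?r'" "b < ?r'" for a b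
    proof -
      have "(\<Sum>i<m. W i a * (spow (- int (v ! b)) * G b i)) = spow (- int (v ! b)) * (\<Sum>i<m. G b i * W i a)"
        by (simp add: sum_distrib_left mult_ac)
      then show ?thesis using GW[OF that(2,1)] by (simp add: spow_minus)
    qed
    then show "mat ?r' m (\<lambda>(i, j). W j i) * (MY * sdiag ?r' (\<lambda>i. - int (v ! i))) = 1\<^sub>m ?r'"
      unfolding YD by (intro eq_matI) (auto simp: scalar_prod_def atLeast0LessThan)
  qed
  moreover have "transpose_mat MY * MK = 0\<^sub>m ?r' ?r"
    using GK by (intro eq_matI) (auto simp: MY_def MK_def scalar_prod_def atLeast0LessThan)
  ultimately show ?thesis by (rule that)
qed

section \<open>Square matrices with prescribed structure\<close>

lemma sum_two_terms:
  fixes f :: "nat \<Rightarrow> 'b::field"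
  assumes "p < n" "q < n" "p \<noteq> q"
  shows "(\<Sum>k<n. (if k = p then x else if k = q then y else 0) * f k) = x * f p + y * f q"
proof -
  have "(\<Sum>k<n. (if k = p then x else if k = q then y else 0) * f k) =
    (\<Sum>k\<in>{p, q}. (if k = p then x else if k = q then y else 0) * f k)"
    using assms by (intro sum.mono_neutral_right) auto
  then show ?thesis using assms by simp
qed

lemma sum_one_term:
  fixes f :: "nat \<Rightarrow> 'b::field"
  assumes "p < n"
  shows "(\<Sum>k<n. (if k = p then x else 0) * f k) = x * f p"
proof -
  have "(\<Sum>k<n. (if k = p then x else 0) * f k) = (\<Sum>k<n. if k = p then x * f k else 0)"
    by (rule sum.cong) auto
  then show ?thesis using assms by simp
qed

lemma mult_mat_index:
  fixes A :: "'b::field mat"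
  assumes "A \<in> carrier_mat m k" "B \<in> carrier_mat k n" "i < m" "j < n"
  shows "(A * B) $$ (i, j) = (\<Sum>h<k. A $$ (i, h) * B $$ (h, j))"
  using assms by (auto simp: scalar_prod_def atLeast0LessThan intro: sum.cong)

context coeff_ring
begin

lemma equiv_diag_permute:
  assumes p: "inj_on p {..<n}" "\<And>a. a < n \<Longrightarrow> p a < n"
  shows "equiv_over S n n (mat_diag n d) (mat_diag n (\<lambda>a. d (p a)))"
proof -
  define P :: "'b mat" where "P = mat n n (\<lambda>(a, b). if b = p a then 1 else 0)"
  have P: "P \<in> mats S n n" by (auto simp: P_def mats_def)
  note Pc = P[THEN mats_carrier]
  have mult: "P * X = mat n n (\<lambda>(a, b). X $$ (p a, b))" if X: "X \<in> carrier_mat n n" for X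
  proof (rule eq_matI)
    fix a b assume "a < dim_row (mat n n (\<lambda>(a, b). X $$ (p a, b)))" "b < dim_col (mat n n (\<lambda>(a, b). X $$ (p a, b)))"
    then have ab: "a < n" "b < n" by simp_all
    have "(P * X) $$ (a, b) = (\<Sum>h<n. (if h = p a then 1 else 0) * X $$ (h, b))"
      unfolding mult_mat_index[OF Pc X ab] using ab by (intro sum.cong) (auto simp: P_def)
    also have "\<dots> = 1 * X $$ (p a, b)" by (rule sum_one_term) (rule p(2)[OF ab(1)])
    finally show "(P * X) $$ (a, b) = mat n n (\<lambda>(a, b). X $$ (p a, b)) $$ (a, b)"
      using ab by simp
  qed (use Pc X in auto)
  have "P * transpose_mat P = 1\<^sub>m n"
    unfolding mult[of "transpose_mat P", OF transpose_carrier_mat[THEN iffD2, OF Pc]]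
    using p by (intro eq_matI) (auto simp: P_def dest: inj_onD)
  then have inv: "inv_over S n P (transpose_mat P)"
    by (intro inv_overI P mats_transpose)
  have "P * mat_diag n d * transpose_mat P = mat_diag n (\<lambda>a. d (p a))"
  proof -
    have "mat_diag n d * transpose_mat P = mat n n (\<lambda>(a, b). d a * (if a = p b then 1 else 0))"
      by (subst mat_diag_mult_left[of _ n n]) (auto simp: P_def intro!: eq_matI)
    then have "P * (mat_diag n d * transpose_mat P) = mat_diag n (\<lambda>a. d (p a))"
      using p by (subst mult) (auto simp: mat_diag_def intro!: eq_matI dest: inj_onD)
    moreover have "P * mat_diag n d * transpose_mat P = P * (mat_diag n d * transpose_mat P)"
      using assoc_mult_mat[OF Pc mat_diag_dim transpose_carrier_mat[THEN iffD2, OF Pc]] .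
    ultimately show ?thesis by simp
  qed
  then show ?thesis unfolding equiv_over_def using inv inv_over_sym[OF inv] by blast
qed

text \<open>The entry \<open>\<xi>\<close> in the added row divides both its neighbour \<open>\<xi>z\<close> and the entry \<open>\<xi>w\<close> below it.
  With it as pivot, both are eliminated, and the product \<open>\<xi>zw\<close> appears in the opposite corner.\<close>

lemma equiv_bordered_diag:
  assumes i: "i < r" and z: "z \<in> S" and w: "w \<in> S" and di: "d i = \<xi> * w"
  shows "equiv_over S (Suc r) (Suc r)
    (four_block_mat (mat 1 1 (\<lambda>_. \<xi> * z)) (mat 1 r (\<lambda>(a, j). if j = i then \<xi> else 0)) (0\<^sub>m r 1) (mat_diag r d))
    (mat_diag (Suc r) (\<lambda>j. if j = 0 then \<xi> else if j = Suc i then \<xi> * z * w else d (j - 1)))"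
    (is "equiv_over S ?n ?n ?M (mat_diag ?n ?e)")
proof -
  define A where "A = mat ?n ?n (\<lambda>(a, b). if a = Suc i then (if b = 0 then w else if b = Suc i then - 1 else 0)
    else if b = a then 1 else 0)"
  define B where "B = mat ?n ?n (\<lambda>(a, b). if a = 0 then (if b = 0 then z else if b = Suc i then 1 else 0)
    else if a = Suc i then (if b = 0 then 1 else 0) else if b = a then 1 else 0)"
  define B' where "B' = mat ?n ?n (\<lambda>(a, b). if a = 0 then (if b = Suc i then 1 else 0)
    else if a = Suc i then (if b = 0 then 1 else if b = Suc i then - z else 0) else if b = a then 1 else 0)"
  have m1: "- 1 \<in> S" "- z \<in> S" using z by (auto intro: uminus_mem)
  have A: "A \<in> mats S ?n ?n" and B: "B \<in> mats S ?n ?n" and B': "B' \<in> mats S ?n ?n"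
    using z w m1 by (auto simp: A_def B_def B'_def mats_def)
  note c = A[THEN mats_carrier] B[THEN mats_carrier] B'[THEN mats_carrier]
  have Mc: "?M \<in> carrier_mat ?n ?n"
    using four_block_carrier_mat[of "mat 1 1 (\<lambda>_. \<xi> * z)" 1 1 "mat_diag r d" r r] by simp
  have Amult: "(A * X) $$ (a, b) = (if a = Suc i then w * X $$ (0, b) - X $$ (Suc i, b) else X $$ (a, b))"
    if X: "X \<in> carrier_mat ?n ?n" and ab: "a < ?n" "b < ?n" for X a b
  proof (cases "a = Suc i")
    case True
    have "(A * X) $$ (a, b) = (\<Sum>h<?n. (if h = 0 then w else if h = Suc i then - 1 else 0) * X $$ (h, b))"
      unfolding mult_mat_index[OF c(1) X ab] using ab True by (intro sum.cong) (auto simp: A_def)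
    also have "\<dots> = w * X $$ (0, b) + - 1 * X $$ (Suc i, b)" by (rule sum_two_terms) (use i in auto)
    finally show ?thesis using True by simp
  next
    case False
    have "(A * X) $$ (a, b) = (\<Sum>h<?n. (if h = a then 1 else 0) * X $$ (h, b))"
      unfolding mult_mat_index[OF c(1) X ab] using ab False by (intro sum.cong) (auto simp: A_def)
    also have "\<dots> = 1 * X $$ (a, b)" by (rule sum_one_term) (rule ab(1))
    finally show ?thesis using False by simp
  qed
  have Bmult: "(B * X) $$ (a, b) = (if a = 0 then z * X $$ (0, b) + X $$ (Suc i, b)
      else if a = Suc i then X $$ (0, b) else X $$ (a, b))"
    if X: "X \<in> carrier_mat ?n ?n" and ab: "a < ?n" "b < ?n" for X a b
  proof (cases "a = 0")
    case True
    have "(B * X) $$ (a, b) = (\<Sum>h<?n. (if h = 0 then z else if h = Suc i then 1 else 0) * X $$ (h, b))"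
      unfolding mult_mat_index[OF c(2) X ab] using ab True by (intro sum.cong) (auto simp: B_def)
    also have "\<dots> = z * X $$ (0, b) + 1 * X $$ (Suc i, b)" by (rule sum_two_terms) (use i in auto)
    finally show ?thesis using True by simp
  next
    case False
    define a' where "a' = (if a = Suc i then 0 else a)"
    have "(B * X) $$ (a, b) = (\<Sum>h<?n. (if h = a' then 1 else 0) * X $$ (h, b))"
      unfolding mult_mat_index[OF c(2) X ab] using ab False by (intro sum.cong) (auto simp: B_def a'_def)
    also have "\<dots> = 1 * X $$ (a', b)" by (rule sum_one_term) (use ab in \<open>simp add: a'_def\<close>)
    finally show ?thesis using False by (simp add: a'_def)
  qed
  have "A * A = 1\<^sub>m ?n"
  proof (rule eq_matI)
    fix a b assume "a < dim_row (1\<^sub>m ?n :: 'b mat)" "b < dim_col (1\<^sub>m ?n :: 'b mat)"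
    then have ab: "a < ?n" "b < ?n" by simp_all
    show "(A * A) $$ (a, b) = 1\<^sub>m ?n $$ (a, b)"
      unfolding Amult[OF c(1) ab] using ab i by (auto simp: A_def)
  qed (use c in auto)
  then have invA: "inv_over S ?n A A" by (intro inv_overI A)
  have BB': "B * B' = 1\<^sub>m ?n"
  proof (rule eq_matI)
    fix a b assume "a < dim_row (1\<^sub>m ?n :: 'b mat)" "b < dim_col (1\<^sub>m ?n :: 'b mat)"
    then have ab: "a < ?n" "b < ?n" by simp_all
    show "(B * B') $$ (a, b) = 1\<^sub>m ?n $$ (a, b)"
      unfolding Bmult[OF c(3) ab] using ab i by (auto simp: B'_def)
  qed (use c in auto)
  then have invB: "inv_over S ?n B' B" by (intro inv_over_sym[OF inv_overI] B B')
  have "A * ?M = mat_diag ?n ?e * B"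
  proof (rule eq_matI)
    fix a b assume "a < dim_row (mat_diag ?n ?e * B)" "b < dim_col (mat_diag ?n ?e * B)"
    then have ab: "a < ?n" "b < ?n" unfolding mat_diag_mult_left[OF c(2)] by simp_all
    have "(mat_diag ?n ?e * B) $$ (a, b) = ?e a * B $$ (a, b)"
      unfolding mat_diag_mult_left[OF c(2)] using ab by simp
    also have "\<dots> = (A * ?M) $$ (a, b)"
      unfolding Amult[OF Mc ab] using ab i di
      by (cases a; cases b) (auto simp: B_def mat_diag_def)
    finally show "(A * ?M) $$ (a, b) = (mat_diag ?n ?e * B) $$ (a, b)" by simp
  qed (use c Mc in \<open>auto simp: mat_diag_mult_left[OF c(2)]\<close>)
  then have "A * ?M * B' = mat_diag ?n ?e * B * B'" by simp
  also have "\<dots> = mat_diag ?n ?e * (B * B')" by (rule assoc_mult_mat[OF mat_diag_dim c(2,3)])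
  also have "\<dots> = mat_diag ?n ?e" unfolding BB' by (rule right_mult_one_mat[OF mat_diag_dim])
  finally show ?thesis unfolding equiv_over_def using invA invB by blast
qed

text \<open>One step of the construction: a row \<open>C\<close> and a pivot \<open>\<xi>z\<close> are added to a matrix \<open>M'\<close>. Only
  \<open>C\<close> modulo \<open>\<xi>z\<close> matters, so that the same \<open>C\<close> can serve for both subrings.\<close>

lemma equiv_bordered:
  assumes M': "M' \<in> carrier_mat r r" and P: "inv_over S r P P'" and Q: "inv_over S r Q Q'"
    and diag: "P * M' * Q = mat_diag r d"
    and i: "i < r" and z: "z \<in> S" and w: "w \<in> S" and di: "d i = \<xi> * w"
    and C: "C \<in> carrier_mat 1 r" and \<Phi>: "\<Phi> \<in> mats S 1 r"
    and eq: "\<And>j. j < r \<Longrightarrow> C $$ (0, j) = \<xi> * Q' $$ (i, j) + \<xi> * z * \<Phi> $$ (0, j)"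
  shows "equiv_over S (Suc r) (Suc r) (four_block_mat (mat 1 1 (\<lambda>_. \<xi> * z)) C (0\<^sub>m r 1) M')
    (mat_diag (Suc r) (\<lambda>j. if j < i then d j else if j = i then \<xi> else if j = Suc i then \<xi> * z * w else d (j - 1)))"
proof -
  let ?n = "Suc r"
  let ?x = "mat 1 1 (\<lambda>_. \<xi> * z)"
  let ?M = "four_block_mat ?x C (0\<^sub>m r 1) M'"
  let ?e = "mat 1 r (\<lambda>(a, j). if j = i then \<xi> else 0)"
  note c = inv_over_carrier[OF P] inv_over_carrier[OF Q] \<Phi>[THEN mats_carrier]
  have Mc: "?M \<in> carrier_mat ?n ?n"
    using four_block_carrier_mat[of ?x 1 1 M' r r] M' by simp
  define \<omega> where "\<omega> = \<Phi> * Q"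
  have \<omega>: "\<omega> \<in> mats S 1 r" unfolding \<omega>_def using \<Phi> Q by (auto simp: inv_over_def intro: mult_mats)
  note \<omega>c = \<omega>[THEN mats_carrier]
  have CQ: "(C * Q) $$ (0, b) = (if b = i then \<xi> else 0) + \<xi> * z * \<omega> $$ (0, b)" if b: "b < r" for b
  proof -
    have "(C * Q) $$ (0, b) = (\<Sum>j<r. (\<xi> * Q' $$ (i, j) + \<xi> * z * \<Phi> $$ (0, j)) * Q $$ (j, b))"
      using mult_mat_index[OF C c(3), of 0 b] b eq by simp
    also have "\<dots> = \<xi> * (\<Sum>j<r. Q' $$ (i, j) * Q $$ (j, b)) + \<xi> * z * (\<Sum>j<r. \<Phi> $$ (0, j) * Q $$ (j, b))"
      by (simp add: distrib_right sum.distrib sum_distrib_left mult.assoc)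
    also have "(\<Sum>j<r. \<Phi> $$ (0, j) * Q $$ (j, b)) = \<omega> $$ (0, b)"
      unfolding \<omega>_def using mult_mat_index[OF c(5) c(3), of 0 b] b by simp
    also have "(\<Sum>j<r. Q' $$ (i, j) * Q $$ (j, b)) = (Q' * Q) $$ (i, b)"
      using mult_mat_index[OF c(4) c(3), of i b] b i by simp
    also have "Q' * Q = 1\<^sub>m r" using Q by (simp add: inv_over_def)
    finally show ?thesis using i b by simp
  qed
  let ?P = "four_block_mat (1\<^sub>m 1) (0\<^sub>m 1 r) (0\<^sub>m r 1) P" and ?Q = "four_block_mat (1\<^sub>m 1) (0\<^sub>m 1 r) (0\<^sub>m r 1) Q"
  have PM: "?P * ?M = four_block_mat ?x C (0\<^sub>m r 1) (P * M')"
    using c M' C by (subst mult_four_block_mat[of _ 1 1 _ r _ r _ _ 1 _ r]) auto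
  have PMQ: "?P * ?M * ?Q = four_block_mat ?x (C * Q) (0\<^sub>m r 1) (mat_diag r d)"
    unfolding PM diag[symmetric] using c M' C by (subst mult_four_block_mat[of _ 1 1 _ r _ r _ _ 1 _ r]) auto
  have 1: "equiv_over S ?n ?n ?M (four_block_mat ?x (C * Q) (0\<^sub>m r 1) (mat_diag r d))"
    using equiv_over_mult[OF inv_over_block[OF inv_over_one P, of 1] inv_over_block[OF inv_over_one Q, of 1]] Mc
    unfolding PMQ[symmetric] by simp
  let ?T = "four_block_mat (1\<^sub>m 1) (- \<omega>) (0\<^sub>m r 1) (1\<^sub>m r)"
  let ?T' = "four_block_mat (1\<^sub>m 1) \<omega> (0\<^sub>m r 1) (1\<^sub>m r)"
  have n\<omega>: "- \<omega> \<in> mats S 1 r" using \<omega> by (auto simp: mats_def intro!: uminus_mem)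
  have "\<omega> + - \<omega> = 0\<^sub>m (Suc 0) r" using \<omega>c by auto
  then have "?T * ?T' = 1\<^sub>m ?n"
    using \<omega>c
    by (subst mult_four_block_mat[of _ 1 1 _ r _ r _ _ 1 _ r]) (auto simp: add.commute)
  moreover have "?T \<in> mats S ?n ?n" "?T' \<in> mats S ?n ?n"
    using four_block_mats[of "1\<^sub>m 1" 1 1 "- \<omega>" r "0\<^sub>m r 1" r "1\<^sub>m r"]
      four_block_mats[of "1\<^sub>m 1" 1 1 \<omega> r "0\<^sub>m r 1" r "1\<^sub>m r"] n\<omega> \<omega> by simp_all
  ultimately have T: "inv_over S ?n ?T ?T'" by (intro inv_overI)
  have N: "four_block_mat ?x (C * Q) (0\<^sub>m r 1) (mat_diag r d) \<in> carrier_mat ?n ?n"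
    using four_block_carrier_mat[of ?x 1 1 "mat_diag r d" r r] by simp
  have "four_block_mat ?x (C * Q) (0\<^sub>m r 1) (mat_diag r d) * ?T = four_block_mat ?x ?e (0\<^sub>m r 1) (mat_diag r d)"
  proof -
    have "four_block_mat ?x (C * Q) (0\<^sub>m r 1) (mat_diag r d) * ?T =
        four_block_mat (?x * 1\<^sub>m 1 + C * Q * 0\<^sub>m r 1) (?x * - \<omega> + C * Q * 1\<^sub>m r)
          (0\<^sub>m r 1 * 1\<^sub>m 1 + mat_diag r d * 0\<^sub>m r 1) (0\<^sub>m r 1 * - \<omega> + mat_diag r d * 1\<^sub>m r)"
      using \<omega>c C c(3) by (intro mult_four_block_mat) auto
    moreover have "?x * 1\<^sub>m 1 + C * Q * 0\<^sub>m r 1 = ?x" using C c(3) by auto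
    moreover have "?x * - \<omega> + C * Q * 1\<^sub>m r = ?e"
    proof (rule eq_matI)
      fix a b assume "a < dim_row ?e" "b < dim_col ?e"
      then have ab: "a = 0" "b < r" by simp_all
      have "C * Q * 1\<^sub>m r = C * Q" using C c(3) by simp
      then have "(?x * - \<omega> + C * Q * 1\<^sub>m r) $$ (0, b) = - (\<xi> * z * \<omega> $$ (0, b)) + (C * Q) $$ (0, b)"
        using ab \<omega>c C c(3) by (simp add: scalar_prod_def)
      then show "(?x * - \<omega> + C * Q * 1\<^sub>m r) $$ (a, b) = ?e $$ (a, b)"
        unfolding CQ[OF ab(2)] using ab by simp
    qed (use C c(3) in auto)
    moreover have "0\<^sub>m r 1 * 1\<^sub>m 1 + mat_diag r d * 0\<^sub>m r 1 = (0\<^sub>m r 1 :: 'b mat)"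
      unfolding right_mult_zero_mat[OF mat_diag_dim] by simp
    moreover have "0\<^sub>m r 1 * - \<omega> + mat_diag r d * 1\<^sub>m r = mat_diag r d"
      unfolding right_mult_one_mat[OF mat_diag_dim]
        left_mult_zero_mat[OF uminus_carrier_iff_mat[THEN iffD2, OF \<omega>c]] by (rule left_add_zero_mat[OF mat_diag_dim])
    ultimately show ?thesis by simp
  qed
  moreover have "1\<^sub>m ?n * four_block_mat ?x (C * Q) (0\<^sub>m r 1) (mat_diag r d) * ?T =
      four_block_mat ?x (C * Q) (0\<^sub>m r 1) (mat_diag r d) * ?T"
    using left_mult_one_mat[OF N] by simp
  ultimately have 2: "equiv_over S ?n ?n (four_block_mat ?x (C * Q) (0\<^sub>m r 1) (mat_diag r d))
      (four_block_mat ?x ?e (0\<^sub>m r 1) (mat_diag r d))"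
    unfolding equiv_over_def using inv_over_one T by metis
  let ?f = "\<lambda>j. if j = 0 then \<xi> else if j = Suc i then \<xi> * z * w else d (j - 1)"
  have 3: "equiv_over S ?n ?n (four_block_mat ?x ?e (0\<^sub>m r 1) (mat_diag r d)) (mat_diag ?n ?f)"
    by (rule equiv_bordered_diag[where d = d and \<xi> = \<xi> and w = w, OF i z w di])
  define p where "p j = (if j < i then Suc j else if j = i then 0 else j)" for j
  have "equiv_over S ?n ?n (mat_diag ?n ?f) (mat_diag ?n (\<lambda>j. ?f (p j)))"
    by (rule equiv_diag_permute) (use i in \<open>auto simp: p_def inj_on_def split: if_splits\<close>)
  moreover have "mat_diag ?n (\<lambda>j. ?f (p j)) =
      mat_diag ?n (\<lambda>j. if j < i then d j else if j = i then \<xi> else if j = Suc i then \<xi> * z * w else d (j - 1))"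
    unfolding mat_diag_def by (rule cong_mat) (auto simp: p_def)
  ultimately have 4: "equiv_over S ?n ?n (mat_diag ?n ?f)
      (mat_diag ?n (\<lambda>j. if j < i then d j else if j = i then \<xi> else if j = Suc i then \<xi> * z * w else d (j - 1)))"
    by simp
  have N2: "four_block_mat ?x ?e (0\<^sub>m r 1) (mat_diag r d) \<in> carrier_mat ?n ?n"
    using four_block_carrier_mat[of ?x 1 1 "mat_diag r d" r r] by simp
  show ?thesis
    by (rule equiv_over_trans[OF 1 equiv_over_trans[OF 2 equiv_over_trans[OF 3 4 N2] N] Mc])
qed

end

text \<open>Linear factors are split off one after the other.\<close>

lemma algebraically_closed_factor:
  fixes y :: "'a::field poly"
  assumes ac: "algebraically_closed TYPE('a)" and y: "y \<noteq> 0"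
  shows "d \<le> degree y \<Longrightarrow> \<exists>z w. y = z * w \<and> degree z = d"
proof (induction d)
  case 0
  then show ?case by (intro exI[of _ 1] exI[of _ y]) simp
next
  case (Suc d)
  then obtain z w where zw: "y = z * w" "degree z = d" by auto
  then have nz: "z \<noteq> 0" "w \<noteq> 0" using y by auto
  then have "degree w > 0" using Suc.prems zw degree_mult_eq[of z w] by simp
  then obtain x where "poly w x = 0" using ac unfolding algebraically_closed_def by blast
  then obtain u where u: "w = [:- x, 1:] * u" by (auto simp: poly_eq_0_iff_dvd elim: dvdE)
  have "degree (z * [:- x, 1:]) = Suc d" using nz zw(2) by (subst degree_mult_eq) auto
  moreover have "y = z * [:- x, 1:] * u" unfolding zw(1) u by (simp only: mult.assoc)
  ultimately show ?case by blast
qed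

lemma sdiag_four_block:
  fixes E :: "'a::field ratfun mat"
  assumes E: "E \<in> carrier_mat r r" and C: "C \<in> carrier_mat 1 r"
  shows "sdiag (Suc r) \<kappa> * four_block_mat (mat 1 1 (\<lambda>_. x)) C (0\<^sub>m r 1) E * sdiag (Suc r) l =
    four_block_mat (mat 1 1 (\<lambda>_. spow (\<kappa> 0 + l 0) * x))
      (mat 1 r (\<lambda>(a, j). spow (\<kappa> 0) * C $$ (0, j) * spow (l (Suc j)))) (0\<^sub>m r 1)
      (sdiag r (\<lambda>j. \<kappa> (Suc j)) * E * sdiag r (\<lambda>j. l (Suc j)))"
proof -
  let ?M = "four_block_mat (mat 1 1 (\<lambda>_. x)) C (0\<^sub>m r 1) E"
  have entry: "(sdiag k a * M * sdiag k b) = mat k k (\<lambda>(i, j). spow (a i) * M $$ (i, j) * spow (b j))"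
    if "M \<in> carrier_mat k k" for k a b and M :: "'a ratfun mat"
    by (subst mat_diag_mult_right[OF mult_carrier_mat[OF mat_diag_dim that]], subst mat_diag_mult_left[OF that])
      (auto intro!: eq_matI)
  have Mc: "?M \<in> carrier_mat (Suc r) (Suc r)"
    using four_block_carrier_mat[of "mat 1 1 (\<lambda>_. x)" 1 1 E r r] E by simp
  show ?thesis
    unfolding entry[OF Mc] entry[OF E]
  proof (rule eq_matI)
    fix i j
    let ?F = "four_block_mat (mat 1 1 (\<lambda>_. spow (\<kappa> 0 + l 0) * x))
      (mat 1 r (\<lambda>(a, j). spow (\<kappa> 0) * C $$ (0, j) * spow (l (Suc j)))) (0\<^sub>m r 1)
      (mat r r (\<lambda>(i, j). spow (\<kappa> (Suc i)) * E $$ (i, j) * spow (l (Suc j))))"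
    assume "i < dim_row ?F" "j < dim_col ?F"
    then have "i < Suc r" "j < Suc r" by simp_all
    then show "mat (Suc r) (Suc r) (\<lambda>(i, j). spow (\<kappa> i) * ?M $$ (i, j) * spow (l j)) $$ (i, j) = ?F $$ (i, j)"
      using E C by (cases i; cases j) (auto simp: spow_add)
  qed (use E C in auto)
qed

text \<open>The entry \<open>b\<^sub>0\<close> lies between two consecutive \<open>a\<^sub>i\<close> and \<open>a\<^bsub>i+1\<^esub>\<close>. Replacing these two by
  \<open>a\<^sub>i + a\<^bsub>i+1\<^esub> - b\<^sub>0\<close> keeps the order and the majorization.\<close>

lemma majorization_step:
  fixes a b :: "nat \<Rightarrow> int"
  assumes r: "0 < r"
    and sub: "\<And>S. S \<subseteq> {..<Suc r} \<Longrightarrow> (\<Sum>i<card S. a i) \<le> (\<Sum>j\<in>S. b j)"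
    and tot: "(\<Sum>i<Suc r. a i) = (\<Sum>j<Suc r. b j)"
  obtains i where "i < r" "a i \<le> b 0" "b 0 \<le> a (Suc i)"
    "\<And>a'. (\<And>j. j < i \<Longrightarrow> a' j = a j) \<Longrightarrow> a' i = a i + a (Suc i) - b 0 \<Longrightarrow> (\<And>j. i < j \<Longrightarrow> a' j = a (Suc j)) \<Longrightarrow>
      (\<forall>S \<subseteq> {..<r}. (\<Sum>i<card S. a' i) \<le> (\<Sum>j\<in>S. b (Suc j))) \<and> (\<Sum>i<r. a' i) = (\<Sum>j<r. b (Suc j))"
proof -
  have a0: "a 0 \<le> b 0" using sub[of "{0}"] by simp
  have "(\<Sum>i<card {Suc 0..<Suc r}. a i) \<le> (\<Sum>j\<in>{Suc 0..<Suc r}. b j)" by (rule sub) auto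
  moreover have "(\<Sum>j<Suc r. b j) = b 0 + (\<Sum>j\<in>{Suc 0..<Suc r}. b j)"
    unfolding lessThan_atLeast0 by (rule sum.atLeast_Suc_lessThan) simp
  ultimately have ar: "b 0 \<le> a r" using tot by simp
  define I where "I = {i. i < r \<and> a i \<le> b 0}"
  have I: "finite I" "I \<noteq> {}" using a0 r by (auto simp: I_def)
  define i where "i = Max I"
  have "i \<in> I" and imax: "\<And>j. j \<in> I \<Longrightarrow> j \<le> i" unfolding i_def using I by auto
  then have i: "i < r" "a i \<le> b 0" by (auto simp: I_def)
  have ai: "b 0 \<le> a (Suc i)"
  proof (cases "Suc i < r")
    case True
    then have "Suc i \<notin> I" using imax[of "Suc i"] by auto
    then show ?thesis using True by (auto simp: I_def)
  next
    case False
    then have "Suc i = r" using i by simp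
    then show ?thesis using ar by simp
  qed
  have "(\<forall>S \<subseteq> {..<r}. (\<Sum>i<card S. a' i) \<le> (\<Sum>j\<in>S. b (Suc j))) \<and> (\<Sum>i<r. a' i) = (\<Sum>j<r. b (Suc j))"
    if a': "\<And>j. j < i \<Longrightarrow> a' j = a j" "a' i = a i + a (Suc i) - b 0" "\<And>j. i < j \<Longrightarrow> a' j = a (Suc j)" for a'
  proof -
    have sum': "(\<Sum>j<t. a' j) = (if t \<le> i then \<Sum>j<t. a j else (\<Sum>j<Suc t. a j) - b 0)" for t
    proof (induction t)
      case (Suc t)
      consider "Suc t \<le> i" | "t = i" | "i < t" by linarith
      then show ?case using Suc a' by cases auto
    qed simp
    have "(\<Sum>i<card S. a' i) \<le> (\<Sum>j\<in>S. b (Suc j))" if S: "S \<subseteq> {..<r}" for S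
    proof -
      have fin: "finite S" using S finite_subset by blast
      have re: "(\<Sum>j\<in>Suc ` S. b j) = (\<Sum>j\<in>S. b (Suc j))" "card (Suc ` S) = card S"
        by (simp_all add: sum.reindex card_image)
      show ?thesis
      proof (cases "card S \<le> i")
        case True
        have "Suc ` S \<subseteq> {..<Suc r}" using S by auto
        then show ?thesis using sub[of "Suc ` S"] re sum'[of "card S"] True by simp
      next
        case False
        have "insert 0 (Suc ` S) \<subseteq> {..<Suc r}" using S by auto
        moreover have "card (insert 0 (Suc ` S)) = Suc (card S)" using fin re(2) by simp
        moreover have "(\<Sum>j\<in>insert 0 (Suc ` S). b j) = b 0 + (\<Sum>j\<in>S. b (Suc j))"
          using fin re(1) by simp
        ultimately show ?thesis using sub[of "insert 0 (Suc ` S)"] sum'[of "card S"] False by simp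
      qed
    qed
    moreover have "(\<Sum>i<r. a' i) = (\<Sum>j<r. b (Suc j))"
      using sum'[of r] i tot sum.lessThan_Suc_shift[of b r] by simp
    ultimately show ?thesis by blast
  qed
  then show ?thesis using that[OF i ai] by blast
qed

text \<open>Upper triangular matrices, built by adding one row and column at a time. The diagonal entry takes
  \<open>\<alpha>\<^sub>i z\<close> of the finite structure, with \<open>z\<close> a factor of \<open>\<alpha>\<^bsub>i+1\<^esub> / \<alpha>\<^sub>i\<close>, and the remaining
  excess \<open>e\<close> from the structure at infinity; algebraic closedness provides \<open>z\<close> of any degree. The row
  beside it has to satisfy one congruence modulo polynomial multiples of \<open>\<alpha>\<^sub>i z\<close> and one modulo proper
  multiples of a scaled \<open>\<alpha>\<^sub>i z\<close>; both can be met because the weights \<open>l\<close> decrease.\<close>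

lemma square_matrix_exists:
  fixes \<alpha> :: "nat \<Rightarrow> 'a::field poly" and q \<kappa> l :: "nat \<Rightarrow> int"
  assumes ac: "algebraically_closed TYPE('a)"
  assumes "0 < r"
    and "\<And>i. i < r \<Longrightarrow> \<alpha> i \<noteq> 0"
    and "\<And>i. Suc i < r \<Longrightarrow> \<alpha> i dvd \<alpha> (Suc i)"
    and "\<And>i. Suc i < r \<Longrightarrow> q i \<le> q (Suc i)"
    and "\<And>i j. i \<le> j \<Longrightarrow> j < r \<Longrightarrow> l j \<le> l i"
    and "\<And>S. S \<subseteq> {..<r} \<Longrightarrow> (\<Sum>i<card S. int (degree (\<alpha> i)) + q i) \<le> (\<Sum>j\<in>S. - (\<kappa> j + l j))"
    and "(\<Sum>i<r. int (degree (\<alpha> i)) + q i) = (\<Sum>j<r. - (\<kappa> j + l j))"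
  shows "\<exists>E d. E \<in> mats polys r r \<and> equiv_over polys r r E (mat_diag r (\<lambda>i. to_fract (\<alpha> i))) \<and>
    (\<forall>i<r. d i \<noteq> 0 \<and> rdeg (d i) = - q i) \<and>
    equiv_over propers r r (sdiag r \<kappa> * E * sdiag r l) (mat_diag r d)"
  using assms(2-)
proof (induction r arbitrary: \<alpha> q \<kappa> l)
  case 0
  then show ?case by simp
next
  case (Suc r)
  show ?case
  proof (cases "r = 0")
    case True
    let ?E = "mat_diag 1 (\<lambda>i. to_fract (\<alpha> i))"
    let ?d = "\<lambda>i. spow (\<kappa> i) * (to_fract (\<alpha> i) * spow (l i))"
    have "?E \<in> mats polys 1 1" by (rule polys.mat_diag_mats) simp
    moreover have "sdiag 1 \<kappa> * ?E * sdiag 1 l = mat_diag 1 ?d" by (simp add: mult.assoc)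
    moreover have "rdeg (?d 0) = - q 0" "?d 0 \<noteq> 0"
      using Suc.prems(2)[of 0] Suc.prems(7) True by (simp_all add: rdeg_mult rdeg_to_fract)
    moreover have "equiv_over polys 1 1 ?E ?E" by (rule polys.equiv_over_refl[OF mat_diag_dim])
    moreover have "equiv_over propers 1 1 (mat_diag 1 ?d) (mat_diag 1 ?d)"
      by (rule propers.equiv_over_refl[OF mat_diag_dim])
    moreover have "\<forall>i<1. ?d i \<noteq> 0 \<and> rdeg (?d i) = - q i" using calculation(3,4) by simp
    ultimately show ?thesis unfolding True One_nat_def[symmetric]
      by (intro exI[of _ ?E] exI[of _ ?d] conjI) (simp_all only:)
  next
    case False
    then have r: "0 < r" by simp
    let ?a = "\<lambda>i. int (degree (\<alpha> i)) + q i" and ?b = "\<lambda>j. - (\<kappa> j + l j)"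
    obtain i where i: "i < r" "?a i \<le> ?b 0" "?b 0 \<le> ?a (Suc i)"
      and step: "\<And>a'. (\<And>j. j < i \<Longrightarrow> a' j = ?a j) \<Longrightarrow> a' i = ?a i + ?a (Suc i) - ?b 0 \<Longrightarrow>
        (\<And>j. i < j \<Longrightarrow> a' j = ?a (Suc j)) \<Longrightarrow>
        (\<forall>S \<subseteq> {..<r}. (\<Sum>i<card S. a' i) \<le> (\<Sum>j\<in>S. ?b (Suc j))) \<and> (\<Sum>i<r. a' i) = (\<Sum>j<r. ?b (Suc j))"
      by (rule majorization_step[OF r Suc.prems(6) Suc.prems(7)]) blast+
    obtain y where y: "\<alpha> (Suc i) = \<alpha> i * y" using Suc.prems(3)[of i] i(1) by (auto elim: dvdE)
    have nz: "\<alpha> i \<noteq> 0" "y \<noteq> 0" using Suc.prems(2)[of i] Suc.prems(2)[of "Suc i"] y i(1) by auto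
    then have dy: "degree (\<alpha> (Suc i)) = degree (\<alpha> i) + degree y" unfolding y by (rule degree_mult_eq)
    define N where "N = nat (?b 0 - ?a i)"
    define e where "e = int N - int (min N (degree y))"
    have qi: "q i \<le> q (Suc i)" using Suc.prems(4)[of i] i(1) by simp
    have N: "int N = ?b 0 - ?a i" using i(2) by (simp add: N_def)
    have e: "0 \<le> e" "e \<le> q (Suc i) - q i"
      using i(3) N dy qi by (auto simp: e_def min_def)
    obtain z w where zw: "y = z * w" "degree z = min N (degree y)"
      using algebraically_closed_factor[OF ac nz(2), of "min N (degree y)"] by auto
    have zwnz: "z \<noteq> 0" "w \<noteq> 0" using zw nz(2) by auto
    have dw: "degree y = degree z + degree w" unfolding zw(1) using zwnz by (rule degree_mult_eq)
    have dz: "int (degree z) = ?b 0 - ?a i - e" using N zw(2) by (simp add: e_def)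
    define \<alpha>' where "\<alpha>' j = (if j < i then \<alpha> j else if j = i then \<alpha> i * w else \<alpha> (Suc j))" for j
    define q' where "q' j = (if j < i then q j else if j = i then q (Suc i) - e else q (Suc j))" for j
    have ez: "\<exists>E d. E \<in> mats polys r r \<and> equiv_over polys r r E (mat_diag r (\<lambda>i. to_fract (\<alpha>' i))) \<and>
      (\<forall>i<r. d i \<noteq> 0 \<and> rdeg (d i) = - q' i) \<and>
      equiv_over propers r r (sdiag r (\<lambda>j. \<kappa> (Suc j)) * E * sdiag r (\<lambda>j. l (Suc j))) (mat_diag r d)"
    proof (rule Suc.IH[OF r])
      have st: "(\<forall>S \<subseteq> {..<r}. (\<Sum>i<card S. int (degree (\<alpha>' i)) + q' i) \<le> (\<Sum>j\<in>S. ?b (Suc j))) \<and>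
        (\<Sum>i<r. int (degree (\<alpha>' i)) + q' i) = (\<Sum>j<r. ?b (Suc j))"
      proof (rule step)
        have "degree (\<alpha> i * w) = degree (\<alpha> i) + degree w" using nz(1) zwnz(2) by (rule degree_mult_eq)
        then show "int (degree (\<alpha>' i)) + q' i = ?a i + ?a (Suc i) - ?b 0"
          using dy dw dz by (simp add: \<alpha>'_def q'_def)
      qed (simp_all add: \<alpha>'_def q'_def)
      show "(\<Sum>i<card S. int (degree (\<alpha>' i)) + q' i) \<le> (\<Sum>j\<in>S. ?b (Suc j))" if "S \<subseteq> {..<r}" for S
        using st that by blast
      show "(\<Sum>i<r. int (degree (\<alpha>' i)) + q' i) = (\<Sum>j<r. ?b (Suc j))" using st by blast
      show "\<alpha>' j \<noteq> 0" if "j < r" for j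
        using that Suc.prems(2)[of j] Suc.prems(2)[of "Suc j"] nz zwnz by (simp add: \<alpha>'_def)
      show "\<alpha>' j dvd \<alpha>' (Suc j)" if j: "Suc j < r" for j
      proof -
        consider "Suc j < i" | "Suc j = i" | "j = i" | "i < j" by linarith
        then show ?thesis
        proof cases
          case 2
          then show ?thesis using Suc.prems(3)[of j] j by (auto simp: \<alpha>'_def intro: dvd_mult2)
        next
          case 3
          have "\<alpha> i * w dvd \<alpha> (Suc i)" unfolding y zw(1) by (simp add: mult.left_commute)
          then show ?thesis using 3 Suc.prems(3)[of "Suc i"] j by (auto simp: \<alpha>'_def intro: dvd_trans)
        qed (use Suc.prems(3)[of j] Suc.prems(3)[of "Suc j"] j in \<open>simp_all add: \<alpha>'_def\<close>)
      qed
      show "q' j \<le> q' (Suc j)" if j: "Suc j < r" for j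
      proof -
        consider "Suc j < i" | "Suc j = i" | "j = i" | "i < j" by linarith
        then show ?thesis
          by cases (use Suc.prems(4)[of j] Suc.prems(4)[of "Suc j"] j e qi in \<open>auto simp: q'_def\<close>)
      qed
      show "l (Suc j') \<le> l (Suc j)" if "j \<le> j'" "j' < r" for j j' using Suc.prems(5) that by simp
    qed
    obtain E d where E: "E \<in> mats polys r r" and fin: "equiv_over polys r r E (mat_diag r (\<lambda>i. to_fract (\<alpha>' i)))"
      and d: "\<And>j. j < r \<Longrightarrow> d j \<noteq> 0" "\<And>j. j < r \<Longrightarrow> rdeg (d j) = - q' j"
      and inf: "equiv_over propers r r (sdiag r (\<lambda>j. \<kappa> (Suc j)) * E * sdiag r (\<lambda>j. l (Suc j))) (mat_diag r d)"
      using ez by blast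
    note Ec = E[THEN mats_carrier]
    let ?M' = "sdiag r (\<lambda>j. \<kappa> (Suc j)) * E * sdiag r (\<lambda>j. l (Suc j))"
    have M'c: "?M' \<in> carrier_mat r r" by (rule mult_carrier_mat[OF mult_carrier_mat[OF mat_diag_dim Ec] mat_diag_dim])
    obtain P P' Q Q' where P: "inv_over polys r P P'" and Q: "inv_over polys r Q Q'"
      and PQ: "P * E * Q = mat_diag r (\<lambda>i. to_fract (\<alpha>' i))"
      using fin unfolding equiv_over_def by blast
    obtain A A' B B' where A: "inv_over propers r A A'" and B: "inv_over propers r B B'"
      and AB: "A * ?M' * B = mat_diag r d"
      using inf unfolding equiv_over_def by blast
    define x where "x = to_fract (\<alpha> i) * to_fract z"
    have xnz: "x \<noteq> 0" and dx: "rdeg x = int (degree (\<alpha> i)) + int (degree z)"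
      using nz zwnz by (simp_all add: x_def rdeg_mult rdeg_to_fract)
    \<comment> \<open>Without the correction by \<open>p j\<close>, entry \<open>j\<close> of the new row satisfies the congruence at the finite
      points. Subtracting a polynomial multiple of \<open>x\<close> keeps it. Subtracting \<open>x * g j\<close> would give the exact
      target at infinity, and there a strictly proper error in \<open>g j\<close> is harmless.\<close>
    define g where "g j = (to_fract (\<alpha> i) * Q' $$ (i, j)
      - spow (- \<kappa> 0 - l (Suc j)) * spow (- q i) * B' $$ (i, j)) / x" for j
    have "\<forall>j. \<exists>p. p \<in> polys \<and> (g j - p = 0 \<or> rdeg (g j - p) < 0)" by (metis polynomial_part)
    then obtain p where p: "\<And>j. p j \<in> polys" "\<And>j. g j - p j = 0 \<or> rdeg (g j - p j) < 0" by metis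
    define C where "C = mat 1 r (\<lambda>(a, j). to_fract (\<alpha> i) * Q' $$ (i, j) + x * - p j)"
    have Cc: "C \<in> carrier_mat 1 r" by (simp add: C_def)
    define T where "T = four_block_mat (mat 1 1 (\<lambda>_. x)) C (0\<^sub>m r 1) E"
    have Q'p: "Q' $$ (i, j) \<in> polys" if "j < r" for j using Q i(1) that by (auto simp: inv_over_def mats_def)
    have xp: "x \<in> polys" unfolding x_def by (intro polys.mult_mem) simp_all
    have "C \<in> mats polys 1 r"
      using Q'p xp p(1) unfolding C_def mats_def
      by (auto intro!: polys.add_mem polys.mult_mem polys.uminus_mem)
    then have "T \<in> mats polys (Suc r) (Suc r)"
      using polys.four_block_mats[of "mat 1 1 (\<lambda>_. x)" 1 1 C r "0\<^sub>m r 1" r E] E xp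
      unfolding T_def by (simp add: mats_def)
    moreover have "equiv_over polys (Suc r) (Suc r) T (mat_diag (Suc r) (\<lambda>i. to_fract (\<alpha> i)))"
    proof -
      have "equiv_over polys (Suc r) (Suc r) (four_block_mat (mat 1 1 (\<lambda>_. to_fract (\<alpha> i) * to_fract z)) C (0\<^sub>m r 1) E)
        (mat_diag (Suc r) (\<lambda>j. if j < i then to_fract (\<alpha>' j) else if j = i then to_fract (\<alpha> i)
          else if j = Suc i then to_fract (\<alpha> i) * to_fract z * to_fract w else to_fract (\<alpha>' (j - 1))))"
      proof (rule polys.equiv_bordered[OF Ec P Q PQ i(1) _ _ _ Cc])
        show "mat 1 r (\<lambda>(a, j). - p j) \<in> mats polys 1 r" using p(1) by (auto simp: mats_def intro: polys.uminus_mem)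
        show "C $$ (0, j) = to_fract (\<alpha> i) * Q' $$ (i, j) + to_fract (\<alpha> i) * to_fract z * mat 1 r (\<lambda>(a, j). - p j) $$ (0, j)"
          if "j < r" for j using that by (simp add: C_def x_def)
      qed (simp_all add: \<alpha>'_def)
      moreover have "(\<lambda>j. if j < i then to_fract (\<alpha>' j) else if j = i then to_fract (\<alpha> i)
          else if j = Suc i then to_fract (\<alpha> i) * to_fract z * to_fract w else to_fract (\<alpha>' (j - 1))) =
          (\<lambda>j. to_fract (\<alpha> j))"
        using y zw(1) by (auto simp: fun_eq_iff \<alpha>'_def mult.assoc)
      ultimately show ?thesis unfolding T_def x_def by simp
    qed
    moreover have "\<exists>d. (\<forall>i<Suc r. d i \<noteq> 0 \<and> rdeg (d i) = - q i) \<and>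
      equiv_over propers (Suc r) (Suc r) (sdiag (Suc r) \<kappa> * T * sdiag (Suc r) l) (mat_diag (Suc r) d)"
    proof -
      define z' where "z' = spow (q i) * (spow (\<kappa> 0 + l 0) * x)"
      define w' where "w' = spow (q i) * d i"
      have z'nz: "z' \<noteq> 0" and w'nz: "w' \<noteq> 0" using xnz d(1)[OF i(1)] by (simp_all add: z'_def w'_def)
      have dz': "rdeg z' = - e" using xnz dx dz by (simp add: z'_def rdeg_mult)
      have dw': "rdeg w' = q i - (q (Suc i) - e)" using d[OF i(1)] by (simp add: w'_def rdeg_mult q'_def)
      have sz: "spow (- q i) * z' = spow (\<kappa> 0 + l 0) * x"
        unfolding z'_def by (simp only: mult.assoc[symmetric] spow_minus mult_1)
      have sw: "d i = spow (- q i) * w'"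
        unfolding w'_def by (simp only: mult.assoc[symmetric] spow_minus mult_1)
      define \<Phi> where "\<Phi> = mat 1 r (\<lambda>(a :: nat, j). spow (l (Suc j) - l 0) * (g j - p j))"
      let ?C = "mat 1 r (\<lambda>(a :: nat, j). spow (\<kappa> 0) * C $$ (0, j) * spow (l (Suc j)))"
      let ?d = "\<lambda>j. if j < i then d j else if j = i then spow (- q i)
        else if j = Suc i then spow (- q i) * z' * w' else d (j - 1)"
      have "equiv_over propers (Suc r) (Suc r)
        (four_block_mat (mat 1 1 (\<lambda>_. spow (- q i) * z')) ?C (0\<^sub>m r 1) ?M') (mat_diag (Suc r) ?d)"
      proof (rule propers.equiv_bordered[OF M'c A B AB i(1) _ _ sw])
        show "z' \<in> propers" using dz' e(1) by (simp add: proper_iff_rdeg)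
        show "w' \<in> propers" using dw' e(2) by (simp add: proper_iff_rdeg)
        show "\<Phi> \<in> mats propers 1 r"
        proof -
          have "spow (l (Suc j) - l 0) * (g j - p j) \<in> propers" if "j < r" for j
          proof (rule propers.mult_mem)
            show "spow (l (Suc j) - l 0) \<in> propers" using Suc.prems(5)[of 0 "Suc j"] that by (simp add: proper_iff_rdeg)
            show "g j - p j \<in> propers" using p(2)[of j] by (auto simp: proper_iff_rdeg)
          qed
          then show ?thesis by (auto simp: mats_def \<Phi>_def)
        qed
        show "?C $$ (0, j) = spow (- q i) * B' $$ (i, j) + spow (- q i) * z' * \<Phi> $$ (0, j)" if j: "j < r" for j
        proof -
          let ?u = "spow (\<kappa> 0) * spow (l (Suc j)) :: 'a ratfun"
          have 1: "spow (\<kappa> 0 + l 0) * spow (l (Suc j) - l 0) = ?u"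
            by (simp only: spow_add[symmetric]) simp
          have 2: "?u * spow (- \<kappa> 0 - l (Suc j)) = 1"
            by (simp only: spow_add[symmetric]) simp
          have 3: "x * g j = to_fract (\<alpha> i) * Q' $$ (i, j) - spow (- \<kappa> 0 - l (Suc j)) * spow (- q i) * B' $$ (i, j)"
            using xnz by (simp add: g_def)
          have "spow (- q i) * z' * \<Phi> $$ (0, j) = ?u * (x * g j) - ?u * (x * p j)"
            unfolding sz 1[symmetric] using j by (simp add: \<Phi>_def algebra_simps)
          also have "?u * (x * g j) = ?u * (to_fract (\<alpha> i) * Q' $$ (i, j)) -
              ?u * spow (- \<kappa> 0 - l (Suc j)) * (spow (- q i) * B' $$ (i, j))"
            unfolding 3 by (simp only: right_diff_distrib mult.assoc)
          finally show ?thesis unfolding 2 using j by (simp add: C_def algebra_simps)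
        qed
      qed simp
      moreover have "sdiag (Suc r) \<kappa> * T * sdiag (Suc r) l =
          four_block_mat (mat 1 1 (\<lambda>_. spow (- q i) * z')) ?C (0\<^sub>m r 1) ?M'"
        unfolding T_def sz by (rule sdiag_four_block[OF Ec Cc])
      moreover have "?d j \<noteq> 0 \<and> rdeg (?d j) = - q j" if j: "j < Suc r" for j
      proof -
        consider "j < i" | "j = i" | "j = Suc i" | "Suc i < j" by linarith
        then show ?thesis
        proof cases
          case 1
          then show ?thesis using d[of j] i(1) by (simp add: q'_def)
        next
          case 3
          then show ?thesis using z'nz w'nz dz' dw' by (simp add: rdeg_mult)
        next
          case 4
          then obtain j' where "j = Suc j'" "i < j'" by (cases j) auto
          then show ?thesis using d[of j'] j by (simp add: q'_def)
        qed simp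
      qed
      ultimately show ?thesis by (intro exI[of _ ?d]) simp
    qed
    ultimately show ?thesis by blast
  qed
qed

section \<open>Sufficiency\<close>

lemma inv_over_unimodular:
  fixes P :: "'a::field ratfun mat"
  assumes "inv_over polys n P P'"
  obtains U where "U \<in> carrier_mat n n" "unimodular U" "map_mat to_fract U = P"
proof -
  have lift: "\<exists>U \<in> carrier_mat n n. map_mat to_fract U = M" if M: "M \<in> mats polys n n" for M :: "'a ratfun mat"
  proof -
    have "\<forall>i j. \<exists>a. i < n \<and> j < n \<longrightarrow> M $$ (i, j) = to_fract a" using M by (auto simp: mats_def)
    then obtain a where a: "\<And>i j. i < n \<Longrightarrow> j < n \<Longrightarrow> M $$ (i, j) = to_fract (a i j)" by metis
    have "map_mat to_fract (mat n n (\<lambda>(i, j). a i j)) = M"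
      using a mats_carrier[OF M] by (intro eq_matI) auto
    then show ?thesis by (intro bexI[of _ "mat n n (\<lambda>(i, j). a i j)"]) auto
  qed
  obtain U U' where U: "U \<in> carrier_mat n n" "map_mat to_fract U = P" "U' \<in> carrier_mat n n" "map_mat to_fract U' = P'"
    using assms lift unfolding inv_over_def by metis
  interpret h: comm_ring_hom "to_fract :: 'a poly \<Rightarrow> 'a ratfun"
    by unfold_locales simp_all
  have inj: "A = B" if "map_mat to_fract A = (map_mat to_fract B :: 'a ratfun mat)" for A B :: "'a poly mat"
    using that by (auto simp: mat_eq_iff)
  have "map_mat to_fract (U * U') = (map_mat to_fract (1\<^sub>m n) :: 'a ratfun mat)"
    "map_mat to_fract (U' * U) = (map_mat to_fract (1\<^sub>m n) :: 'a ratfun mat)"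
    using assms U h.mat_hom_mult[OF U(1,3)] h.mat_hom_mult[OF U(3,1)]
    by (simp_all add: h.mat_hom_one inv_over_def)
  then have "U * U' = 1\<^sub>m n" "U' * U = 1\<^sub>m n" using inj by blast+
  then have "unimodular U"
    using U(1,3) unfolding unimodular_def invertible_mat_def inverts_mat_def by auto
  then show ?thesis using that U by blast
qed

lemma inv_over_biproper:
  assumes "inv_over propers n B B'"
  shows "biproper B"
  using assms inv_over_carrier[OF assms] unfolding biproper_def inv_over_def inverts_mat_def
  by (intro conjI exI[of _ B']) (auto simp: mats_def proper_mat_def)

context coeff_ring
begin

lemma equiv_diag_units:
  assumes "\<And>i. i < n \<Longrightarrow> d i \<noteq> 0" "\<And>i. i < n \<Longrightarrow> e i / d i \<in> S" "\<And>i. i < n \<Longrightarrow> d i / e i \<in> S"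
    "\<And>i. i < n \<Longrightarrow> e i \<noteq> 0"
  shows "equiv_over S n n (mat_diag n d) (mat_diag n e)"
proof -
  have "mat_diag n (\<lambda>i. e i / d i) * mat_diag n (\<lambda>i. d i / e i) = 1\<^sub>m n"
    unfolding mat_diag_diag using assms by (auto simp: mat_diag_def intro!: eq_matI)
  then have inv: "inv_over S n (mat_diag n (\<lambda>i. e i / d i)) (mat_diag n (\<lambda>i. d i / e i))"
    using assms by (intro inv_overI mat_diag_mats) auto
  have "mat_diag n (\<lambda>i. e i / d i) * mat_diag n d = mat_diag n e"
    unfolding mat_diag_diag using assms by (auto simp: mat_diag_def intro!: eq_matI)
  then have "mat_diag n (\<lambda>i. e i / d i) * mat_diag n d * 1\<^sub>m n = mat_diag n e"
    using right_mult_one_mat[OF mat_diag_dim] by simp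
  then show ?thesis unfolding equiv_over_def using inv inv_over_one by blast
qed

text \<open>Completing \<open>K\<close> and \<open>L\<close> to invertible matrices turns \<open>K E L\<^sup>T\<close> into \<open>E\<close> bordered by zeros.\<close>

lemma equiv_padded_diag:
  assumes W: "inv_over S m W W'" "W * K = vcat (1\<^sub>m r) (0\<^sub>m r1 r)" and K: "K \<in> carrier_mat m r" and m: "r + r1 = m"
    and V: "inv_over S n V V'" "V * L = vcat (1\<^sub>m r) (0\<^sub>m r2 r)" and L: "L \<in> carrier_mat n r" and n: "r + r2 = n"
    and E: "E \<in> carrier_mat r r" "equiv_over S r r E (mat_diag r d)"
  shows "equiv_over S m n (K * E * transpose_mat L) (padded_diag_mat m n (map d [0..<r]))"
proof -
  obtain P P' Q Q' where P: "inv_over S r P P'" and Q: "inv_over S r Q Q'" and PQ: "P * E * Q = mat_diag r d"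
    using E(2) unfolding equiv_over_def by blast
  note c = inv_over_carrier[OF W(1)] inv_over_carrier[OF V(1)] inv_over_carrier[OF P] inv_over_carrier[OF Q]
  let ?R = "K * E * transpose_mat L"
  have Rc: "?R \<in> carrier_mat m n" using K E L by auto
  let ?v1 = "vcat (1\<^sub>m r) (0\<^sub>m r1 r) :: 'b mat" and ?v2 = "vcat (1\<^sub>m r) (0\<^sub>m r2 r) :: 'b mat"
  have vc: "?v1 \<in> carrier_mat m r" "?v2 \<in> carrier_mat n r"
    using vcat_carrier[of "1\<^sub>m r" r r "0\<^sub>m r1 r" r1] vcat_carrier[of "1\<^sub>m r" r r "0\<^sub>m r2 r" r2] m n by auto
  have tv: "transpose_mat ?v2 = hcat (1\<^sub>m r) (0\<^sub>m r r2)"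
    unfolding vcat_def hcat_def by (subst transpose_four_block_mat[of _ r r _ 0 _ r2]) auto
  have LV: "transpose_mat L * transpose_mat V = transpose_mat ?v2"
    using transpose_mult[of V n n L r] c L V(2) by simp
  have "W * ?R * transpose_mat V = W * K * E * (transpose_mat L * transpose_mat V)"
    using c K E(1) L by (simp add: assoc_mult_mat[of _ m m _ r _ r] assoc_mult_mat[of _ m m _ r _ n]
        assoc_mult_mat[of _ m m _ n _ n] assoc_mult_mat[of _ m r _ r _ n] assoc_mult_mat[of _ m r _ n _ n]
        assoc_mult_mat[of _ r r _ n _ n])
  also have "\<dots> = vcat (1\<^sub>m r) (0\<^sub>m r1 r) * E * hcat (1\<^sub>m r) (0\<^sub>m r r2)" unfolding W(2) LV tv ..
  also have "vcat (1\<^sub>m r) (0\<^sub>m r1 r) * E = vcat E (0\<^sub>m r1 r)"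
    using E(1) by (subst vcat_mult[of _ r r _ r1 _ r]) auto
  also have "vcat E (0\<^sub>m r1 r) * hcat (1\<^sub>m r) (0\<^sub>m r r2) = four_block_mat E (0\<^sub>m r r2) (0\<^sub>m r1 r) (0\<^sub>m r1 r2)"
    using E(1) by (subst vcat_mult_hcat[of _ r r _ r1 _ r _ r2]) auto
  finally have eq: "W * ?R * transpose_mat V = four_block_mat E (0\<^sub>m r r2) (0\<^sub>m r1 r) (0\<^sub>m r1 r2)" .
  have 1: "equiv_over S m n ?R (four_block_mat E (0\<^sub>m r r2) (0\<^sub>m r1 r) (0\<^sub>m r1 r2))"
    unfolding eq[symmetric] by (rule equiv_over_mult[OF W(1) inv_over_transpose[OF V(1)] Rc])
  let ?P = "four_block_mat P (0\<^sub>m r r1) (0\<^sub>m r1 r) (1\<^sub>m r1)" and ?Q = "four_block_mat Q (0\<^sub>m r r2) (0\<^sub>m r2 r) (1\<^sub>m r2)"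
  have "?P * four_block_mat E (0\<^sub>m r r2) (0\<^sub>m r1 r) (0\<^sub>m r1 r2) = four_block_mat (P * E) (0\<^sub>m r r2) (0\<^sub>m r1 r) (0\<^sub>m r1 r2)"
    using c E(1) by (subst mult_four_block_mat[of _ r r _ r1 _ r1 _ _ r _ r2]) auto
  moreover have "four_block_mat (P * E) (0\<^sub>m r r2) (0\<^sub>m r1 r) (0\<^sub>m r1 r2) * ?Q =
      four_block_mat (P * E * Q) (0\<^sub>m r r2) (0\<^sub>m r1 r) (0\<^sub>m r1 r2)"
    using c E(1) by (subst mult_four_block_mat[of _ r r _ r2 _ r1 _ _ r _ r2]) auto
  moreover have "four_block_mat (mat_diag r d) (0\<^sub>m r r2) (0\<^sub>m r1 r) (0\<^sub>m r1 r2) = padded_diag_mat m n (map d [0..<r])"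
    using m n by (intro eq_matI) (auto simp: padded_diag_mat_def mat_diag_def)
  ultimately have eq2: "?P * four_block_mat E (0\<^sub>m r r2) (0\<^sub>m r1 r) (0\<^sub>m r1 r2) * ?Q = padded_diag_mat m n (map d [0..<r])"
    unfolding PQ by simp
  have 2: "equiv_over S m n (four_block_mat E (0\<^sub>m r r2) (0\<^sub>m r1 r) (0\<^sub>m r1 r2)) (padded_diag_mat m n (map d [0..<r]))"
    unfolding eq2[symmetric]
    using inv_over_block[OF P inv_over_one[of r1]] inv_over_block[OF Q inv_over_one[of r2]] m n E(1)
    by (intro equiv_over_mult) auto
  show ?thesis by (rule equiv_over_trans[OF 1 2 Rc])
qed

end

lemma mult_mat_zero_vec: "(A :: 'b::field mat) \<in> carrier_mat m n \<Longrightarrow> A *\<^sub>v 0\<^sub>v n = 0\<^sub>v m"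
  by auto

text \<open>The inverse \<open>[K, U\<^sup>T]\<close> of the unimodular completion decomposes every vector into a part that
  \<open>K\<^sup>T\<close> detects and a part in the image of \<open>Y\<close>.\<close>

lemma reduced_completion:
  fixes K Y :: "'a::field ratfun mat"
  assumes K: "reduced m r K e" and Y: "reduced m r' Y f" and m: "r + r' = m"
    and YK: "transpose_mat Y * K = 0\<^sub>m r' r"
  shows "\<exists>W W'. inv_over polys m W W' \<and> W * K = vcat (1\<^sub>m r) (0\<^sub>m r' r)"
    and "\<exists>W W'. inv_over propers m W W' \<and> W * (K * sdiag r (\<lambda>i. - e i)) = vcat (1\<^sub>m r) (0\<^sub>m r' r)"
    and "{x \<in> carrier_vec m. transpose_mat K *\<^sub>v x = 0\<^sub>v r} = col_image m r' Y"
proof -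
  let ?De = "sdiag r (\<lambda>i. - e i) :: 'a ratfun mat"
  let ?Df = "sdiag r' (\<lambda>i. - f i) :: 'a ratfun mat"
  obtain X Z U V where K': "K \<in> mats polys m r" "X \<in> mats polys r m" "X * K = 1\<^sub>m r"
    "K * ?De \<in> mats propers m r" "Z \<in> mats propers r m" "Z * (K * ?De) = 1\<^sub>m r"
    and Y': "Y \<in> mats polys m r'" "U \<in> mats polys r' m" "Y * ?Df \<in> mats propers m r'" "V \<in> mats propers r' m"
    and YU: "transpose_mat Y * transpose_mat U = 1\<^sub>m r'" and YV: "transpose_mat (Y * ?Df) * transpose_mat V = 1\<^sub>m r'"
    and YK': "transpose_mat (Y * ?Df) * (K * ?De) = 0\<^sub>m r' r"
    using reduced_dual_inverses[OF K Y YK] by metis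
  note c = K'(1)[THEN mats_carrier] K'(2)[THEN mats_carrier] K'(5)[THEN mats_carrier]
    Y'(1)[THEN mats_carrier] Y'(2)[THEN mats_carrier] Y'(4)[THEN mats_carrier]
  note comp = polys.completion[OF K'(1-3) mats_transpose[OF Y'(1)] mats_transpose[OF Y'(2)] YU YK m]
  show "\<exists>W W'. inv_over polys m W W' \<and> W * K = vcat (1\<^sub>m r) (0\<^sub>m r' r)" using comp by blast
  show "\<exists>W W'. inv_over propers m W W' \<and> W * (K * ?De) = vcat (1\<^sub>m r) (0\<^sub>m r' r)"
    using propers.completion[OF K'(4-6) mats_transpose[OF Y'(3)] mats_transpose[OF Y'(4)] YV YK' m] by blast
  let ?T = "X - X * transpose_mat U * transpose_mat Y"
  have Tc: "?T \<in> carrier_mat r m" using c by auto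
  have "hcat K (transpose_mat U) * vcat ?T (transpose_mat Y) = 1\<^sub>m m"
    using comp(1) by (simp add: inv_over_def)
  then have one: "K * ?T + transpose_mat U * transpose_mat Y = 1\<^sub>m m"
    using hcat_mult_vcat[of K m r "transpose_mat U" r' ?T m "transpose_mat Y"] c Tc by simp
  have "transpose_mat ?T * transpose_mat K + Y * U = 1\<^sub>m m"
  proof -
    have "transpose_mat (K * ?T + transpose_mat U * transpose_mat Y) =
      transpose_mat (K * ?T) + transpose_mat (transpose_mat U * transpose_mat Y)"
      using c Tc by (intro transpose_add[of _ m m]) auto
    also have "transpose_mat (K * ?T) = transpose_mat ?T * transpose_mat K"
      by (rule transpose_mult[OF c(1) Tc])
    also have "transpose_mat (transpose_mat U * transpose_mat Y) = Y * U"
      using transpose_mult[of "transpose_mat U" m r' "transpose_mat Y" m] c by simp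
    finally show ?thesis unfolding one by simp
  qed
  note one' = this
  show "{x \<in> carrier_vec m. transpose_mat K *\<^sub>v x = 0\<^sub>v r} = col_image m r' Y"
  proof (intro equalityI subsetI)
    fix x assume "x \<in> {x \<in> carrier_vec m. transpose_mat K *\<^sub>v x = 0\<^sub>v r}"
    then have x: "x \<in> carrier_vec m" "transpose_mat K *\<^sub>v x = 0\<^sub>v r" by auto
    have "x = (transpose_mat ?T * transpose_mat K + Y * U) *\<^sub>v x" unfolding one' using x by simp
    also have "\<dots> = transpose_mat ?T * transpose_mat K *\<^sub>v x + Y * U *\<^sub>v x"
      using c Tc x by (intro add_mult_distrib_mat_vec[of _ m m]) auto
    also have "transpose_mat ?T * transpose_mat K *\<^sub>v x = transpose_mat ?T *\<^sub>v (transpose_mat K *\<^sub>v x)"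
      using c Tc x by (intro assoc_mult_mat_vec[of _ m r _ m]) auto
    also have "\<dots> = 0\<^sub>v m" unfolding x(2) by (rule mult_mat_zero_vec[OF transpose_carrier_mat[THEN iffD2, OF Tc]])
    also have "Y * U *\<^sub>v x = Y *\<^sub>v (U *\<^sub>v x)" using c x by (intro assoc_mult_mat_vec[of _ m r' _ m]) auto
    finally have "Y *\<^sub>v (U *\<^sub>v x) = x" using c x by simp
    then show "x \<in> col_image m r' Y"
      using x(1) mult_mat_vec_carrier[OF c(5) x(1)] unfolding col_image_def by blast
  next
    fix x assume "x \<in> col_image m r' Y"
    then obtain u where u: "x \<in> carrier_vec m" "u \<in> carrier_vec r'" "Y *\<^sub>v u = x" by (auto simp: col_image_def)
    have "transpose_mat (transpose_mat Y * K) = transpose_mat K * Y"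
      using transpose_mult[of "transpose_mat Y" r' m K r] c by simp
    then have KY: "transpose_mat K * Y = 0\<^sub>m r r'" unfolding YK by simp
    have "transpose_mat K *\<^sub>v x = transpose_mat K * Y *\<^sub>v u"
      unfolding u(3)[symmetric] using c u by (intro assoc_mult_mat_vec[symmetric]) auto
    also have "\<dots> = 0\<^sub>v r" unfolding KY using u by auto
    finally show "x \<in> {x \<in> carrier_vec m. transpose_mat K *\<^sub>v x = 0\<^sub>v r}" using u by simp
  qed
qed

text \<open>\<open>E L\<^sup>T\<close> has a right inverse, so that multiplying \<open>K\<close> by it changes neither the column space nor the
  vectors that annihilate the columns.\<close>

lemma subspaces_of_product:
  fixes K E L :: "'b::field mat"
  assumes K: "K \<in> carrier_mat m r" and L: "L \<in> carrier_mat n r" and U: "U \<in> carrier_mat r n" "U * L = 1\<^sub>m r"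
    and E: "E \<in> carrier_mat r r" and F: "F \<in> carrier_mat r r" "E * F = 1\<^sub>m r"
  shows "col_image m n (K * E * transpose_mat L) = col_image m r K"
    and "left_null_space (K * E * transpose_mat L) = {x \<in> carrier_vec m. transpose_mat K *\<^sub>v x = 0\<^sub>v r}"
proof -
  let ?R = "K * E * transpose_mat L"
  have R: "?R \<in> carrier_mat m n" using K E L by auto
  have R': "?R = K * (E * transpose_mat L)" using K E L by (intro assoc_mult_mat) auto
  have LU: "transpose_mat L * transpose_mat U = 1\<^sub>m r" using U L transpose_mult[of U r n L r] by simp
  let ?C = "transpose_mat U * F"
  have C: "?C \<in> carrier_mat n r" using U F by auto
  have KRC: "K = ?R * ?C"
  proof -
    have "?R * ?C = K * E * (transpose_mat L * transpose_mat U) * F"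
      using K E L U F by (simp add: assoc_mult_mat[of _ m r _ r _ n] assoc_mult_mat[of _ m r _ n _ r]
          assoc_mult_mat[of _ r r _ n _ r] assoc_mult_mat[of _ r n _ r _ r] assoc_mult_mat[of _ m r _ r _ r]
          assoc_mult_mat[of _ r r _ r _ r])
    also have "\<dots> = K * (E * F)" unfolding LU using K E F by (simp add: assoc_mult_mat[of _ m r _ r _ r])
    also have "\<dots> = K" unfolding F(2) using K by simp
    finally show ?thesis by simp
  qed
  have ELc: "E * transpose_mat L \<in> carrier_mat r n" using E L by auto
  show "col_image m n ?R = col_image m r K"
    using col_image_mult[OF K ELc] col_image_mult[OF R C] unfolding R'[symmetric] KRC[symmetric] by auto
  show "left_null_space ?R = {x \<in> carrier_vec m. transpose_mat K *\<^sub>v x = 0\<^sub>v r}"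
    unfolding left_null_space_alt[OF R]
  proof (intro Collect_cong conj_cong refl iffI)
    fix x assume x: "x \<in> carrier_vec m" "transpose_mat ?R *\<^sub>v x = 0\<^sub>v n"
    have "transpose_mat K = transpose_mat ?C * transpose_mat ?R"
      using transpose_mult[OF R C] unfolding KRC[symmetric] .
    then have "transpose_mat K *\<^sub>v x = transpose_mat ?C *\<^sub>v (transpose_mat ?R *\<^sub>v x)"
      using assoc_mult_mat_vec[OF transpose_carrier_mat[THEN iffD2, OF C] transpose_carrier_mat[THEN iffD2, OF R] x(1)]
      by (simp only:)
    then show "transpose_mat K *\<^sub>v x = 0\<^sub>v r"
      unfolding x(2) mult_mat_zero_vec[OF transpose_carrier_mat[THEN iffD2, OF C]] .
  next
    fix x assume x: "x \<in> carrier_vec m" "transpose_mat K *\<^sub>v x = 0\<^sub>v r"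
    have "transpose_mat ?R = transpose_mat (E * transpose_mat L) * transpose_mat K"
      unfolding R' by (rule transpose_mult[OF K ELc])
    then have "transpose_mat ?R *\<^sub>v x = transpose_mat (E * transpose_mat L) *\<^sub>v (transpose_mat K *\<^sub>v x)"
      using assoc_mult_mat_vec[OF transpose_carrier_mat[THEN iffD2, OF ELc] transpose_carrier_mat[THEN iffD2, OF K] x(1)]
      by (simp only:)
    then show "transpose_mat ?R *\<^sub>v x = 0\<^sub>v n"
      unfolding x(2) mult_mat_zero_vec[OF transpose_carrier_mat[THEN iffD2, OF ELc]] .
  qed
qed

lemma equiv_diag_right_inverse:
  assumes E: "E \<in> carrier_mat r r" and eq: "equiv_over S r r E (mat_diag r d)" and d: "\<And>i. i < r \<Longrightarrow> d i \<noteq> 0"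
  obtains F where "F \<in> carrier_mat r r" "E * F = 1\<^sub>m r" "F * E = 1\<^sub>m r"
proof -
  obtain P P' Q Q' where P: "inv_over S r P P'" and Q: "inv_over S r Q Q'" and PQ: "P * E * Q = mat_diag r d"
    using eq unfolding equiv_over_def by blast
  note c = inv_over_carrier[OF P] inv_over_carrier[OF Q]
  define D where "D = mat_diag r (\<lambda>i. inverse (d i))"
  have D: "D \<in> carrier_mat r r" by (simp add: D_def)
  have "mat_diag r d * D = 1\<^sub>m r" unfolding D_def mat_diag_diag using d by (auto simp: mat_diag_def intro!: eq_matI)
  then have PD: "P * E * Q * D = 1\<^sub>m r" unfolding PQ .
  have "P * (E * (Q * D)) = 1\<^sub>m r"
    using PD c E D by (simp add: assoc_mult_mat[of _ r r _ r _ r])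
  then have "E * (Q * D) * P = 1\<^sub>m r"
    using mat_mult_left_right_inverse[of P r "E * (Q * D)"] c E D by simp
  then have EF: "E * (Q * D * P) = 1\<^sub>m r" using c E D by (simp add: assoc_mult_mat[of _ r r _ r _ r])
  have F: "Q * D * P \<in> carrier_mat r r" using c D by simp
  show ?thesis using that[OF F EF mat_mult_left_right_inverse[OF E F EF]] .
qed

text \<open>\<open>R = K E L\<^sup>T\<close>, where \<open>K\<close> and \<open>L\<close> come from \<open>reduced_dual_exists\<close> and carry all minimal indices, and
  \<open>E\<close> comes from \<open>square_matrix_exists\<close> and carries the finite structure and that at infinity.\<close>

lemma structural_data_sufficient:
  fixes eps psi :: "'a::field poly list"
  assumes ac: "algebraically_closed TYPE('a)"
    and mn: "0 < m" "0 < n" "0 < r" "r \<le> m" "r \<le> n"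
    and len: "length eps = r" "length psi = r" "length q = r" "length k = r" "length l = r"
      "length d = n - r" "length v = m - r"
    and data: "invariant_fraction_data eps psi" and q: "sorted q"
    and part: "is_partition k" "is_partition l" "is_partition d" "is_partition v"
    and sums: "index_sum_condition k l d v"
    and maj: "majorization_condition r eps psi q (reordered_sums k l)"
  shows "\<exists>R \<in> carrier_mat m n. has_structural_data R r eps psi q k l d v"
proof -
  let ?\<kappa> = "\<lambda>i. int (rev k ! i)" and ?\<mu> = "\<lambda>i. int (l ! i)"
  have nz: "eps ! i \<noteq> 0" "psi ! i \<noteq> 0" if "i < r" for i
    using invariant_fraction_data_nonzero[OF data] that len by auto
  have "\<exists>u. psi ! 0 = psi ! i * u" if "i < r" for i
    using invariant_fraction_data_chain(2)[OF data, of 0 i] that len by (auto elim: dvdE)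
  then obtain u where u: "\<And>i. i < r \<Longrightarrow> psi ! 0 = psi ! i * u i" by metis
  have unz: "u i \<noteq> 0" if "i < r" for i using u[OF that] nz(2)[OF mn(3)] by auto
  define \<alpha> where "\<alpha> i = eps ! i * u i" for i
  define q' where "q' i = q ! i - int (degree (psi ! 0))" for i
  have d\<alpha>: "int (degree (\<alpha> i)) + q' i = int (degree (eps ! i)) - int (degree (psi ! i)) + q ! i" if i: "i < r" for i
  proof -
    have "degree (psi ! 0) = degree (psi ! i) + degree (u i)"
      unfolding u[OF i] using nz(2)[OF i] unz[OF i] by (rule degree_mult_eq)
    moreover have "degree (\<alpha> i) = degree (eps ! i) + degree (u i)"
      unfolding \<alpha>_def using nz(1)[OF i] unz[OF i] by (rule degree_mult_eq)
    ultimately show ?thesis by (simp add: q'_def)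
  qed
  have maj': "(\<Sum>i<card S. int (degree (\<alpha> i)) + q' i) \<le> (\<Sum>j\<in>S. - (?\<kappa> j + ?\<mu> j))" if S: "S \<subseteq> {..<r}" for S
  proof -
    have "card S \<le> r" using S by (metis card_lessThan card_mono finite_lessThan)
    then have "(\<Sum>i<card S. int (degree (\<alpha> i)) + q' i) =
        (\<Sum>i<card S. int (degree (eps ! i)) - int (degree (psi ! i)) + q ! i)"
      by (intro sum.cong d\<alpha>) auto
    also have "\<dots> \<le> - (\<Sum>j\<in>S. ?\<kappa> j + ?\<mu> j)"
      using maj S unfolding majorization_condition_iff[OF len(4,5)] by blast
    finally show ?thesis by (simp only: sum_negf)
  qed
  have tot: "(\<Sum>i<r. int (degree (\<alpha> i)) + q' i) = (\<Sum>j<r. - (?\<kappa> j + ?\<mu> j))"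
  proof -
    have "(\<Sum>i<r. int (degree (\<alpha> i)) + q' i) = (\<Sum>i<r. int (degree (eps ! i)) - int (degree (psi ! i)) + q ! i)"
      by (intro sum.cong d\<alpha>) auto
    also have "\<dots> = - (\<Sum>j<r. ?\<kappa> j + ?\<mu> j)"
      using maj unfolding majorization_condition_iff[OF len(4,5)] by blast
    finally show ?thesis by (simp only: sum_negf)
  qed
  have "\<exists>E \<delta>. E \<in> mats polys r r \<and> equiv_over polys r r E (mat_diag r (\<lambda>i. to_fract (\<alpha> i))) \<and>
    (\<forall>i<r. \<delta> i \<noteq> 0 \<and> rdeg (\<delta> i) = - q' i) \<and> equiv_over propers r r (sdiag r ?\<kappa> * E * sdiag r ?\<mu>) (mat_diag r \<delta>)"
  proof (rule square_matrix_exists[OF ac mn(3) _ _ _ _ maj' tot])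
    show "\<alpha> i \<noteq> 0" if "i < r" for i using nz(1)[OF that] unz[OF that] by (simp add: \<alpha>_def)
    show "\<alpha> i dvd \<alpha> (Suc i)" if i: "Suc i < r" for i
    proof -
      have "psi ! Suc i dvd psi ! i" using invariant_fraction_data_chain(2)[OF data, of i "Suc i"] i len by simp
      then obtain t where t: "psi ! i = psi ! Suc i * t" by (auto elim: dvdE)
      have "psi ! Suc i * (t * u i) = psi ! Suc i * u (Suc i)"
        using u[of i] u[OF i] i t by (metis Suc_lessD mult.assoc)
      then have "u (Suc i) = t * u i" using nz(2)[OF i] by simp
      moreover have "eps ! i dvd eps ! Suc i" using invariant_fraction_data_chain(1)[OF data, of i "Suc i"] i len by simp
      ultimately show ?thesis unfolding \<alpha>_def by (intro mult_dvd_mono) auto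
    qed
    show "q' i \<le> q' (Suc i)" if "Suc i < r" for i
      using sorted_nth_mono[OF q, of i "Suc i"] that len by (simp add: q'_def)
    show "int (l ! j) \<le> int (l ! i)" if "i \<le> j" "j < r" for i j
      using part(2) that len unfolding is_partition_def by (cases "i = j") (auto simp: sorted_wrt_iff_nth_less)
  qed
  then obtain E0 \<delta> where E0: "E0 \<in> mats polys r r" "equiv_over polys r r E0 (mat_diag r (\<lambda>i. to_fract (\<alpha> i)))"
    and \<delta>: "\<And>i. i < r \<Longrightarrow> \<delta> i \<noteq> 0" "\<And>i. i < r \<Longrightarrow> rdeg (\<delta> i) = - q' i"
    and E0inf: "equiv_over propers r r (sdiag r ?\<kappa> * E0 * sdiag r ?\<mu>) (mat_diag r \<delta>)"
    by blast
  note E0c = E0(1)[THEN mats_carrier]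
  \<comment> \<open>Dividing by the common denominator \<open>\<psi>\<^sub>1\<close> turns the polynomials \<open>\<alpha>\<^sub>i\<close> into the prescribed fractions.\<close>
  define c where "c = inverse (to_fract (psi ! 0))"
  have cnz: "c \<noteq> 0" and dc: "rdeg c = - int (degree (psi ! 0))"
    using nz(2)[OF mn(3)] by (simp_all add: c_def rdeg_inverse rdeg_to_fract)
  define E where "E = c \<cdot>\<^sub>m E0"
  have Ec: "E \<in> carrier_mat r r" using E0c by (simp add: E_def)
  have scale: "equiv_over S r r (c \<cdot>\<^sub>m A) (mat_diag r (\<lambda>i. c * f i))"
    if A: "A \<in> carrier_mat r r" "equiv_over S r r A (mat_diag r f)" for S A f
  proof -
    obtain P P' Q Q' where P: "inv_over S r P P'" and Q: "inv_over S r Q Q'" and PQ: "P * A * Q = mat_diag r f"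
      using A(2) unfolding equiv_over_def by blast
    note pc = inv_over_carrier[OF P] inv_over_carrier[OF Q]
    have "P * (c \<cdot>\<^sub>m A) * Q = c \<cdot>\<^sub>m (P * A * Q)"
      using pc A(1) by (simp add: mult_smult_distrib[of _ r r _ r] mult_smult_assoc_mat[of _ r r _ r])
    also have "\<dots> = mat_diag r (\<lambda>i. c * f i)" unfolding PQ by (auto simp: mat_diag_def intro!: eq_matI)
    finally show ?thesis unfolding equiv_over_def using P Q by blast
  qed
  have Efin: "equiv_over polys r r E (mat_diag r (\<lambda>i. c * to_fract (\<alpha> i)))"
    unfolding E_def by (rule scale[OF E0c E0(2)])
  have Einf: "equiv_over propers r r (sdiag r ?\<kappa> * E * sdiag r ?\<mu>) (mat_diag r (\<lambda>i. spow (- (q ! i))))"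
  proof -
    have DEc: "sdiag r ?\<kappa> * E0 * sdiag r ?\<mu> \<in> carrier_mat r r"
      by (rule mult_carrier_mat[OF mult_carrier_mat[OF mat_diag_dim E0c] mat_diag_dim])
    have "sdiag r ?\<kappa> * E * sdiag r ?\<mu> = c \<cdot>\<^sub>m (sdiag r ?\<kappa> * E0 * sdiag r ?\<mu>)"
      unfolding E_def mult_smult_distrib[OF mat_diag_dim E0c]
        mult_smult_assoc_mat[OF mult_carrier_mat[OF mat_diag_dim E0c] mat_diag_dim] ..
    then have 1: "equiv_over propers r r (sdiag r ?\<kappa> * E * sdiag r ?\<mu>) (mat_diag r (\<lambda>i. c * \<delta> i))"
      using scale[OF DEc E0inf] by simp
    have rd: "c * \<delta> i \<noteq> 0" "rdeg (c * \<delta> i) = - (q ! i)" if "i < r" for i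
      using \<delta>[OF that] cnz dc by (simp_all add: rdeg_mult q'_def)
    have 2: "equiv_over propers r r (mat_diag r (\<lambda>i. c * \<delta> i)) (mat_diag r (\<lambda>i. spow (- (q ! i))))"
    proof (rule propers.equiv_diag_units)
      show "c * \<delta> i \<noteq> 0" if "i < r" for i by (rule rd(1)[OF that])
      show "spow (- (q ! i)) / (c * \<delta> i) \<in> propers" if "i < r" for i
        using rdeg_divide[OF spow_nonzero rd(1)[OF that], of "- (q ! i)"] rd(2)[OF that] by (simp add: proper_iff_rdeg)
      show "c * \<delta> i / spow (- (q ! i)) \<in> propers" if "i < r" for i
        using rdeg_divide[OF rd(1)[OF that] spow_nonzero, of "- (q ! i)"] rd(2)[OF that] by (simp add: proper_iff_rdeg)
    qed simp
    have "sdiag r ?\<kappa> * E * sdiag r ?\<mu> \<in> carrier_mat r r"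
      by (rule mult_carrier_mat[OF mult_carrier_mat[OF mat_diag_dim Ec] mat_diag_dim])
    then show ?thesis by (rule propers.equiv_over_trans[OF 1 2])
  qed
  have "c * to_fract (\<alpha> i) \<noteq> 0" if "i < r" for i
    using cnz nz(1)[OF that] unz[OF that] by (simp add: \<alpha>_def)
  then obtain F where F: "F \<in> carrier_mat r r" "E * F = 1\<^sub>m r" "F * E = 1\<^sub>m r"
    using equiv_diag_right_inverse[OF Ec Efin] by blast
  have "rev k \<noteq> []" "sum_list (rev k) = sum_list v" "length (rev k) + length v = m"
    using len mn sums by (auto simp: index_sum_condition_def)
  then obtain K Yk where K: "reduced m r K ?\<kappa>" and Yk: "reduced m (m - r) Yk (\<lambda>i. int (v ! i))"
    and YK: "transpose_mat Yk * K = (0\<^sub>m (m - r) r :: 'a ratfun mat)"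
    using reduced_dual_exists[of "rev k" v m] len by (metis length_rev)
  have "l \<noteq> []" "sum_list l = sum_list d" "length l + length d = n"
    using len mn sums by (auto simp: index_sum_condition_def)
  then obtain L Yl where L: "reduced n r L ?\<mu>" and Yl: "reduced n (n - r) Yl (\<lambda>i. int (d ! i))"
    and YL: "transpose_mat Yl * L = (0\<^sub>m (n - r) r :: 'a ratfun mat)"
    using reduced_dual_exists[of l d n] len by metis
  have m': "r + (m - r) = m" and n': "r + (n - r) = n" using mn by auto
  note compK = reduced_completion[OF K Yk m' YK] and compL = reduced_completion[OF L Yl n' YL]
  obtain XK XL where Kc: "K \<in> carrier_mat m r" and Lc: "L \<in> carrier_mat n r"
    and X: "XK \<in> carrier_mat r m" "XK * K = 1\<^sub>m r" "XL \<in> carrier_mat r n" "XL * L = 1\<^sub>m r"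
    using K L mats_carrier unfolding reduced_def by metis
  define R where "R = K * E * transpose_mat L"
  have R: "R \<in> carrier_mat m n" unfolding R_def using Kc Ec Lc by auto
  have tR: "transpose_mat R = L * transpose_mat E * transpose_mat K"
    unfolding R_def using Kc Ec Lc
    by (simp add: transpose_mult[of _ m r _ n] transpose_mult[of _ m r _ r] transpose_mult[of _ r r _ n] assoc_mult_mat[of _ n r _ r _ m])
  have tEF: "transpose_mat E * transpose_mat F = 1\<^sub>m r"
    using transpose_mult[OF F(1) Ec] F(3) by simp
  have cR: "col_image m n R = col_image m r K" "left_null_space R = col_image m (m - r) Yk"
    unfolding R_def compK(3)[symmetric] by (rule subspaces_of_product[OF Kc Lc X(3,4) Ec F(1,2)])+
  have cRt: "col_image n m (transpose_mat R) = col_image n r L"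
    "left_null_space (transpose_mat R) = col_image n (n - r) Yl"
    unfolding tR compL(3)[symmetric]
    by (rule subspaces_of_product[OF Lc Kc X(1,2) _ _ tEF], use Ec F(1) in simp, use Ec F(1) in simp)+
  have map_nth': "map (\<lambda>i. xs ! i) [0..<length xs] = xs" for xs :: "nat list" by (rule map_nth)
  have ik: "has_minimal_indices m (col_image m n R) k"
    unfolding cR by (rule reduced_has_minimal_indices[OF mn(1) K part(1)]) (use map_nth'[of "rev k"] len in simp)
  have iv: "has_minimal_indices m (left_null_space R) v"
    unfolding cR by (rule reduced_has_minimal_indices[OF mn(1) Yk part(4)]) (use map_nth'[of v] len in simp)
  have il: "has_minimal_indices n (col_image n m (transpose_mat R)) l"
    unfolding cRt by (rule reduced_has_minimal_indices[OF mn(2) L part(2)]) (use map_nth'[of l] len in simp)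
  have id: "has_minimal_indices n (left_null_space (transpose_mat R)) d"
    unfolding cRt by (rule reduced_has_minimal_indices[OF mn(2) Yl part(3)]) (use map_nth'[of d] len in simp)
  have rank: "vec_space.rank m R = r"
  proof -
    obtain bs where bs: "minimal_basis m (col_image m r K) bs" "map vec_degree bs = map (\<lambda>i. rev k ! i) [0..<r]"
      using reduced_minimal_basis[OF mn(1) K] by blast
    have "length bs = r" using arg_cong[OF bs(2), of length] by simp
    moreover have "polynomial_basis m (col_image m r K) bs" using bs(1) by (simp add: minimal_basis_def)
    ultimately show ?thesis using polynomial_basis_length[OF _ R cR(1)] by blast
  qed
  have "has_invariant_rational_functions R eps psi"
  proof -
    obtain W W' V V' where W: "inv_over polys m W W'" "W * K = vcat (1\<^sub>m r) (0\<^sub>m (m - r) r)"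
      and V: "inv_over polys n V V'" "V * L = vcat (1\<^sub>m r) (0\<^sub>m (n - r) r)"
      using compK(1) compL(1) by blast
    have "equiv_over polys m n R (padded_diag_mat m n (map (\<lambda>i. c * to_fract (\<alpha> i)) [0..<r]))"
      unfolding R_def by (rule polys.equiv_padded_diag[OF W Kc m' V Lc n' Ec Efin])
    moreover have "map (\<lambda>i. c * to_fract (\<alpha> i)) [0..<r] = map2 Fract eps psi"
    proof (rule nth_equalityI)
      fix i assume "i < length (map (\<lambda>i. c * to_fract (\<alpha> i)) [0..<r])"
      then have i: "i < r" by simp
      have "c * to_fract (\<alpha> i) = to_fract (eps ! i) / to_fract (psi ! i)"
        unfolding c_def \<alpha>_def u[OF i] using unz[OF i] nz(2)[OF i] by (simp add: field_simps)
      then show "map (\<lambda>i. c * to_fract (\<alpha> i)) [0..<r] ! i = map2 Fract eps psi ! i"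
        using i len by (simp add: Fract_conv_to_fract)
    qed (use len in simp)
    ultimately obtain P P' Q Q' where P: "inv_over polys m P P'" and Q: "inv_over polys n Q Q'"
      and PRQ: "P * R * Q = padded_diag_mat m n (map2 Fract eps psi)"
      unfolding equiv_over_def by auto
    obtain U0 where U0: "U0 \<in> carrier_mat m m" "unimodular U0" "map_mat to_fract U0 = P"
      using inv_over_unimodular[OF P] by blast
    obtain V0 where V0: "V0 \<in> carrier_mat n n" "unimodular V0" "map_mat to_fract V0 = Q"
      using inv_over_unimodular[OF Q] by blast
    have dim: "dim_row R = m" "dim_col R = n" using R by auto
    show ?thesis unfolding has_invariant_rational_functions_def dim rank len(1)
      using data U0 V0 PRQ by blast
  qed
  moreover have "has_invariant_orders_at_infinity R q"
  proof -
    let ?Kd = "K * sdiag r (\<lambda>i. - ?\<kappa> i)" and ?Ld = "L * sdiag r (\<lambda>i. - ?\<mu> i)"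
    obtain W W' V V' where W: "inv_over propers m W W'" "W * ?Kd = vcat (1\<^sub>m r) (0\<^sub>m (m - r) r)"
      and V: "inv_over propers n V V'" "V * ?Ld = vcat (1\<^sub>m r) (0\<^sub>m (n - r) r)"
      using compK(2) compL(2) by blast
    have "equiv_over propers m n R (padded_diag_mat m n (map (\<lambda>i. spow (- (q ! i))) [0..<r]))"
      unfolding R_def scaled_factorization[OF Kc Ec Lc, of ?\<kappa> ?\<mu>]
      by (rule propers.equiv_padded_diag[OF W mult_carrier_mat[OF Kc mat_diag_dim] m' V
            mult_carrier_mat[OF Lc mat_diag_dim] n'
            mult_carrier_mat[OF mult_carrier_mat[OF mat_diag_dim Ec] mat_diag_dim] Einf])
    moreover have "map (\<lambda>i. spow (- (q ! i))) [0..<r] = (map (\<lambda>e. spow (- e)) q :: 'a ratfun list)"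
      using len by (intro nth_equalityI) auto
    ultimately have "equiv_over propers m n R (padded_diag_mat m n (map (\<lambda>e. spow (- e)) q))" by simp
    then obtain P P' Q Q' where P: "inv_over propers m P P'" and Q: "inv_over propers n Q Q'"
      and PRQ: "P * R * Q = padded_diag_mat m n (map (\<lambda>e. spow (- e)) q)"
      unfolding equiv_over_def by blast
    have dim: "dim_row R = m" "dim_col R = n" using R by auto
    show ?thesis unfolding has_invariant_orders_at_infinity_def dim rank len(3) spow_def[symmetric]
      using q PRQ inv_over_biproper[OF P] inv_over_biproper[OF Q] inv_over_carrier(1)[OF P] inv_over_carrier(1)[OF Q]
      by blast
  qed
  ultimately have "has_structural_data R r eps psi q k l d v"
    unfolding has_structural_data_def has_colspan_minimal_indices_def has_rowspan_minimal_indices_def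
      has_right_minimal_indices_def has_left_minimal_indices_def
    using R rank ik iv il id col_space_col_image[OF R] col_space_col_image[of "transpose_mat R" n m]
      left_null_space_transpose[OF R] by simp
  then show ?thesis using R by blast
qed

theorem theorem6p5:
  fixes m n r :: nat
    and eps psi :: "'a::field poly list"
    and q :: "int list"
    and k l d v g :: "nat list"
  assumes "0 < m" "0 < n" "0 < r" "r \<le> min m n"
    and "length eps = r" "length psi = r"
    and "invariant_fraction_data eps psi"
    and "length q = r" "sorted q"
    and "length k = r" "is_partition k"
    and "length l = r" "is_partition l"
    and "length d = n - r" "is_partition d"
    and "length v = m - r" "is_partition v"
    and "g = reordered_sums k l"
  shows "(\<forall>R \<in> carrier_mat m n.
            has_structural_data R r eps psi q k l d v \<longrightarrow>
              index_sum_condition k l d v \<and> majorization_condition r eps psi q g)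
       \<and> (algebraically_closed TYPE('a) \<and>
            index_sum_condition k l d v \<and> majorization_condition r eps psi q g \<longrightarrow>
              (\<exists>R \<in> carrier_mat m n. has_structural_data R r eps psi q k l d v))"
  using assms structural_data_necessary[of m n r _ eps q k l d v psi]
    structural_data_sufficient[of m n r eps psi q k l d v] by auto

end
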